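(* Let $C$ be a left finite Rat-splitting coalgebra over a field $K$. Then the following assertions hold: (i) $C$ is artinian as a left $C$-comodule (equivalently, as a right $C^*$-module). (ii) $C^*$ is a left Noetherian ring. (iii) $C$ has at most countable dimension over $K$. (iv) $C$ is injective as a left $C^*$-module.
   Context: $C$ is a coalgebra over a field $K$ with comultiplication $\Delta(c)=c_1\otimes c_2$ (Sweedler notation) and counit $\varepsilon$; $C^*=\mathrm{Hom}_K(C,K)$ is the dual algebra with convolution product $(fg)(c)=f(c_1)g(c_2)$. Right $C$-comodules are regarded as left $C^*$-modules via $f\cdot m=f(m_1)m_0$, and left $C$-comodules as right $C^*$-modules analogously; in particular $C$ is a left $C^*$-module via $f\cdot c=c_1f(c_2)$ and a right $C^*$-module via $c\cdot f=f(c_1)c_2$. Left $C^*$-modules arising from right $C$-comodules are called rational. For a left $C^*$-module $M$, $\mathrm{Rat}(M)$ is the sum of all rational submodules of $M$; equivalently $m\in\mathrm{Rat}(M)$ iff there are finitely many $m_i\in M$, $c_i\in C$ with $f\cdot m=\sum_i f(c_i)m_i$ for all $f\in C^*$. $C$ is called left finite Rat-splitting if $\mathrm{Rat}(M)$ is a direct summand of $M$ for every finitely generated left $C^*$-module $M$. *)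

theory Defs
  imports Complex_Main "HOL-Library.Poly_Mapping" "HOL-Library.Countable_Set" "HOL-Algebra.Module" "HOL-Algebra.AbelCoset"
begin

section \<open>One-sided modules over a ring\<close>

text \<open>The library locale \<open>module\<close> requires a commutative ring of scalars.  The record type
  \<open>module\<close> and the locale \<open>submodule\<close> make no such assumption and are reused here.
  A right module is also stored in this record: \<open>a \<odot> x\<close> then stands for \<open>x \<cdot> a\<close>.\<close>

locale left_module = R?: ring R + M?: abelian_group M
  for R :: "('r, 'x) ring_scheme" (structure) and M :: "('r, 'm, 'y) module_scheme" (structure) +
  assumes smult_closed:
      "\<lbrakk>a \<in> carrier R; x \<in> carrier M\<rbrakk> \<Longrightarrow> a \<odot>\<^bsub>M\<^esub> x \<in> carrier M"
    and smult_l_distr: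
      "\<lbrakk>a \<in> carrier R; b \<in> carrier R; x \<in> carrier M\<rbrakk> \<Longrightarrow>
        (a \<oplus>\<^bsub>R\<^esub> b) \<odot>\<^bsub>M\<^esub> x = a \<odot>\<^bsub>M\<^esub> x \<oplus>\<^bsub>M\<^esub> b \<odot>\<^bsub>M\<^esub> x"
    and smult_r_distr:
      "\<lbrakk>a \<in> carrier R; x \<in> carrier M; y \<in> carrier M\<rbrakk> \<Longrightarrow>
        a \<odot>\<^bsub>M\<^esub> (x \<oplus>\<^bsub>M\<^esub> y) = a \<odot>\<^bsub>M\<^esub> x \<oplus>\<^bsub>M\<^esub> a \<odot>\<^bsub>M\<^esub> y"
    and smult_assoc:
      "\<lbrakk>a \<in> carrier R; b \<in> carrier R; x \<in> carrier M\<rbrakk> \<Longrightarrow>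
        (a \<otimes>\<^bsub>R\<^esub> b) \<odot>\<^bsub>M\<^esub> x = a \<odot>\<^bsub>M\<^esub> (b \<odot>\<^bsub>M\<^esub> x)"
    and smult_one: "x \<in> carrier M \<Longrightarrow> \<one>\<^bsub>R\<^esub> \<odot>\<^bsub>M\<^esub> x = x"

locale right_module = R?: ring R + M?: abelian_group M
  for R :: "('r, 'x) ring_scheme" (structure) and M :: "('r, 'm, 'y) module_scheme" (structure) +
  assumes smult_closed:
      "\<lbrakk>a \<in> carrier R; x \<in> carrier M\<rbrakk> \<Longrightarrow> a \<odot>\<^bsub>M\<^esub> x \<in> carrier M"
    and smult_l_distr:
      "\<lbrakk>a \<in> carrier R; b \<in> carrier R; x \<in> carrier M\<rbrakk> \<Longrightarrow>
        (a \<oplus>\<^bsub>R\<^esub> b) \<odot>\<^bsub>M\<^esub> x = a \<odot>\<^bsub>M\<^esub> x \<oplus>\<^bsub>M\<^esub> b \<odot>\<^bsub>M\<^esub> x"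
    and smult_r_distr:
      "\<lbrakk>a \<in> carrier R; x \<in> carrier M; y \<in> carrier M\<rbrakk> \<Longrightarrow>
        a \<odot>\<^bsub>M\<^esub> (x \<oplus>\<^bsub>M\<^esub> y) = a \<odot>\<^bsub>M\<^esub> x \<oplus>\<^bsub>M\<^esub> a \<odot>\<^bsub>M\<^esub> y"
    and smult_assoc:
      "\<lbrakk>a \<in> carrier R; b \<in> carrier R; x \<in> carrier M\<rbrakk> \<Longrightarrow>
        (a \<otimes>\<^bsub>R\<^esub> b) \<odot>\<^bsub>M\<^esub> x = b \<odot>\<^bsub>M\<^esub> (a \<odot>\<^bsub>M\<^esub> x)"
    and smult_one: "x \<in> carrier M \<Longrightarrow> \<one>\<^bsub>R\<^esub> \<odot>\<^bsub>M\<^esub> x = x"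

definition generated_submodule ::
    "('r, 'x) ring_scheme \<Rightarrow> ('r, 'm, 'y) module_scheme \<Rightarrow> 'm set \<Rightarrow> 'm set" where
  "generated_submodule R M S = \<Inter>{N. submodule N R M \<and> S \<subseteq> N}"

definition finitely_generated ::
    "('r, 'x) ring_scheme \<Rightarrow> ('r, 'm, 'y) module_scheme \<Rightarrow> bool" where
  "finitely_generated R M \<longleftrightarrow>
    (\<exists>S. finite S \<and> S \<subseteq> carrier M \<and> generated_submodule R M S = carrier M)"

definition direct_summand ::
    "('r, 'x) ring_scheme \<Rightarrow> ('r, 'm, 'y) module_scheme \<Rightarrow> 'm set \<Rightarrow> bool" where
  "direct_summand R M N \<longleftrightarrow> submodule N R M \<and>
    (\<exists>N'. submodule N' R M \<and> N <+>\<^bsub>M\<^esub> N' = carrier M \<and> N \<inter> N' = {\<zero>\<^bsub>M\<^esub>})"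

definition module_homs ::
    "('r, 'x) ring_scheme \<Rightarrow> ('r, 'm, 'y) module_scheme \<Rightarrow> ('r, 'n, 'z) module_scheme
      \<Rightarrow> ('m \<Rightarrow> 'n) set" where
  "module_homs R M N = {h. h \<in> carrier M \<rightarrow> carrier N \<and>
    (\<forall>x\<in>carrier M. \<forall>y\<in>carrier M. h (x \<oplus>\<^bsub>M\<^esub> y) = h x \<oplus>\<^bsub>N\<^esub> h y) \<and>
    (\<forall>a\<in>carrier R. \<forall>x\<in>carrier M. h (a \<odot>\<^bsub>M\<^esub> x) = a \<odot>\<^bsub>N\<^esub> h x)}"

text \<open>The type arguments are the carrier types of the modules \<open>A\<close> and \<open>B\<close> in the extension
  problem.  Injectivity without qualification is obtained by leaving them as free type
  variables in the conclusion of a theorem.\<close>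

definition injective_module ::
    "'a itself \<Rightarrow> 'b itself \<Rightarrow> ('r, 'x) ring_scheme \<Rightarrow> ('r, 'm, 'y) module_scheme \<Rightarrow> bool" where
  "injective_module TYPE('a) TYPE('b) R Q \<longleftrightarrow> left_module R Q \<and>
    (\<forall>(A :: ('r, 'a) module) (B :: ('r, 'b) module) i g.
      left_module R A \<longrightarrow> left_module R B \<longrightarrow>
      i \<in> module_homs R A B \<longrightarrow> inj_on i (carrier A) \<longrightarrow> g \<in> module_homs R A Q \<longrightarrow>
      (\<exists>h \<in> module_homs R B Q. \<forall>x\<in>carrier A. h (i x) = g x))"

definition descending_chain_condition :: "'m set set \<Rightarrow> bool" where
  "descending_chain_condition \<F> \<longleftrightarrow>
    (\<forall>N :: nat \<Rightarrow> 'm set. (\<forall>i. N i \<in> \<F>) \<longrightarrow> (\<forall>i. N (Suc i) \<subseteq> N i) \<longrightarrow>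
      (\<exists>n. \<forall>i\<ge>n. N i = N n))"

definition ascending_chain_condition :: "'m set set \<Rightarrow> bool" where
  "ascending_chain_condition \<F> \<longleftrightarrow>
    (\<forall>N :: nat \<Rightarrow> 'm set. (\<forall>i. N i \<in> \<F>) \<longrightarrow> (\<forall>i. N i \<subseteq> N (Suc i)) \<longrightarrow>
      (\<exists>n. \<forall>i\<ge>n. N i = N n))"

definition artinian_right_module ::
    "('r, 'x) ring_scheme \<Rightarrow> ('r, 'm, 'y) module_scheme \<Rightarrow> bool" where
  "artinian_right_module R M \<longleftrightarrow>
    right_module R M \<and> descending_chain_condition {N. submodule N R M}"

definition regular_left_module :: "('r, 'x) ring_scheme \<Rightarrow> ('r, 'r) module" where
  "regular_left_module R = \<lparr>carrier = carrier R, monoid.mult = undefined, one = undefined,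
    zero = \<zero>\<^bsub>R\<^esub>, add = add R, smult = monoid.mult R\<rparr>"

definition left_noetherian_ring :: "('r, 'x) ring_scheme \<Rightarrow> bool" where
  "left_noetherian_ring R \<longleftrightarrow>
    ring R \<and> ascending_chain_condition {I. submodule I R (regular_left_module R)}"


section \<open>Tensor products of vector spaces\<close>

text \<open>The base field is a type \<open>'k\<close> of class \<open>field\<close>, a vector space with an explicit carrier
  is a record \<open>V\<close> with \<open>module field_ring V\<close>.  The multiplicative fields of the record
  are irrelevant.\<close>

definition field_ring :: "'k::field ring" where
  "field_ring = \<lparr>carrier = UNIV, monoid.mult = (*), one = 1, zero = 0, add = (+)\<rparr>"

definition full_space :: "('k \<Rightarrow> 'v \<Rightarrow> 'v) \<Rightarrow> ('k::field, 'v::ab_group_add) module" where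
  "full_space scale = \<lparr>carrier = UNIV, monoid.mult = undefined, one = undefined,
    zero = 0, add = (+), smult = scale\<rparr>"

text \<open>\<open>V \<otimes> W\<close> is the space of finite formal linear combinations of pairs, modulo the subspace
  spanned by the bilinearity relations; its elements are cosets.\<close>

definition formal_scale :: "'k::field \<Rightarrow> ('a \<Rightarrow>\<^sub>0 'k) \<Rightarrow> ('a \<Rightarrow>\<^sub>0 'k)" where
  "formal_scale k = Poly_Mapping.map ((*) k)"

definition formal_tensors ::
    "('k::field, 'v, 'x) module_scheme \<Rightarrow> ('k, 'w, 'y) module_scheme \<Rightarrow> ('v \<times> 'w \<Rightarrow>\<^sub>0 'k) set" where
  "formal_tensors V W = {x. Poly_Mapping.keys x \<subseteq> carrier V \<times> carrier W}"

definition bilinearity_relations ::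
    "('k::field, 'v, 'x) module_scheme \<Rightarrow> ('k, 'w, 'y) module_scheme \<Rightarrow> ('v \<times> 'w \<Rightarrow>\<^sub>0 'k) set" where
  "bilinearity_relations V W =
    {Poly_Mapping.single (k \<odot>\<^bsub>V\<^esub> v \<oplus>\<^bsub>V\<^esub> v', w) 1
       - (Poly_Mapping.single (v, w) k + Poly_Mapping.single (v', w) 1) | k v v' w.
       v \<in> carrier V \<and> v' \<in> carrier V \<and> w \<in> carrier W}
    \<union> {Poly_Mapping.single (v, k \<odot>\<^bsub>W\<^esub> w \<oplus>\<^bsub>W\<^esub> w') 1
       - (Poly_Mapping.single (v, w) k + Poly_Mapping.single (v, w') 1) | k v w w'.
       v \<in> carrier V \<and> w \<in> carrier W \<and> w' \<in> carrier W}"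

definition tensor_class ::
    "('k::field, 'v, 'x) module_scheme \<Rightarrow> ('k, 'w, 'y) module_scheme
      \<Rightarrow> ('v \<times> 'w \<Rightarrow>\<^sub>0 'k) \<Rightarrow> ('v \<times> 'w \<Rightarrow>\<^sub>0 'k) set" where
  "tensor_class V W x = {y \<in> formal_tensors V W.
    y - x \<in> module.span formal_scale (bilinearity_relations V W)}"

definition tensor_space ::
    "('k::field, 'v, 'x) module_scheme \<Rightarrow> ('k, 'w, 'y) module_scheme
      \<Rightarrow> ('k, ('v \<times> 'w \<Rightarrow>\<^sub>0 'k) set) module" where
  "tensor_space V W = \<lparr>carrier = tensor_class V W ` formal_tensors V W,
    monoid.mult = undefined, one = undefined,
    zero = tensor_class V W 0,
    add = (\<lambda>X Y. \<Union>x\<in>X. \<Union>y\<in>Y. tensor_class V W (x + y)),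
    smult = (\<lambda>k X. \<Union>x\<in>X. tensor_class V W (formal_scale k x))\<rparr>"

definition pure_tensor ::
    "('k::field, 'v, 'x) module_scheme \<Rightarrow> ('k, 'w, 'y) module_scheme
      \<Rightarrow> 'v \<Rightarrow> 'w \<Rightarrow> ('v \<times> 'w \<Rightarrow>\<^sub>0 'k) set" where
  "pure_tensor V W v w = tensor_class V W (Poly_Mapping.single (v, w) 1)"

text \<open>The linear map \<open>V \<otimes> W \<rightarrow> T\<close> induced by a bilinear map \<open>b\<close>.  In Sweedler notation
  \<open>tensor_lift T b (\<Delta> c)\<close> is \<open>b c\<^sub>1 c\<^sub>2\<close>.\<close>

definition tensor_lift ::
    "('k::field, 't, 'z) module_scheme \<Rightarrow> ('v \<Rightarrow> 'w \<Rightarrow> 't) \<Rightarrow> ('v \<times> 'w \<Rightarrow>\<^sub>0 'k) set \<Rightarrow> 't" where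
  "tensor_lift T b X = the_elem
    ((\<lambda>x. finsum T (\<lambda>(v, w). Poly_Mapping.lookup x (v, w) \<odot>\<^bsub>T\<^esub> b v w) (Poly_Mapping.keys x)) ` X)"

definition tensor_map ::
    "('k::field, 'v, 'x) module_scheme \<Rightarrow> ('k, 'w, 'y) module_scheme
      \<Rightarrow> ('a \<Rightarrow> 'v) \<Rightarrow> ('b \<Rightarrow> 'w) \<Rightarrow> ('a \<times> 'b \<Rightarrow>\<^sub>0 'k) set \<Rightarrow> ('v \<times> 'w \<Rightarrow>\<^sub>0 'k) set" where
  "tensor_map V W f g = tensor_lift (tensor_space V W) (\<lambda>a b. pure_tensor V W (f a) (g b))"

text \<open>The canonical map \<open>(U \<otimes> V) \<otimes> W \<rightarrow> U \<otimes> (V \<otimes> W)\<close>.\<close>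

definition tensor_assoc ::
    "('k::field, 'u, 'x) module_scheme \<Rightarrow> ('k, 'v, 'y) module_scheme \<Rightarrow> ('k, 'w, 'z) module_scheme
      \<Rightarrow> (('u \<times> 'v \<Rightarrow>\<^sub>0 'k) set \<times> 'w \<Rightarrow>\<^sub>0 'k) set \<Rightarrow> ('u \<times> ('v \<times> 'w \<Rightarrow>\<^sub>0 'k) set \<Rightarrow>\<^sub>0 'k) set" where
  "tensor_assoc U V W =
    (let T = tensor_space U (tensor_space V W) in
      tensor_lift T (\<lambda>t w. tensor_lift T
        (\<lambda>u v. pure_tensor U (tensor_space V W) u (pure_tensor V W v w)) t))"


section \<open>Coalgebras and comodules\<close>

locale coalgebra = vector_space scale
  for scale :: "'k::field \<Rightarrow> 'c::ab_group_add \<Rightarrow> 'c" +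
  fixes comult :: "'c \<Rightarrow> ('c \<times> 'c \<Rightarrow>\<^sub>0 'k) set"
    and counit :: "'c \<Rightarrow> 'k"
  assumes comult_linear:
      "comult \<in> module_homs field_ring (full_space scale)
        (tensor_space (full_space scale) (full_space scale))"
    and counit_linear: "Vector_Spaces.linear scale (*) counit"
    and coassociative:
      "tensor_assoc (full_space scale) (full_space scale) (full_space scale)
         (tensor_map (tensor_space (full_space scale) (full_space scale)) (full_space scale)
           comult id (comult c))
       = tensor_map (full_space scale) (tensor_space (full_space scale) (full_space scale))
           id comult (comult c)"
    and counit_left: "tensor_lift (full_space scale) (\<lambda>a b. scale (counit a) b) (comult c) = c"
    and counit_right: "tensor_lift (full_space scale) (\<lambda>a b. scale (counit b) a) (comult c) = c"
begin

abbreviation C_space :: "('k, 'c) module" where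
  "C_space \<equiv> full_space scale"

text \<open>The dual algebra: \<open>(f g)(c) = f(c\<^sub>1) g(c\<^sub>2)\<close>.\<close>

definition dual_algebra :: "('c \<Rightarrow> 'k) ring" where
  "dual_algebra = \<lparr>carrier = {f. Vector_Spaces.linear scale (*) f},
    monoid.mult = (\<lambda>f g c. tensor_lift (full_space (*)) (\<lambda>a b. f a * g b) (comult c)),
    one = counit, zero = (\<lambda>c. 0), add = (\<lambda>f g c. f c + g c)\<rparr>"

text \<open>\<open>f \<cdot> c = c\<^sub>1 f(c\<^sub>2)\<close>\<close>

definition C_as_left_module :: "('c \<Rightarrow> 'k, 'c) module" where
  "C_as_left_module = \<lparr>carrier = UNIV, monoid.mult = undefined, one = undefined,
    zero = 0, add = (+),
    smult = (\<lambda>f c. tensor_lift C_space (\<lambda>a b. scale (f b) a) (comult c))\<rparr>"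

text \<open>\<open>c \<cdot> f = f(c\<^sub>1) c\<^sub>2\<close>\<close>

definition C_as_right_module :: "('c \<Rightarrow> 'k, 'c) module" where
  "C_as_right_module = \<lparr>carrier = UNIV, monoid.mult = undefined, one = undefined,
    zero = 0, add = (+),
    smult = (\<lambda>f c. tensor_lift C_space (\<lambda>a b. scale (f a) b) (comult c))\<rparr>"

text \<open>The condition \<open>\<Delta>(X) \<subseteq> C \<otimes> X\<close>, where \<open>C \<otimes> X\<close> is regarded as a subspace of \<open>C \<otimes> C\<close>.\<close>

definition left_subcomodule :: "'c set \<Rightarrow> bool" where
  "left_subcomodule X \<longleftrightarrow> subspace X \<and>
    (\<forall>c\<in>X. \<exists>t. Poly_Mapping.keys t \<subseteq> UNIV \<times> X \<and> comult c = tensor_class C_space C_space t)"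

definition artinian_as_left_comodule :: bool where
  "artinian_as_left_comodule \<longleftrightarrow> descending_chain_condition {X. left_subcomodule X}"

definition right_comodule ::
    "('k, 'm) module \<Rightarrow> ('m \<Rightarrow> ('m \<times> 'c \<Rightarrow>\<^sub>0 'k) set) \<Rightarrow> bool" where
  "right_comodule V \<rho> \<longleftrightarrow> module field_ring V \<and>
    \<rho> \<in> module_homs field_ring V (tensor_space V C_space) \<and>
    (\<forall>m\<in>carrier V.
      tensor_assoc V C_space C_space (tensor_map (tensor_space V C_space) C_space \<rho> id (\<rho> m))
        = tensor_map V (tensor_space C_space C_space) id comult (\<rho> m)) \<and>
    (\<forall>m\<in>carrier V. tensor_lift V (\<lambda>v c. counit c \<odot>\<^bsub>V\<^esub> v) (\<rho> m) = m)"

text \<open>A left module over the dual algebra is a vector space via \<open>k \<mapsto> k \<epsilon>\<close>.\<close>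

definition underlying_space :: "('c \<Rightarrow> 'k, 'm) module \<Rightarrow> ('k, 'm) module" where
  "underlying_space M = \<lparr>carrier = carrier M, monoid.mult = undefined, one = undefined,
    zero = \<zero>\<^bsub>M\<^esub>, add = add M, smult = (\<lambda>k x. (\<lambda>c. k * counit c) \<odot>\<^bsub>M\<^esub> x)\<rparr>"

text \<open>A module is rational if its action is \<open>f \<cdot> m = f(m\<^sub>1) m\<^sub>0\<close> for some comodule
  structure \<open>m \<mapsto> m\<^sub>0 \<otimes> m\<^sub>1\<close>.\<close>

definition rational :: "('c \<Rightarrow> 'k, 'm) module \<Rightarrow> bool" where
  "rational M \<longleftrightarrow> left_module dual_algebra M \<and>
    (\<exists>\<rho>. right_comodule (underlying_space M) \<rho> \<and>
      (\<forall>f\<in>carrier dual_algebra. \<forall>m\<in>carrier M.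
        f \<odot>\<^bsub>M\<^esub> m = tensor_lift (underlying_space M)
          (\<lambda>v c. f c \<odot>\<^bsub>underlying_space M\<^esub> v) (\<rho> m)))"

text \<open>The sum of a family of submodules is the submodule generated by their union.\<close>

definition Rat :: "('c \<Rightarrow> 'k, 'm) module \<Rightarrow> 'm set" where
  "Rat M = generated_submodule dual_algebra M
    (\<Union>{N. submodule N dual_algebra M \<and> rational (M\<lparr>carrier := N\<rparr>)})"

text \<open>Every finitely generated left module is isomorphic to a quotient of a finite power of the
  dual algebra, whose elements are cosets, i.e. sets of functions \<open>nat \<Rightarrow> ('c \<Rightarrow> 'k)\<close>.  Since
  being a direct summand is invariant under isomorphism, the type of \<open>M\<close> below is no
  restriction.\<close>

definition left_finite_Rat_splitting :: bool where
  "left_finite_Rat_splitting \<longleftrightarrow>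
    (\<forall>M :: ('c \<Rightarrow> 'k, (nat \<Rightarrow> 'c \<Rightarrow> 'k) set) module.
      left_module dual_algebra M \<longrightarrow> finitely_generated dual_algebra M \<longrightarrow>
      direct_summand dual_algebra M (Rat M))"

definition countable_dimension :: bool where
  "countable_dimension \<longleftrightarrow> (\<exists>B. countable B \<and> independent B \<and> span B = UNIV)"

end

end

theory Submission
  imports Defs "HOL-Library.Function_Algebras"
begin

text \<open>Write \<open>f g\<close> for the convolution product, \<open>f \<cdot> c = c\<^sub>1 f(c\<^sub>2)\<close> and \<open>c \<cdot> f = f(c\<^sub>1) c\<^sub>2\<close>.  Linear functionals separate
the points of \<open>C\<close>, and \<open>h (f \<cdot> c) = (h f)(c)\<close>, \<open>h (c \<cdot> f) = (f h)(c)\<close>, so that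
identities about the product of the dual algebra and about its two actions translate into each other.

An element \<open>m\<close> of a left module is rational if and only if it is killed by all functionals that vanish on
some finite subset of \<open>C\<close>: a coaction can be rebuilt from such an action with the help of a finite dual
basis, and its coassociativity is the associativity of the module (\<open>Rat_eq\<close>).  Apply the splitting
hypothesis to the cyclic module \<open>C\<^sup>* / L\<close> for a left ideal \<open>L\<close>, and let \<open>e\<close> represent the component of the
class of \<open>\<epsilon>\<close> in the rational part.  Right multiplication by \<open>e\<close> is the projection onto that part: \<open>e\<close> is
rational modulo \<open>L\<close>, and \<open>f - f e\<close> lies in \<open>L\<close> whenever \<open>f\<close> is rational modulo \<open>L\<close>
(\<open>splitting_idempotent\<close>).  All four assertions follow from this one consequence of splitting.

For the chain conditions, over every left subcomodule \<open>X\<close> there is a subcomodule \<open>P\<close> of finite dimension modulo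
\<open>X\<close> that every strictly larger subcomodule meets outside \<open>X\<close> (\<open>finite_essential_extension\<close>).  Otherwise
there are subcomodules \<open>S\<^sub>0, S\<^sub>1, \<dots>\<close> strictly above \<open>X\<close> that are independent modulo \<open>X\<close>.  Let \<open>W\<close> be
their sum and \<open>L\<close> the annihilator of \<open>W\<close>.  A functional that vanishes on \<open>X\<close> and on almost all \<open>S\<^sub>i\<close> is
rational modulo \<open>L\<close>, so \<open>C\<^sup>* / L\<close> has an infinite-dimensional rational part.  But this part is generated
by the rational class of \<open>e\<close> and hence finite-dimensional.

In a descending chain with intersection \<open>X\<close>, some member meets \<open>P\<close> only in \<open>X\<close>, since \<open>P\<close> is
finite-dimensional modulo \<open>X\<close>; this member is then \<open>X\<close> itself, and \<open>C\<close> is artinian.  Starting from \<open>0\<close> and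
passing repeatedly from \<open>X\<close> to \<open>P\<close> gives a countable union of finite-dimensional subcomodules.  It is all
of \<open>C\<close>, because the intersection of a finite-dimensional subcomodule with the chain grows at every step
until the subcomodule is exhausted.  Finally, finitely generated left ideals are annihilators, so the descending
chain condition on the common kernels of finite sets of functionals makes every left ideal the
annihilator of such a kernel, and \<open>C\<^sup>*\<close> is left Noetherian.

For injectivity, let \<open>\<phi>\<close> be a homomorphism from a left ideal \<open>I\<close> to \<open>C\<close> and \<open>L\<close> its kernel.  Since \<open>C\<close> is
rational, all of \<open>I\<close> is rational modulo \<open>L\<close>.  Extend \<open>\<epsilon> \<circ> \<phi>\<close> to a functional \<open>\<Lambda>\<close> on all functions; as \<open>e\<close>
is rational modulo \<open>L\<close>, the map \<open>f \<mapsto> \<Lambda>(f e)\<close> is evaluation at an element \<open>x\<close> of \<open>C\<close>, and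
\<open>f (r \<cdot> x) = \<Lambda>(f r e) = \<Lambda>(f r) = f (\<phi> r)\<close> shows that \<open>\<phi>\<close> is \<open>r \<mapsto> r \<cdot> x\<close>
(\<open>homomorphism_from_left_ideal_extends\<close>).  Baer's argument with Zorn's lemma completes the proof.\<close>

section \<open>Vector spaces with explicit carriers\<close>

lemma field_ring_simps [simp]:
  "carrier (field_ring :: 'k::field ring) = UNIV"
  "a \<oplus>\<^bsub>field_ring\<^esub> b = a + (b :: 'k)"
  "a \<otimes>\<^bsub>field_ring\<^esub> b = a * (b :: 'k)"
  "\<one>\<^bsub>field_ring\<^esub> = (1 :: 'k)"
  "\<zero>\<^bsub>field_ring\<^esub> = (0 :: 'k)"
  by (simp_all add: field_ring_def)

lemma cring_field_ring: "cring (field_ring :: 'k::field ring)"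
proof (rule cringI)
  show "abelian_group (field_ring :: 'k ring)"
  proof (rule abelian_groupI)
    fix x :: 'k
    show "\<exists>y\<in>carrier field_ring. y \<oplus>\<^bsub>field_ring\<^esub> x = \<zero>\<^bsub>field_ring\<^esub>"
      by (auto intro: exI[of _ "- x"])
  qed (simp_all add: algebra_simps)
  show "comm_monoid (field_ring :: 'k ring)"
    by (rule comm_monoidI) (simp_all add: algebra_simps)
qed (simp add: algebra_simps)

text \<open>The carriers of tensor spaces and of modules over the dual algebra are in general not whole types, so
their linear algebra is developed for records.\<close>

locale vspace = Module.module "field_ring :: 'k::field ring" V
  for V :: "('k::field, 'v, 'x) module_scheme" (structure)

lemma vspaceI:
  fixes V :: "('k::field, 'v, 'x) module_scheme" (structure)
  assumes "abelian_group V"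
    and "\<And>k x. x \<in> carrier V \<Longrightarrow> k \<odot> x \<in> carrier V"
    and "\<And>k l x. x \<in> carrier V \<Longrightarrow> (k + l) \<odot> x = k \<odot> x \<oplus> l \<odot> x"
    and "\<And>k x y. x \<in> carrier V \<Longrightarrow> y \<in> carrier V \<Longrightarrow>
      k \<odot> (x \<oplus> y) = k \<odot> x \<oplus> k \<odot> y"
    and "\<And>k l x. x \<in> carrier V \<Longrightarrow> (k * l) \<odot> x = k \<odot> (l \<odot> x)"
    and "\<And>x. x \<in> carrier V \<Longrightarrow> 1 \<odot> x = x"
  shows "vspace V"
  unfolding vspace_def by (rule moduleI) (use assms cring_field_ring in auto)

context vspace
begin

lemma scl_closed [simp, intro]: "x \<in> carrier V \<Longrightarrow> k \<odot> x \<in> carrier V"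
  using smult_closed[of k x] by simp

lemma scl_add_left: "x \<in> carrier V \<Longrightarrow> (k + l) \<odot> x = k \<odot> x \<oplus> l \<odot> x"
  using smult_l_distr[of k l x] by simp

lemma scl_add_right:
  "x \<in> carrier V \<Longrightarrow> y \<in> carrier V \<Longrightarrow> k \<odot> (x \<oplus> y) = k \<odot> x \<oplus> k \<odot> y"
  using smult_r_distr[of k x y] by simp

lemma scl_scl: "x \<in> carrier V \<Longrightarrow> k \<odot> (l \<odot> x) = (k * l) \<odot> x"
  using smult_assoc1[of k l x] by simp

lemma scl_one [simp]: "x \<in> carrier V \<Longrightarrow> 1 \<odot> x = x"
  using smult_one[of x] by simp

lemma scl_zero_left [simp]: "x \<in> carrier V \<Longrightarrow> 0 \<odot> x = \<zero>"
  using smult_l_null[of x] by simp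

lemma scl_zero_right [simp]: "k \<odot> \<zero> = \<zero>"
  using smult_r_null[of k] by simp

lemma add_eq_zero_scl:
  assumes "x \<in> carrier V" "y \<in> carrier V" "x \<oplus> y = \<zero>"
  shows "x = (- 1) \<odot> y"
proof -
  have "(- 1) \<odot> y \<oplus> y = ((- 1) + 1) \<odot> y"
    using assms by (simp only: scl_add_left scl_one)
  also have "\<dots> = \<zero>" using assms by simp
  finally show ?thesis
    using assms M.add.inv_equality[of x y] M.add.inv_equality[of "(- 1) \<odot> y" y] by simp
qed

lemma finsum_scl:
  "finite A \<Longrightarrow> f \<in> A \<rightarrow> carrier V \<Longrightarrow>
    k \<odot> (finsum V f A) = finsum V (\<lambda>i. k \<odot> f i) A"
  using finsum_smult_ldistr[of A k f] by simp

end

lemma module_homsD: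
  assumes "h \<in> module_homs R M N"
  shows "x \<in> carrier M \<Longrightarrow> h x \<in> carrier N"
    and "x \<in> carrier M \<Longrightarrow> y \<in> carrier M \<Longrightarrow> h (x \<oplus>\<^bsub>M\<^esub> y) = h x \<oplus>\<^bsub>N\<^esub> h y"
    and "a \<in> carrier R \<Longrightarrow> x \<in> carrier M \<Longrightarrow> h (a \<odot>\<^bsub>M\<^esub> x) = a \<odot>\<^bsub>N\<^esub> h x"
  using assms unfolding module_homs_def by auto

abbreviation homs ::
    "('k::field, 'v, 'x) module_scheme \<Rightarrow> ('k, 'w, 'y) module_scheme \<Rightarrow> ('v \<Rightarrow> 'w) set" where
  "homs \<equiv> module_homs field_ring"

lemma vspace_homI:
  fixes V :: "('k::field, 'v, 'x) module_scheme"
  assumes "\<And>x. x \<in> carrier V \<Longrightarrow> h x \<in> carrier W"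
    and "\<And>x y. x \<in> carrier V \<Longrightarrow> y \<in> carrier V \<Longrightarrow> h (x \<oplus>\<^bsub>V\<^esub> y) = h x \<oplus>\<^bsub>W\<^esub> h y"
    and "\<And>k x. x \<in> carrier V \<Longrightarrow> h (k \<odot>\<^bsub>V\<^esub> x) = k \<odot>\<^bsub>W\<^esub> h x"
  shows "h \<in> homs V W"
  using assms unfolding module_homs_def by auto

lemma vspace_hom_scl:
  fixes V :: "('k::field, 'v, 'x) module_scheme"
  assumes "h \<in> homs V W" "x \<in> carrier V"
  shows "h (k \<odot>\<^bsub>V\<^esub> x) = k \<odot>\<^bsub>W\<^esub> h x"
  using module_homsD(3)[OF assms(1), of k x] assms(2) by simp

lemma vspace_homI_combination:
  fixes V :: "('k::field, 'v, 'x) module_scheme"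
  assumes "vspace V" "vspace W" "\<And>x. x \<in> carrier V \<Longrightarrow> h x \<in> carrier W"
    and comb: "\<And>k x y. x \<in> carrier V \<Longrightarrow> y \<in> carrier V \<Longrightarrow>
      h (k \<odot>\<^bsub>V\<^esub> x \<oplus>\<^bsub>V\<^esub> y) = k \<odot>\<^bsub>W\<^esub> h x \<oplus>\<^bsub>W\<^esub> h y"
  shows "h \<in> homs V W"
proof -
  interpret V: vspace V by fact
  interpret W: vspace W by fact
  note c = assms(3)
  have zero: "h \<zero>\<^bsub>V\<^esub> = \<zero>\<^bsub>W\<^esub>"
    using comb[of "\<zero>\<^bsub>V\<^esub>" "\<zero>\<^bsub>V\<^esub>" 1] c[of "\<zero>\<^bsub>V\<^esub>"] by simp
  show ?thesis
  proof (rule vspace_homI)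
    fix x y assume "x \<in> carrier V" "y \<in> carrier V"
    thus "h (x \<oplus>\<^bsub>V\<^esub> y) = h x \<oplus>\<^bsub>W\<^esub> h y" using comb[of x y 1] c by simp
  next
    fix k x assume "x \<in> carrier V"
    thus "h (k \<odot>\<^bsub>V\<^esub> x) = k \<odot>\<^bsub>W\<^esub> h x" using comb[of x "\<zero>\<^bsub>V\<^esub>" k] c zero by simp
  qed (rule c)
qed

lemma vspace_hom_zero:
  assumes "vspace V" "vspace W" "h \<in> homs V W"
  shows "h \<zero>\<^bsub>V\<^esub> = \<zero>\<^bsub>W\<^esub>"
proof -
  interpret V: vspace V by fact
  interpret W: vspace W by fact
  have "h (0 \<odot>\<^bsub>V\<^esub> \<zero>\<^bsub>V\<^esub>) = 0 \<odot>\<^bsub>W\<^esub> h \<zero>\<^bsub>V\<^esub>"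
    by (rule vspace_hom_scl[OF assms(3)]) simp
  thus ?thesis using module_homsD(1)[OF assms(3), of "\<zero>\<^bsub>V\<^esub>"] by simp
qed

lemma vspace_hom_finsum:
  assumes "vspace V" "vspace W" "h \<in> homs V W"
    and "finite A" "f \<in> A \<rightarrow> carrier V"
  shows "h (finsum V f A) = finsum W (\<lambda>i. h (f i)) A"
proof -
  interpret V: vspace V by fact
  interpret W: vspace W by fact
  show ?thesis using assms(4,5)
  proof (induction A)
    case empty
    show ?case using vspace_hom_zero[OF assms(1-3)] by simp
  next
    case (insert a A)
    have "(\<lambda>i. h (f i)) \<in> A \<rightarrow> carrier W"
      using insert.prems module_homsD(1)[OF assms(3)] by auto
    moreover have "finsum V f A \<in> carrier V" using insert.prems by (intro V.M.finsum_closed) auto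
    ultimately show ?case
      using insert module_homsD[OF assms(3)] by (simp add: Pi_iff)
  qed
qed

lemma vspace_hom_comp:
  fixes V :: "('k::field, 'v, 'x) module_scheme"
  assumes "h \<in> homs V W" "g \<in> homs W T"
  shows "(\<lambda>x. g (h x)) \<in> homs V T"
  using assms by (intro vspace_homI) (simp_all add: module_homsD vspace_hom_scl)

lemma full_space_simps [simp]:
  "carrier (full_space s) = UNIV"
  "x \<oplus>\<^bsub>full_space s\<^esub> y = x + y"
  "\<zero>\<^bsub>full_space s\<^esub> = 0"
  "k \<odot>\<^bsub>full_space s\<^esub> x = s k x"
  by (simp_all add: full_space_def)

lemma vspace_full_space:
  assumes "vector_space s"
  shows "vspace (full_space s)"
proof -
  interpret vector_space s by fact
  show ?thesis
  proof (rule vspaceI)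
    show "abelian_group (full_space s)"
    proof (rule abelian_groupI)
      fix x
      show "\<exists>y\<in>carrier (full_space s). y \<oplus>\<^bsub>full_space s\<^esub> x = \<zero>\<^bsub>full_space s\<^esub>"
        by (auto intro: exI[of _ "- x"])
    qed (simp_all add: algebra_simps)
  qed (simp_all add: algebra_simps)
qed

lemma vector_space_field: "vector_space ((*) :: 'k::field \<Rightarrow> 'k \<Rightarrow> 'k)"
  by unfold_locales (simp_all add: algebra_simps)

lemma finsum_full_space:
  assumes "vector_space s"
  shows "finsum (full_space s) f A = sum f A"
proof -
  interpret vspace "full_space s" by (rule vspace_full_space) fact
  show ?thesis
    by (induction A rule: infinite_finite_induct) (simp_all add: Pi_iff)
qed

lemma full_space_hom_iff_linear:
  assumes "vector_space s" "vector_space t"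
  shows "h \<in> homs (full_space s) (full_space t) \<longleftrightarrow> Vector_Spaces.linear s t h"
  using assms by (auto simp: module_homs_def Vector_Spaces.linear_iff)

section \<open>Formal linear combinations\<close>

abbreviation "keys \<equiv> Poly_Mapping.keys"
abbreviation "lookup \<equiv> Poly_Mapping.lookup"
abbreviation "single \<equiv> Poly_Mapping.single"

text \<open>The linear map out of the free vector space on \<open>'p\<close> that extends \<open>\<beta>\<close>.\<close>

definition formal_eval ::
    "('k::field, 't, 'z) module_scheme \<Rightarrow> ('p \<Rightarrow> 't) \<Rightarrow> ('p \<Rightarrow>\<^sub>0 'k) \<Rightarrow> 't" where
  "formal_eval T \<beta> x = finsum T (\<lambda>p. lookup x p \<odot>\<^bsub>T\<^esub> \<beta> p) (keys x)"

lemma lookup_formal_scale [simp]: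
  "lookup (formal_scale k x) p = k * lookup x p"
  by (simp add: formal_scale_def Poly_Mapping.map.rep_eq when_def)

interpretation formal: vector_space "formal_scale :: 'k::field \<Rightarrow> ('a \<Rightarrow>\<^sub>0 'k) \<Rightarrow> _"
  by unfold_locales (auto intro!: poly_mapping_eqI simp: lookup_add algebra_simps)

lemma formal_scale_single [simp]:
  "formal_scale k (single p l) = single p (k * l)"
  by (rule poly_mapping_eqI) (simp add: lookup_single when_def)

lemma keys_formal_scale: "keys (formal_scale k x) \<subseteq> keys x"
  by (auto simp: in_keys_iff)

context vspace
begin

lemma formal_eval_superset:
  assumes "finite A" "keys x \<subseteq> A" "\<beta> \<in> A \<rightarrow> carrier V"
  shows "formal_eval V \<beta> x = finsum V (\<lambda>p. lookup x p \<odot> \<beta> p) A"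
  unfolding formal_eval_def
proof (rule M.add.finprod_mono_neutral_cong_left)
  show "finite A" "keys x \<subseteq> A" using assms by auto
  show "(\<lambda>p. lookup x p \<odot> \<beta> p) \<in> A \<rightarrow> carrier V" using assms by auto
qed (use assms in \<open>auto simp: in_keys_iff Pi_iff\<close>)

lemma formal_eval_closed:
  assumes "\<beta> \<in> keys x \<rightarrow> carrier V"
  shows "formal_eval V \<beta> x \<in> carrier V"
  unfolding formal_eval_def using assms by (intro M.finsum_closed) auto

lemma formal_eval_zero [simp]: "formal_eval V \<beta> 0 = \<zero>"
  by (simp add: formal_eval_def)

lemma formal_eval_add:
  assumes "\<beta> \<in> keys x \<union> keys y \<rightarrow> carrier V"
  shows "formal_eval V \<beta> (x + y) = formal_eval V \<beta> x \<oplus> formal_eval V \<beta> y"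
proof -
  let ?A = "keys x \<union> keys y"
  have "formal_eval V \<beta> (x + y) = finsum V (\<lambda>p. lookup (x + y) p \<odot> \<beta> p) ?A"
    by (rule formal_eval_superset) (use assms Poly_Mapping.keys_add[of x y] in auto)
  also have "\<dots> = finsum V (\<lambda>p. lookup x p \<odot> \<beta> p
      \<oplus> lookup y p \<odot> \<beta> p) ?A"
    by (rule M.finsum_cong') (use assms in \<open>auto simp: lookup_add scl_add_left Pi_iff\<close>)
  also have "\<dots> = finsum V (\<lambda>p. lookup x p \<odot> \<beta> p) ?A
      \<oplus> finsum V (\<lambda>p. lookup y p \<odot> \<beta> p) ?A"
    by (rule M.finsum_addf) (use assms in auto)
  also have "\<dots> = formal_eval V \<beta> x \<oplus> formal_eval V \<beta> y"
    using assms by (simp add: formal_eval_superset[of ?A])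
  finally show ?thesis .
qed

lemma formal_eval_scale:
  assumes "\<beta> \<in> keys x \<rightarrow> carrier V"
  shows "formal_eval V \<beta> (formal_scale k x) = k \<odot> formal_eval V \<beta> x"
proof -
  let ?A = "keys x"
  have "formal_eval V \<beta> (formal_scale k x)
      = finsum V (\<lambda>p. lookup (formal_scale k x) p \<odot> \<beta> p) ?A"
    by (rule formal_eval_superset) (use assms keys_formal_scale[of k x] in auto)
  also have "\<dots> = finsum V (\<lambda>p. k \<odot> (lookup x p \<odot> \<beta> p)) ?A"
    by (rule M.finsum_cong') (use assms in \<open>auto simp: scl_scl Pi_iff\<close>)
  also have "\<dots> = k \<odot> formal_eval V \<beta> x"
    unfolding formal_eval_def by (rule finsum_scl[symmetric]) (use assms in auto)
  finally show ?thesis .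
qed

lemma formal_eval_single:
  assumes "\<beta> p \<in> carrier V"
  shows "formal_eval V \<beta> (single p k) = k \<odot> \<beta> p"
proof -
  have "formal_eval V \<beta> (single p k)
      = finsum V (\<lambda>q. lookup (single p k) q \<odot> \<beta> q) {p}"
    by (rule formal_eval_superset) (use assms in auto)
  thus ?thesis using assms by (simp add: Pi_iff)
qed

lemma formal_eval_diff_eq_zero_iff:
  assumes "\<beta> \<in> keys x \<union> keys y \<rightarrow> carrier V"
  shows "formal_eval V \<beta> (x - y) = \<zero> \<longleftrightarrow> formal_eval V \<beta> x = formal_eval V \<beta> y"
proof -
  have k: "keys (x - y) \<subseteq> keys x \<union> keys y"
    by (auto simp: in_keys_iff lookup_minus)
  have "formal_eval V \<beta> ((x - y) + y) = formal_eval V \<beta> (x - y) \<oplus> formal_eval V \<beta> y"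
    by (rule formal_eval_add) (use assms k in auto)
  moreover have "formal_eval V \<beta> (x - y) \<in> carrier V" "formal_eval V \<beta> y \<in> carrier V"
    by (rule formal_eval_closed; use assms k in auto)+
  ultimately show ?thesis
    using M.add.r_cancel_one'[of "formal_eval V \<beta> y" "formal_eval V \<beta> (x - y)"] by auto
qed

end

lemma vspace_hom_formal_eval:
  assumes "vspace V" "vspace W" "h \<in> homs V W"
    and "\<beta> \<in> keys x \<rightarrow> carrier V"
  shows "h (formal_eval V \<beta> x) = formal_eval W (\<lambda>p. h (\<beta> p)) x"
proof -
  interpret V: vspace V by fact
  interpret W: vspace W by fact
  have "h (formal_eval V \<beta> x) = finsum W (\<lambda>p. h (lookup x p \<odot>\<^bsub>V\<^esub> \<beta> p)) (keys x)"
    unfolding formal_eval_def by (rule vspace_hom_finsum[OF assms(1-3)]) (use assms(4) in auto)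
  also have "\<dots> = formal_eval W (\<lambda>p. h (\<beta> p)) x"
    unfolding formal_eval_def
    by (rule W.M.finsum_cong')
      (use assms(4) module_homsD[OF assms(3)] in \<open>auto simp: vspace_hom_scl[OF assms(3)] Pi_iff\<close>)
  finally show ?thesis .
qed

section \<open>Tensor products\<close>

lemma hom_add_scl:
  fixes T :: "('k::field, 't, 'z) module_scheme" and V :: "('k, 'v, 'y) module_scheme"
  assumes "vspace T" "g \<in> homs V T" "h \<in> homs V T"
  shows "(\<lambda>x. k \<odot>\<^bsub>T\<^esub> g x \<oplus>\<^bsub>T\<^esub> h x) \<in> homs V T"
proof -
  interpret T: vspace T by fact
  show ?thesis
    using assms(2,3)
    by (intro vspace_homI)
      (simp_all add: module_homsD vspace_hom_scl T.scl_add_right T.scl_scl T.M.a_ac mult.commute)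
qed

definition bilinear_map ::
    "('k::field, 'v, 'x) module_scheme \<Rightarrow> ('k, 'w, 'y) module_scheme \<Rightarrow> ('k, 't, 'z) module_scheme
      \<Rightarrow> ('v \<Rightarrow> 'w \<Rightarrow> 't) \<Rightarrow> bool" where
  "bilinear_map V W T b \<longleftrightarrow>
    (\<forall>w\<in>carrier W. (\<lambda>v. b v w) \<in> homs V T) \<and>
    (\<forall>v\<in>carrier V. b v \<in> homs W T)"

lemma bilinear_mapI:
  assumes "\<And>w. w \<in> carrier W \<Longrightarrow> (\<lambda>v. b v w) \<in> homs V T"
    and "\<And>v. v \<in> carrier V \<Longrightarrow> b v \<in> homs W T"
  shows "bilinear_map V W T b"
  using assms by (auto simp: bilinear_map_def)

locale tensor_pair = V: vspace V + W: vspace W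
  for V :: "('k::field, 'v, 'x) module_scheme" and W :: "('k, 'w, 'y) module_scheme"
begin

abbreviation "FT \<equiv> formal_tensors V W"
abbreviation "rel_span \<equiv> formal.span (bilinearity_relations V W)"
abbreviation "cls \<equiv> tensor_class V W"
abbreviation "TS \<equiv> tensor_space V W"

lemma subspace_FT: "formal.subspace FT"
proof (rule formal.subspaceI)
  fix x y assume "x \<in> FT" "y \<in> FT"
  thus "x + y \<in> FT" using Poly_Mapping.keys_add[of x y] by (auto simp: formal_tensors_def)
next
  fix c x assume "x \<in> FT"
  thus "formal_scale c x \<in> FT" using keys_formal_scale[of c x] by (auto simp: formal_tensors_def)
qed (simp add: formal_tensors_def)

lemma single_FT: "v \<in> carrier V \<Longrightarrow> w \<in> carrier W \<Longrightarrow> single (v, w) k \<in> FT"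
  by (simp add: formal_tensors_def)

lemma keys_FT: "x \<in> FT \<Longrightarrow> p \<in> keys x \<Longrightarrow> fst p \<in> carrier V \<and> snd p \<in> carrier W"
  by (simp add: formal_tensors_def, drule (1) subsetD, simp add: mem_Times_iff)

lemma cls_self: "x \<in> FT \<Longrightarrow> x \<in> cls x"
  by (simp add: tensor_class_def formal.span_zero)

lemma cls_eq_iff:
  assumes "x \<in> FT" "y \<in> FT"
  shows "cls x = cls y \<longleftrightarrow> x - y \<in> rel_span"
proof
  assume "cls x = cls y"
  hence "x \<in> cls y" using cls_self[OF assms(1)] by simp
  thus "x - y \<in> rel_span" by (simp add: tensor_class_def)
next
  assume d: "x - y \<in> rel_span"
  have "z - x \<in> rel_span \<longleftrightarrow> z - y \<in> rel_span" for z
    using formal.span_add[OF _ d, of "z - x"] formal.span_diff[OF _ d, of "z - y"] by auto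
  thus "cls x = cls y" by (simp add: tensor_class_def)
qed

lemma TS_carrier: "carrier TS = cls ` FT"
  by (simp add: tensor_space_def)

lemma TS_zero: "\<zero>\<^bsub>TS\<^esub> = cls 0"
  by (simp add: tensor_space_def)

lemma TS_add:
  assumes "x \<in> FT" "y \<in> FT"
  shows "cls x \<oplus>\<^bsub>TS\<^esub> cls y = cls (x + y)"
proof -
  have "cls (x' + y') = cls (x + y)" if "x' \<in> cls x" "y' \<in> cls y" for x' y'
  proof -
    have "x' \<in> FT" "y' \<in> FT" "x' - x \<in> rel_span" "y' - y \<in> rel_span"
      using that by (simp_all add: tensor_class_def)
    moreover have "x' + y' - (x + y) = (x' - x) + (y' - y)" by simp
    ultimately have "x' + y' \<in> FT" "x + y \<in> FT" "x' + y' - (x + y) \<in> rel_span"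
      using assms formal.span_add[of "x' - x" _ "y' - y"]
      by (auto intro: formal.subspace_add[OF subspace_FT] simp only:)
    thus ?thesis by (simp only: cls_eq_iff)
  qed
  hence "(\<Union>x'\<in>cls x. \<Union>y'\<in>cls y. cls (x' + y')) = (\<Union>x'\<in>cls x. \<Union>y'\<in>cls y. cls (x + y))"
    by (intro SUP_cong refl)
  also have "\<dots> = cls (x + y)" using cls_self[OF assms(1)] cls_self[OF assms(2)] by blast
  finally show ?thesis by (simp add: tensor_space_def)
qed

lemma TS_scl:
  assumes "x \<in> FT"
  shows "k \<odot>\<^bsub>TS\<^esub> cls x = cls (formal_scale k x)"
proof -
  have "cls (formal_scale k x') = cls (formal_scale k x)" if "x' \<in> cls x" for x'
  proof -
    have "x' \<in> FT" "x' - x \<in> rel_span"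
      using that by (simp_all add: tensor_class_def)
    hence "formal_scale k x' \<in> FT" "formal_scale k x \<in> FT"
        "formal_scale k x' - formal_scale k x \<in> rel_span"
      using assms formal.span_scale[of "x' - x" _ k]
      by (auto intro: formal.subspace_scale[OF subspace_FT]
          simp only: formal.scale_right_diff_distrib)
    thus ?thesis by (simp only: cls_eq_iff)
  qed
  hence "(\<Union>x'\<in>cls x. cls (formal_scale k x')) = (\<Union>x'\<in>cls x. cls (formal_scale k x))"
    by (intro SUP_cong refl)
  also have "\<dots> = cls (formal_scale k x)" using cls_self[OF assms(1)] by blast
  finally show ?thesis by (simp add: tensor_space_def)
qed

lemmas FT_closed =
  formal.subspace_add[OF subspace_FT] formal.subspace_scale[OF subspace_FT]
  formal.subspace_0[OF subspace_FT] formal.subspace_neg[OF subspace_FT]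

lemma vspace_TS: "vspace TS"
proof (rule vspaceI)
  show "abelian_group TS"
  proof (rule abelian_groupI)
    fix X assume "X \<in> carrier TS"
    then obtain x where x: "x \<in> FT" "X = cls x" by (auto simp: TS_carrier)
    show "\<exists>y\<in>carrier TS. y \<oplus>\<^bsub>TS\<^esub> X = \<zero>\<^bsub>TS\<^esub>"
      using x by (intro bexI[of _ "cls (- x)"]) (auto simp: TS_add TS_zero TS_carrier FT_closed)
  next
    fix X Y Z assume "X \<in> carrier TS" "Y \<in> carrier TS" "Z \<in> carrier TS"
    then obtain x y z where "x \<in> FT" "X = cls x" "y \<in> FT" "Y = cls y" "z \<in> FT" "Z = cls z"
      by (auto simp: TS_carrier)
    thus "X \<oplus>\<^bsub>TS\<^esub> Y \<oplus>\<^bsub>TS\<^esub> Z = X \<oplus>\<^bsub>TS\<^esub> (Y \<oplus>\<^bsub>TS\<^esub> Z)"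
      by (simp add: TS_add FT_closed add.assoc)
  next
    fix X Y assume "X \<in> carrier TS" "Y \<in> carrier TS"
    then obtain x y where "x \<in> FT" "X = cls x" "y \<in> FT" "Y = cls y"
      by (auto simp: TS_carrier)
    thus "X \<oplus>\<^bsub>TS\<^esub> Y = Y \<oplus>\<^bsub>TS\<^esub> X" "X \<oplus>\<^bsub>TS\<^esub> Y \<in> carrier TS"
      by (simp_all add: TS_add TS_carrier FT_closed add.commute)
  qed (auto simp: TS_carrier TS_zero TS_add FT_closed)
next
  fix X k l assume "X \<in> carrier TS"
  then obtain x where x: "x \<in> FT" "X = cls x" by (auto simp: TS_carrier)
  show "k \<odot>\<^bsub>TS\<^esub> X \<in> carrier TS" "1 \<odot>\<^bsub>TS\<^esub> X = X"
    "(k + l) \<odot>\<^bsub>TS\<^esub> X = k \<odot>\<^bsub>TS\<^esub> X \<oplus>\<^bsub>TS\<^esub> l \<odot>\<^bsub>TS\<^esub> X"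
    "(k * l) \<odot>\<^bsub>TS\<^esub> X = k \<odot>\<^bsub>TS\<^esub> (l \<odot>\<^bsub>TS\<^esub> X)"
    using x by (simp_all add: TS_scl TS_carrier TS_add FT_closed formal.scale_left_distrib)
next
  fix X Y k assume "X \<in> carrier TS" "Y \<in> carrier TS"
  then obtain x y where "x \<in> FT" "X = cls x" "y \<in> FT" "Y = cls y"
    by (auto simp: TS_carrier)
  thus "k \<odot>\<^bsub>TS\<^esub> (X \<oplus>\<^bsub>TS\<^esub> Y) = k \<odot>\<^bsub>TS\<^esub> X \<oplus>\<^bsub>TS\<^esub> k \<odot>\<^bsub>TS\<^esub> Y"
    by (simp add: TS_add TS_scl FT_closed formal.scale_right_distrib)
qed

sublocale T: vspace TS by (rule vspace_TS)

abbreviation "pure \<equiv> pure_tensor V W"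

lemma pure_closed [simp]: "v \<in> carrier V \<Longrightarrow> w \<in> carrier W \<Longrightarrow> pure v w \<in> carrier TS"
  by (auto simp: pure_tensor_def TS_carrier single_FT)

lemma pure_linear_left:
  assumes "v \<in> carrier V" "v' \<in> carrier V" "w \<in> carrier W"
  shows "pure (k \<odot>\<^bsub>V\<^esub> v \<oplus>\<^bsub>V\<^esub> v') w = k \<odot>\<^bsub>TS\<^esub> pure v w \<oplus>\<^bsub>TS\<^esub> pure v' w"
proof -
  have "single (k \<odot>\<^bsub>V\<^esub> v \<oplus>\<^bsub>V\<^esub> v', w) 1
       - (single (v, w) k + single (v', w) 1) \<in> rel_span"
    using assms by (intro formal.span_base) (auto simp: bilinearity_relations_def)
  thus ?thesis
    using assms by (simp add: pure_tensor_def TS_scl TS_add single_FT FT_closed cls_eq_iff)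
qed

lemma pure_linear_right:
  assumes "v \<in> carrier V" "w \<in> carrier W" "w' \<in> carrier W"
  shows "pure v (k \<odot>\<^bsub>W\<^esub> w \<oplus>\<^bsub>W\<^esub> w') = k \<odot>\<^bsub>TS\<^esub> pure v w \<oplus>\<^bsub>TS\<^esub> pure v w'"
proof -
  have "single (v, k \<odot>\<^bsub>W\<^esub> w \<oplus>\<^bsub>W\<^esub> w') 1
       - (single (v, w) k + single (v, w') 1) \<in> rel_span"
    using assms by (intro formal.span_base) (auto simp: bilinearity_relations_def)
  thus ?thesis
    using assms by (simp add: pure_tensor_def TS_scl TS_add single_FT FT_closed cls_eq_iff)
qed

lemma bilinear_pure: "bilinear_map V W TS pure"
  by (intro bilinear_mapI vspace_homI_combination V.vspace_axioms W.vspace_axioms vspace_TS)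
    (simp_all add: pure_linear_left pure_linear_right)

text \<open>The kernel of \<open>formal_eval\<close> is a subspace, so it is enough to look at the generating relations.  This is
what makes \<open>tensor_lift\<close> independent of representatives.\<close>

lemma formal_eval_bilinear_rel:
  assumes "vspace T" "bilinear_map V W T b" "x \<in> rel_span"
  shows "formal_eval T (\<lambda>(v, w). b v w) x = \<zero>\<^bsub>T\<^esub>"
proof -
  interpret T': vspace T by fact
  let ?\<beta> = "\<lambda>(v, w). b v w"
  let ?Z = "{x \<in> FT. formal_eval T ?\<beta> x = \<zero>\<^bsub>T\<^esub>}"
  have b1: "b (k \<odot>\<^bsub>V\<^esub> v \<oplus>\<^bsub>V\<^esub> v') w = k \<odot>\<^bsub>T\<^esub> b v w \<oplus>\<^bsub>T\<^esub> b v' w"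
    if "v \<in> carrier V" "v' \<in> carrier V" "w \<in> carrier W" for k v v' w
    using assms(2) that module_homsD[of "\<lambda>v. b v w" field_ring V T] vspace_hom_scl[of "\<lambda>v. b v w" V T]
    by (simp add: bilinear_map_def)
  have b2: "b v (k \<odot>\<^bsub>W\<^esub> w \<oplus>\<^bsub>W\<^esub> w') = k \<odot>\<^bsub>T\<^esub> b v w \<oplus>\<^bsub>T\<^esub> b v w'"
    if "v \<in> carrier V" "w \<in> carrier W" "w' \<in> carrier W" for k v w w'
    using assms(2) that module_homsD[of "b v" field_ring W T] vspace_hom_scl[of "b v" W T]
    by (simp add: bilinear_map_def)
  have bc: "b v w \<in> carrier T" if "v \<in> carrier V" "w \<in> carrier W" for v w
    using assms(2) that module_homsD(1)[of "b v" field_ring W T w] by (simp add: bilinear_map_def)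
  have cl: "?\<beta> \<in> keys x \<rightarrow> carrier T" if "x \<in> FT" for x
    using keys_FT[OF that] bc by (auto simp: Pi_iff)
  have "formal.subspace ?Z"
  proof (rule formal.subspaceI)
    fix x y assume "x \<in> ?Z" "y \<in> ?Z"
    hence xy: "x \<in> FT" "y \<in> FT" "formal_eval T ?\<beta> x = \<zero>\<^bsub>T\<^esub>" "formal_eval T ?\<beta> y = \<zero>\<^bsub>T\<^esub>"
      by simp_all
    have "formal_eval T ?\<beta> (x + y) = formal_eval T ?\<beta> x \<oplus>\<^bsub>T\<^esub> formal_eval T ?\<beta> y"
      by (rule T'.formal_eval_add) (use cl[OF xy(1)] cl[OF xy(2)] in \<open>simp add: Pi_iff ball_Un\<close>)
    thus "x + y \<in> ?Z" using xy FT_closed(1) by simp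
  next
    fix c x assume "x \<in> ?Z"
    thus "formal_scale c x \<in> ?Z" using T'.formal_eval_scale[OF cl] FT_closed(2) by simp
  qed (use FT_closed(3) in simp)
  moreover have "bilinearity_relations V W \<subseteq> ?Z"
  proof -
    have diff: "s - (t + u) \<in> ?Z"
      if F: "s \<in> FT" "t \<in> FT" "u \<in> FT"
        and eq: "formal_eval T ?\<beta> s = formal_eval T ?\<beta> t \<oplus>\<^bsub>T\<^esub> formal_eval T ?\<beta> u" for s t u
    proof -
      have tu: "t + u \<in> FT" using F by (simp add: FT_closed)
      have "formal_eval T ?\<beta> (t + u) = formal_eval T ?\<beta> t \<oplus>\<^bsub>T\<^esub> formal_eval T ?\<beta> u"
        by (rule T'.formal_eval_add) (use cl[OF F(2)] cl[OF F(3)] in \<open>simp add: Pi_iff ball_Un\<close>)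
      moreover have "formal_eval T ?\<beta> (s - (t + u)) = \<zero>\<^bsub>T\<^esub> \<longleftrightarrow>
          formal_eval T ?\<beta> s = formal_eval T ?\<beta> (t + u)"
        by (rule T'.formal_eval_diff_eq_zero_iff)
          (use cl[OF F(1)] cl[OF tu] in \<open>simp add: Pi_iff ball_Un\<close>)
      moreover have "s - (t + u) \<in> FT" by (rule formal.subspace_diff[OF subspace_FT F(1) tu])
      ultimately show ?thesis using eq by simp
    qed
    show ?thesis
      unfolding bilinearity_relations_def
    proof (intro Un_least subsetI; elim CollectE exE conjE)
      fix r k v v' w
      assume r: "r = single (k \<odot>\<^bsub>V\<^esub> v \<oplus>\<^bsub>V\<^esub> v', w) 1
            - (single (v, w) k + single (v', w) 1)"
        and "v \<in> carrier V" "v' \<in> carrier V" "w \<in> carrier W"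
      thus "r \<in> ?Z" unfolding r
        by (intro diff single_FT) (simp_all add: T'.formal_eval_single bc b1)
    next
      fix r k v w w'
      assume r: "r = single (v, k \<odot>\<^bsub>W\<^esub> w \<oplus>\<^bsub>W\<^esub> w') 1
            - (single (v, w) k + single (v, w') 1)"
        and "v \<in> carrier V" "w \<in> carrier W" "w' \<in> carrier W"
      thus "r \<in> ?Z" unfolding r
        by (intro diff single_FT) (simp_all add: T'.formal_eval_single bc b2)
    qed
  qed
  ultimately have "rel_span \<subseteq> ?Z" by (intro formal.span_minimal)
  from subsetD[OF this assms(3)] show ?thesis by simp
qed

lemma bilinear_map_closed:
  "bilinear_map V W T b \<Longrightarrow> v \<in> carrier V \<Longrightarrow> w \<in> carrier W \<Longrightarrow> b v w \<in> carrier T"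
  using module_homsD(1)[of "b v" field_ring W T w] by (simp add: bilinear_map_def)

lemma bilinear_map_Pi:
  "bilinear_map V W T b \<Longrightarrow> x \<in> FT \<Longrightarrow> (\<lambda>(v, w). b v w) \<in> keys x \<rightarrow> carrier T"
  using bilinear_map_closed[of T b] keys_FT[of x] by (simp add: Pi_iff case_prod_beta')

lemma tensor_lift_cls:
  assumes "vspace T" "bilinear_map V W T b" "x \<in> FT"
  shows "tensor_lift T b (cls x) = formal_eval T (\<lambda>(v, w). b v w) x"
proof -
  interpret T': vspace T by fact
  let ?\<beta> = "\<lambda>(v, w). b v w"
  have "formal_eval T ?\<beta> y = formal_eval T ?\<beta> x" if "y \<in> cls x" for y
  proof -
    have y: "y \<in> FT" "y - x \<in> rel_span" using that by (simp_all add: tensor_class_def)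
    have "formal_eval T ?\<beta> (y - x) = \<zero>\<^bsub>T\<^esub>" by (rule formal_eval_bilinear_rel) fact+
    moreover have "formal_eval T ?\<beta> (y - x) = \<zero>\<^bsub>T\<^esub> \<longleftrightarrow> formal_eval T ?\<beta> y = formal_eval T ?\<beta> x"
      by (rule T'.formal_eval_diff_eq_zero_iff)
        (use bilinear_map_Pi[OF assms(2,3)] bilinear_map_Pi[OF assms(2) y(1)] in auto)
    ultimately show ?thesis by simp
  qed
  hence "formal_eval T ?\<beta> ` cls x = (\<lambda>_. formal_eval T ?\<beta> x) ` cls x"
    by (intro image_cong refl)
  also have "\<dots> = {formal_eval T ?\<beta> x}" using cls_self[OF assms(3)] by blast
  finally have "formal_eval T ?\<beta> ` cls x = {formal_eval T ?\<beta> x}" .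
  moreover have "tensor_lift T b (cls x) = the_elem (formal_eval T ?\<beta> ` cls x)"
    unfolding tensor_lift_def formal_eval_def by (simp add: case_prod_beta')
  ultimately show ?thesis by simp
qed

lemma tensor_lift_hom:
  assumes "vspace T" "bilinear_map V W T b"
  shows "tensor_lift T b \<in> homs TS T"
proof -
  interpret T': vspace T by fact
  note lift = tensor_lift_cls[OF assms]
  note cl = bilinear_map_Pi[OF assms(2)]
  show ?thesis
  proof (rule vspace_homI)
    fix X assume "X \<in> carrier TS"
    then obtain x where x: "x \<in> FT" "X = cls x" by (auto simp: TS_carrier)
    thus "tensor_lift T b X \<in> carrier T"
      using lift T'.formal_eval_closed[OF cl] by simp
    fix k show "tensor_lift T b (k \<odot>\<^bsub>TS\<^esub> X) = k \<odot>\<^bsub>T\<^esub> tensor_lift T b X"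
      using x lift T'.formal_eval_scale[OF cl] by (simp add: TS_scl FT_closed)
  next
    fix X Y assume "X \<in> carrier TS" "Y \<in> carrier TS"
    then obtain x y where x: "x \<in> FT" "X = cls x" "y \<in> FT" "Y = cls y" by (auto simp: TS_carrier)
    have "formal_eval T (\<lambda>(v, w). b v w) (x + y)
        = formal_eval T (\<lambda>(v, w). b v w) x \<oplus>\<^bsub>T\<^esub> formal_eval T (\<lambda>(v, w). b v w) y"
      by (rule T'.formal_eval_add) (use cl[OF x(1)] cl[OF x(3)] in auto)
    thus "tensor_lift T b (X \<oplus>\<^bsub>TS\<^esub> Y) = tensor_lift T b X \<oplus>\<^bsub>T\<^esub> tensor_lift T b Y"
      using x lift by (simp add: TS_add FT_closed)
  qed
qed

lemma tensor_lift_pure: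
  assumes "vspace T" "bilinear_map V W T b" "v \<in> carrier V" "w \<in> carrier W"
  shows "tensor_lift T b (pure v w) = b v w"
proof -
  interpret T': vspace T by fact
  show ?thesis
    using assms tensor_lift_cls[OF assms(1,2) single_FT] bilinear_map_closed[OF assms(2)]
    by (simp add: pure_tensor_def T'.formal_eval_single)
qed

lemma cls_eq_formal_eval:
  assumes "x \<in> FT"
  shows "cls x = formal_eval TS (\<lambda>(v, w). pure v w) x"
proof -
  have "y \<in> FT \<Longrightarrow> cls y = formal_eval TS (\<lambda>(v, w). pure v w) y"
    if "finite A" "keys y \<subseteq> A" for A y
    using that
  proof (induction A arbitrary: y)
    case empty
    hence "y = 0" by (auto intro!: poly_mapping_eqI simp: in_keys_iff)
    thus ?case by (simp add: TS_zero)
  next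
    case (insert p A)
    obtain v w where p: "p = (v, w)" by fastforce
    let ?s = "single p (lookup y p)"
    let ?z = "y - ?s"
    show ?case
    proof (cases "p \<in> keys y")
      case False
      thus ?thesis using insert by blast
    next
      case True
      hence vw: "v \<in> carrier V" "w \<in> carrier W" using insert.prems p by (auto simp: formal_tensors_def)
      have s: "?s \<in> FT" using single_FT[OF vw] p by simp
      have z: "?z \<in> FT" using formal.subspace_diff[OF subspace_FT insert.prems(1) s] .
      have kz: "keys ?z \<subseteq> A"
      proof
        fix q assume "q \<in> keys ?z"
        thus "q \<in> A" using insert.prems(2)
          by (cases "q = p") (auto simp: in_keys_iff lookup_minus lookup_single)
      qed
      have "cls y = cls ?s \<oplus>\<^bsub>TS\<^esub> cls ?z" using TS_add[OF s z] by simp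
      also have "cls ?s = lookup y p \<odot>\<^bsub>TS\<^esub> pure v w"
        using p vw by (simp add: pure_tensor_def TS_scl single_FT)
      also have "\<dots> = formal_eval TS (\<lambda>(v, w). pure v w) ?s"
        using p vw by (simp add: T.formal_eval_single)
      also have "cls ?z = formal_eval TS (\<lambda>(v, w). pure v w) ?z"
        using insert.IH[OF z kz] by simp
      also have "formal_eval TS (\<lambda>(v, w). pure v w) ?s \<oplus>\<^bsub>TS\<^esub> \<dots> =
          formal_eval TS (\<lambda>(v, w). pure v w) (?s + ?z)"
        by (rule T.formal_eval_add[symmetric])
          (use bilinear_map_Pi[OF bilinear_pure s] bilinear_map_Pi[OF bilinear_pure z] in auto)
      finally show ?thesis by simp
    qed
  qed
  from this[OF finite_keys subset_refl assms] show ?thesis .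
qed

lemma hom_cls:
  assumes "vspace T" "h \<in> homs TS T" "x \<in> FT"
  shows "h (cls x) = formal_eval T (\<lambda>(v, w). h (pure v w)) x"
proof -
  have "h (cls x) = formal_eval T (\<lambda>p. h (case p of (v, w) \<Rightarrow> pure v w)) x"
    unfolding cls_eq_formal_eval[OF assms(3)]
    by (rule vspace_hom_formal_eval[OF vspace_TS assms(1,2)])
      (rule bilinear_map_Pi[OF bilinear_pure assms(3)])
  thus ?thesis by (simp add: case_prod_beta')
qed

text \<open>Pure tensors generate the tensor product.  Nearly all equations between maps on tensor products below
are obtained from this lemma.\<close>

lemma hom_eqI:
  assumes "vspace T" "g \<in> homs TS T" "h \<in> homs TS T"
    and "\<And>v w. v \<in> carrier V \<Longrightarrow> w \<in> carrier W \<Longrightarrow> g (pure v w) = h (pure v w)"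
    and "X \<in> carrier TS"
  shows "g X = h X"
proof -
  interpret T': vspace T by fact
  obtain x where x: "x \<in> FT" "X = cls x" using assms(5) by (auto simp: TS_carrier)
  have "formal_eval T (\<lambda>(v, w). g (pure v w)) x = formal_eval T (\<lambda>(v, w). h (pure v w)) x"
    unfolding formal_eval_def
    by (rule T'.M.finsum_cong')
      (use keys_FT[OF x(1)] assms(4) module_homsD(1)[OF assms(3)] in \<open>auto simp: case_prod_beta'\<close>)
  thus ?thesis using x hom_cls[OF assms(1)] assms(2,3) by simp
qed

text \<open>Moving the coefficients of a formal combination into the left factor leaves a plain sum of pure tensors.\<close>

lemma tensor_as_sum:
  assumes "X \<in> carrier TS"
  obtains n v w where "v \<in> {..<n::nat} \<rightarrow> carrier V" "w \<in> {..<n} \<rightarrow> carrier W"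
    "X = finsum TS (\<lambda>i. pure (v i) (w i)) {..<n}"
proof -
  obtain x where x: "x \<in> FT" "X = cls x" using assms by (auto simp: TS_carrier)
  let ?K = "keys x"
  obtain e where e: "bij_betw e {..<card ?K} ?K"
    using ex_bij_betw_nat_finite[of ?K] by (auto simp: atLeast0LessThan)
  define v where "v i = lookup x (e i) \<odot>\<^bsub>V\<^esub> fst (e i)" for i
  define w where "w i = snd (e i)" for i
  have ec: "fst (e i) \<in> carrier V" "snd (e i) \<in> carrier W" if "i < card ?K" for i
    using keys_FT[OF x(1), of "e i"] that bij_betwE[OF e] by auto
  have "X = finsum TS (\<lambda>p. lookup x p \<odot>\<^bsub>TS\<^esub> pure (fst p) (snd p)) (e ` {..<card ?K})"
    using x cls_eq_formal_eval[OF x(1)] bij_betw_imp_surj_on[OF e]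
    by (simp add: formal_eval_def case_prod_beta')
  also have "\<dots> = finsum TS (\<lambda>i. lookup x (e i) \<odot>\<^bsub>TS\<^esub> pure (fst (e i)) (snd (e i))) {..<card ?K}"
    by (rule T.M.add.finprod_reindex) (use ec bij_betw_imp_inj_on[OF e] in auto)
  also have "\<dots> = finsum TS (\<lambda>i. pure (v i) (w i)) {..<card ?K}"
  proof (rule T.M.finsum_cong')
    fix i assume "i \<in> {..<card ?K}"
    hence i: "fst (e i) \<in> carrier V" "snd (e i) \<in> carrier W" using ec by auto
    show "lookup x (e i) \<odot>\<^bsub>TS\<^esub> pure (fst (e i)) (snd (e i)) = pure (v i) (w i)"
      using vspace_hom_scl[of "\<lambda>v. pure v (snd (e i))" V TS] bilinear_pure i
      by (simp add: v_def w_def bilinear_map_def)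
  qed (use ec in \<open>auto simp: v_def w_def\<close>)
  finally have "X = finsum TS (\<lambda>i. pure (v i) (w i)) {..<card ?K}" .
  thus ?thesis by (intro that) (use ec in \<open>auto simp: v_def w_def\<close>)
qed

text \<open>The map \<open>id \<otimes> \<phi>\<close>, followed by the identification of \<open>V \<otimes> K\<close> with \<open>V\<close>.\<close>

abbreviation "slice \<phi> \<equiv> tensor_lift V (\<lambda>v w. \<phi> w \<odot>\<^bsub>V\<^esub> v)"

lemma bilinear_slice:
  assumes "\<phi> \<in> homs W (full_space (*))"
  shows "bilinear_map V W V (\<lambda>v w. \<phi> w \<odot>\<^bsub>V\<^esub> v)"
  using module_homsD(2)[OF assms] vspace_hom_scl[OF assms]
  by (intro bilinear_mapI vspace_homI)
    (simp_all add: V.scl_add_left V.scl_add_right V.scl_scl mult.commute)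

lemma slice_hom:
  "\<phi> \<in> homs W (full_space (*)) \<Longrightarrow> slice \<phi> \<in> homs TS V"
  by (intro tensor_lift_hom bilinear_slice V.vspace_axioms)

lemma slice_pure:
  "\<phi> \<in> homs W (full_space (*)) \<Longrightarrow> v \<in> carrier V \<Longrightarrow> w \<in> carrier W \<Longrightarrow>
    slice \<phi> (pure v w) = \<phi> w \<odot>\<^bsub>V\<^esub> v"
  by (intro tensor_lift_pure bilinear_slice V.vspace_axioms)

text \<open>The proof is by induction on the number of pure tensors in the sum, without bases.  If the last right factor
\<open>w n\<close> is nonzero, some \<open>\<phi>\<close> does not kill it, and the vanishing of the slice at \<open>\<phi>\<close> expresses \<open>v n\<close> as a
combination of the other \<open>v i\<close>.  By bilinearity the last term is then absorbed into the others.\<close>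

lemma tensor_zero_if_slices_zero:
  assumes \<Phi>: "\<Phi> \<subseteq> homs W (full_space (*))"
    and sep: "\<And>w. w \<in> carrier W \<Longrightarrow> \<forall>\<phi>\<in>\<Phi>. \<phi> w = 0 \<Longrightarrow> w = \<zero>\<^bsub>W\<^esub>"
    and X: "X \<in> carrier TS" and zero: "\<And>\<phi>. \<phi> \<in> \<Phi> \<Longrightarrow> slice \<phi> X = \<zero>\<^bsub>V\<^esub>"
  shows "X = \<zero>\<^bsub>TS\<^esub>"
proof -
  note pl = bilinear_pure[unfolded bilinear_map_def, THEN conjunct1, rule_format]
  note pr = bilinear_pure[unfolded bilinear_map_def, THEN conjunct2, rule_format]
  have key: "finsum TS (\<lambda>i. pure (v i) (w i)) {..<n} = \<zero>\<^bsub>TS\<^esub>"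
    if "v \<in> {..<n::nat} \<rightarrow> carrier V" "w \<in> {..<n} \<rightarrow> carrier W"
      "\<forall>\<phi>\<in>\<Phi>. slice \<phi> (finsum TS (\<lambda>i. pure (v i) (w i)) {..<n}) = \<zero>\<^bsub>V\<^esub>" for n v w
    using that
  proof (induction n arbitrary: w)
    case 0
    show ?case by simp
  next
    case (Suc n)
    have v: "v n \<in> carrier V" "v \<in> {..<n} \<rightarrow> carrier V" "\<And>i. i < n \<Longrightarrow> v i \<in> carrier V"
      and w: "w n \<in> carrier W" "w \<in> {..<n} \<rightarrow> carrier W" "\<And>i. i < n \<Longrightarrow> w i \<in> carrier W"
      using Suc.prems by auto
    let ?p = "\<lambda>i. pure (v i) (w i)"
    have pc: "?p \<in> {..<n} \<rightarrow> carrier TS" "?p n \<in> carrier TS" using v w by auto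
    have split: "finsum TS ?p {..<Suc n} = ?p n \<oplus>\<^bsub>TS\<^esub> finsum TS ?p {..<n}"
      using pc by (simp add: lessThan_Suc)
    show ?case
    proof (cases "w n = \<zero>\<^bsub>W\<^esub>")
      case True
      hence "?p n = \<zero>\<^bsub>TS\<^esub>"
        using vspace_hom_zero[OF W.vspace_axioms vspace_TS pr[OF v(1)]] by simp
      hence eq: "finsum TS ?p {..<Suc n} = finsum TS ?p {..<n}" using split pc by simp
      show ?thesis unfolding eq by (rule Suc.IH) (use v w Suc.prems(3) eq in auto)
    next
      case False
      then obtain \<phi> where \<phi>: "\<phi> \<in> \<Phi>" "\<phi> (w n) \<noteq> 0" using sep[OF w(1)] by auto
      have \<phi>h: "\<phi> \<in> homs W (full_space (*))" using \<phi> \<Phi> by auto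
      let ?a = "\<phi> (w n)"
      let ?s = "finsum V (\<lambda>i. \<phi> (w i) \<odot>\<^bsub>V\<^esub> v i) {..<n}"
      have sc: "(\<lambda>i. \<phi> (w i) \<odot>\<^bsub>V\<^esub> v i) \<in> {..<n} \<rightarrow> carrier V" using v by auto
      have "slice \<phi> (finsum TS ?p {..<n}) = finsum V (\<lambda>i. slice \<phi> (?p i)) {..<n}"
        by (rule vspace_hom_finsum[OF vspace_TS V.vspace_axioms slice_hom[OF \<phi>h]]) (use pc in auto)
      also have "\<dots> = ?s"
        by (rule V.M.finsum_cong') (use v w sc in \<open>auto simp: slice_pure[OF \<phi>h]\<close>)
      finally have s1: "slice \<phi> (finsum TS ?p {..<n}) = ?s" .
      have "slice \<phi> (finsum TS ?p {..<Suc n}) = ?a \<odot>\<^bsub>V\<^esub> v n \<oplus>\<^bsub>V\<^esub> ?s"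
        using pc module_homsD(2)[OF slice_hom[OF \<phi>h], of "?p n" "finsum TS ?p {..<n}"]
        by (simp add: split slice_pure[OF \<phi>h] v w s1)
      hence "?a \<odot>\<^bsub>V\<^esub> v n \<oplus>\<^bsub>V\<^esub> ?s = \<zero>\<^bsub>V\<^esub>" using Suc.prems(3) \<phi>(1) by simp
      hence "?a \<odot>\<^bsub>V\<^esub> v n = (- 1) \<odot>\<^bsub>V\<^esub> ?s"
        by (intro V.add_eq_zero_scl) (use v sc in auto)
      hence "(1 / ?a) \<odot>\<^bsub>V\<^esub> (?a \<odot>\<^bsub>V\<^esub> v n) = (1 / ?a) \<odot>\<^bsub>V\<^esub> ((- 1) \<odot>\<^bsub>V\<^esub> ?s)" by simp
      hence "v n = (- 1 / ?a) \<odot>\<^bsub>V\<^esub> ?s"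
        using \<phi>(2) v sc by (simp add: V.scl_scl V.M.finsum_closed)
      also have "\<dots> = finsum V (\<lambda>i. (- 1 / ?a) \<odot>\<^bsub>V\<^esub> (\<phi> (w i) \<odot>\<^bsub>V\<^esub> v i)) {..<n}"
        by (rule V.finsum_scl) (use sc in auto)
      finally have vn: "v n = finsum V (\<lambda>i. (- 1 / ?a) \<odot>\<^bsub>V\<^esub> (\<phi> (w i) \<odot>\<^bsub>V\<^esub> v i)) {..<n}" .
      define c where "c i = - 1 / ?a * \<phi> (w i)" for i
      have "?p n = finsum TS (\<lambda>i. pure ((- 1 / ?a) \<odot>\<^bsub>V\<^esub> (\<phi> (w i) \<odot>\<^bsub>V\<^esub> v i)) (w n)) {..<n}"
        by (subst vn, rule vspace_hom_finsum[OF V.vspace_axioms vspace_TS pl[OF w(1)]]) (use v in auto)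
      also have "\<dots> = finsum TS (\<lambda>i. pure (v i) (c i \<odot>\<^bsub>W\<^esub> w n)) {..<n}"
        by (rule T.M.finsum_cong')
          (use v w in \<open>auto simp: c_def V.scl_scl vspace_hom_scl[OF pr] vspace_hom_scl[OF pl]\<close>)
      finally have pn: "?p n = finsum TS (\<lambda>i. pure (v i) (c i \<odot>\<^bsub>W\<^esub> w n)) {..<n}" .
      define w' where "w' i = c i \<odot>\<^bsub>W\<^esub> w n \<oplus>\<^bsub>W\<^esub> w i" for i
      have "finsum TS ?p {..<Suc n}
          = finsum TS (\<lambda>i. pure (v i) (c i \<odot>\<^bsub>W\<^esub> w n) \<oplus>\<^bsub>TS\<^esub> ?p i) {..<n}"
        unfolding split pn by (rule T.M.finsum_addf[symmetric]) (use v w in auto)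
      also have "\<dots> = finsum TS (\<lambda>i. pure (v i) (w' i)) {..<n}"
        by (rule T.M.finsum_cong') (use v w in \<open>auto simp: w'_def module_homsD(2)[OF pr]\<close>)
      finally have eq: "finsum TS ?p {..<Suc n} = finsum TS (\<lambda>i. pure (v i) (w' i)) {..<n}" .
      show ?thesis unfolding eq
        by (rule Suc.IH) (use v w Suc.prems(3) eq in \<open>auto simp: w'_def\<close>)
    qed
  qed
  obtain n v w where "v \<in> {..<n::nat} \<rightarrow> carrier V" "w \<in> {..<n} \<rightarrow> carrier W"
    "X = finsum TS (\<lambda>i. pure (v i) (w i)) {..<n}"
    by (rule tensor_as_sum[OF X])
  with key[of v n w] zero show ?thesis by simp
qed

lemma tensor_eq_if_slices_eq:
  assumes \<Phi>: "\<Phi> \<subseteq> homs W (full_space (*))"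
    and sep: "\<And>w. w \<in> carrier W \<Longrightarrow> \<forall>\<phi>\<in>\<Phi>. \<phi> w = 0 \<Longrightarrow> w = \<zero>\<^bsub>W\<^esub>"
    and X: "X \<in> carrier TS" and Y: "Y \<in> carrier TS"
    and eq: "\<And>\<phi>. \<phi> \<in> \<Phi> \<Longrightarrow> slice \<phi> X = slice \<phi> Y"
  shows "X = Y"
proof -
  let ?D = "(- 1) \<odot>\<^bsub>TS\<^esub> Y \<oplus>\<^bsub>TS\<^esub> X"
  have "slice \<phi> ?D = \<zero>\<^bsub>V\<^esub>" if "\<phi> \<in> \<Phi>" for \<phi>
  proof -
    have h: "slice \<phi> \<in> homs TS V" using that \<Phi> by (intro slice_hom) auto
    have c: "slice \<phi> X \<in> carrier V" using module_homsD(1)[OF h X] .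
    have "slice \<phi> ?D = (- 1) \<odot>\<^bsub>V\<^esub> slice \<phi> X \<oplus>\<^bsub>V\<^esub> 1 \<odot>\<^bsub>V\<^esub> slice \<phi> X"
      using X Y c eq[OF that] by (simp add: module_homsD(2)[OF h] vspace_hom_scl[OF h])
    also have "\<dots> = (- 1 + 1) \<odot>\<^bsub>V\<^esub> slice \<phi> X" using c by (simp only: V.scl_add_left)
    finally show ?thesis using c by simp
  qed
  hence "?D = \<zero>\<^bsub>TS\<^esub>" by (intro tensor_zero_if_slices_zero[OF \<Phi> sep]) (use X Y in auto)
  hence "(- 1) \<odot>\<^bsub>TS\<^esub> Y = (- 1) \<odot>\<^bsub>TS\<^esub> X" by (intro T.add_eq_zero_scl) (use X Y in auto)
  hence "(- 1) \<odot>\<^bsub>TS\<^esub> ((- 1) \<odot>\<^bsub>TS\<^esub> Y) = (- 1) \<odot>\<^bsub>TS\<^esub> ((- 1) \<odot>\<^bsub>TS\<^esub> X)" by simp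
  thus ?thesis using X Y by (simp add: T.scl_scl)
qed

end

lemma tensor_pairI: "vspace V \<Longrightarrow> vspace W \<Longrightarrow> tensor_pair V W"
  by (simp add: tensor_pair_def)

lemma hom_scl:
  fixes T :: "('k::field, 't, 'z) module_scheme" and V :: "('k, 'v, 'y) module_scheme"
  assumes "vspace T" "h \<in> homs V T"
  shows "(\<lambda>x. k \<odot>\<^bsub>T\<^esub> h x) \<in> homs V T"
proof -
  interpret T: vspace T by fact
  show ?thesis
    using assms(2)
    by (intro vspace_homI)
      (simp_all add: module_homsD vspace_hom_scl T.scl_add_right T.scl_scl mult.commute)
qed

lemma bilinear_mapD:
  assumes "bilinear_map V W T b"
  shows "w \<in> carrier W \<Longrightarrow> (\<lambda>v. b v w) \<in> homs V T"
    and "v \<in> carrier V \<Longrightarrow> b v \<in> homs W T"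
  using assms by (auto simp: bilinear_map_def)

lemma bilinear_map_comp:
  assumes "f \<in> homs A V" "g \<in> homs B W" "bilinear_map V W T b"
  shows "bilinear_map A B T (\<lambda>x y. b (f x) (g y))"
proof (rule bilinear_mapI)
  fix y assume "y \<in> carrier B"
  hence "g y \<in> carrier W" by (rule module_homsD(1)[OF assms(2)])
  from vspace_hom_comp[OF assms(1) bilinear_mapD(1)[OF assms(3) this]]
  show "(\<lambda>x. b (f x) (g y)) \<in> homs A T" .
next
  fix x assume "x \<in> carrier A"
  hence "f x \<in> carrier V" by (rule module_homsD(1)[OF assms(1)])
  from vspace_hom_comp[OF assms(2) bilinear_mapD(2)[OF assms(3) this]]
  show "(\<lambda>y. b (f x) (g y)) \<in> homs B T" .
qed

lemma
  assumes sp: "vspace A" "vspace B" "vspace V" "vspace W"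
    and f: "f \<in> homs A V" and g: "g \<in> homs B W"
  shows tensor_map_hom:
      "tensor_map V W f g \<in> homs (tensor_space A B) (tensor_space V W)"
    and tensor_map_pure:
      "a \<in> carrier A \<Longrightarrow> b \<in> carrier B \<Longrightarrow>
        tensor_map V W f g (pure_tensor A B a b) = pure_tensor V W (f a) (g b)"
proof -
  interpret AB: tensor_pair A B by (rule tensor_pairI) fact+
  interpret VW: tensor_pair V W by (rule tensor_pairI) fact+
  note bil = bilinear_map_comp[OF f g VW.bilinear_pure]
  show "tensor_map V W f g \<in> homs AB.TS VW.TS"
    unfolding tensor_map_def by (rule AB.tensor_lift_hom[OF VW.vspace_TS bil])
  show "tensor_map V W f g (AB.pure a b) = VW.pure (f a) (g b)"
    if "a \<in> carrier A" "b \<in> carrier B"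
    unfolding tensor_map_def by (rule AB.tensor_lift_pure[OF VW.vspace_TS bil that])
qed

text \<open>The slot map \<open>\<beta> w\<close> is \<open>u \<otimes> v \<mapsto> u \<otimes> (v \<otimes> w)\<close>.  Its linearity in \<open>w\<close> has to be checked for all tensors
in place of \<open>u \<otimes> v\<close>, and this reduces to pure ones.\<close>

lemma
  fixes U :: "('k::field, 'u, 'x) module_scheme"
    and V :: "('k, 'v, 'y) module_scheme" and W :: "('k, 'w, 'z) module_scheme"
  assumes sp: "vspace U" "vspace V" "vspace W"
  defines "T \<equiv> tensor_space U (tensor_space V W)"
  defines "\<beta> \<equiv> \<lambda>w. tensor_lift T (\<lambda>u v. pure_tensor U (tensor_space V W) u (pure_tensor V W v w))"
  shows tensor_assoc_hom:
      "tensor_assoc U V W \<in> homs (tensor_space (tensor_space U V) W) T"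
    and tensor_assoc_pure_left:
      "t \<in> carrier (tensor_space U V) \<Longrightarrow> w \<in> carrier W \<Longrightarrow>
        tensor_assoc U V W (pure_tensor (tensor_space U V) W t w) = \<beta> w t"
    and tensor_assoc_slot_hom:
      "w \<in> carrier W \<Longrightarrow> \<beta> w \<in> homs (tensor_space U V) T"
    and tensor_assoc_slot_pure:
      "u \<in> carrier U \<Longrightarrow> v \<in> carrier V \<Longrightarrow> w \<in> carrier W \<Longrightarrow>
        \<beta> w (pure_tensor U V u v) = pure_tensor U (tensor_space V W) u (pure_tensor V W v w)"
proof -
  interpret UV: tensor_pair U V by (rule tensor_pairI) fact+
  interpret VW: tensor_pair V W by (rule tensor_pairI) fact+
  interpret UVW: tensor_pair U VW.TS by (rule tensor_pairI) (fact, rule VW.vspace_TS)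
  interpret L: tensor_pair UV.TS W by (rule tensor_pairI) (rule UV.vspace_TS, fact)
  note T_vs = UVW.vspace_TS[folded T_def]
  have bil: "bilinear_map U V T (\<lambda>u v. UVW.pure u (VW.pure v w))" if "w \<in> carrier W" for w
  proof (rule bilinear_map_comp)
    show "(\<lambda>u. u) \<in> homs U U" by (rule vspace_homI) auto
    show "(\<lambda>v. VW.pure v w) \<in> homs V VW.TS"
      by (rule bilinear_mapD(1)[OF VW.bilinear_pure that])
    show "bilinear_map U VW.TS T UVW.pure" unfolding T_def by (rule UVW.bilinear_pure)
  qed
  show slot_hom: "\<beta> w \<in> homs UV.TS T" if "w \<in> carrier W" for w
    unfolding \<beta>_def by (rule UV.tensor_lift_hom[OF T_vs bil[OF that]])
  show slot_pure: "\<beta> w (UV.pure u v) = UVW.pure u (VW.pure v w)"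
    if "u \<in> carrier U" "v \<in> carrier V" "w \<in> carrier W" for u v w
    unfolding \<beta>_def by (rule UV.tensor_lift_pure[OF T_vs bil[OF that(3)] that(1,2)])
  have bil2: "bilinear_map UV.TS W T (\<lambda>t w. \<beta> w t)"
  proof (rule bilinear_mapI)
    fix t assume t: "t \<in> carrier UV.TS"
    show "(\<lambda>w. \<beta> w t) \<in> homs W T"
    proof (rule vspace_homI_combination[OF sp(3) T_vs])
      fix w assume w: "w \<in> carrier W"
      show "\<beta> w t \<in> carrier T" using module_homsD(1)[OF slot_hom[OF w] t] .
      fix k w' assume w': "w' \<in> carrier W"
      have c: "k \<odot>\<^bsub>W\<^esub> w \<oplus>\<^bsub>W\<^esub> w' \<in> carrier W" using w w' by simp
      show "\<beta> (k \<odot>\<^bsub>W\<^esub> w \<oplus>\<^bsub>W\<^esub> w') t = k \<odot>\<^bsub>T\<^esub> \<beta> w t \<oplus>\<^bsub>T\<^esub> \<beta> w' t"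
      proof (rule UV.hom_eqI[OF T_vs slot_hom[OF c]
            hom_add_scl[OF T_vs slot_hom[OF w] slot_hom[OF w']] _ t])
        fix u v assume uv: "u \<in> carrier U" "v \<in> carrier V"
        show "\<beta> (k \<odot>\<^bsub>W\<^esub> w \<oplus>\<^bsub>W\<^esub> w') (UV.pure u v)
            = k \<odot>\<^bsub>T\<^esub> \<beta> w (UV.pure u v) \<oplus>\<^bsub>T\<^esub> \<beta> w' (UV.pure u v)"
          using uv w w' c
          by (simp add: slot_pure T_def VW.pure_linear_right UVW.pure_linear_right)
      qed
    qed
  qed (rule slot_hom)
  have assoc: "tensor_assoc U V W = tensor_lift T (\<lambda>t w. \<beta> w t)"
    unfolding tensor_assoc_def Let_def \<beta>_def T_def ..
  show "tensor_assoc U V W \<in> homs L.TS T"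
    unfolding assoc by (rule L.tensor_lift_hom[OF T_vs bil2])
  show "tensor_assoc U V W (L.pure t w) = \<beta> w t" if "t \<in> carrier UV.TS" "w \<in> carrier W"
    unfolding assoc by (rule L.tensor_lift_pure[OF T_vs bil2 that])
qed

section \<open>The dual algebra acting on the coalgebra\<close>

abbreviation K_space :: "('k::field, 'k) module" where
  "K_space \<equiv> full_space (*)"

lemma vspace_K: "vspace K_space"
  by (rule vspace_full_space[OF vector_space_field])

lemma bilinear_map_mult:
  assumes "f \<in> homs V K_space" "g \<in> homs W K_space"
  shows "bilinear_map V W K_space (\<lambda>v w. f v * g w)"
  using module_homsD(2)[OF assms(1)] module_homsD(2)[OF assms(2)]
    vspace_hom_scl[OF assms(1)] vspace_hom_scl[OF assms(2)]
  by (intro bilinear_mapI vspace_homI) (simp_all add: algebra_simps)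

context coalgebra
begin

abbreviation lin :: "('c \<Rightarrow> 'k) \<Rightarrow> bool" where
  "lin f \<equiv> Vector_Spaces.linear scale (*) f"

lemma vspace_C: "vspace C_space"
  by (rule vspace_full_space) (rule vector_space_axioms)

interpretation CC: tensor_pair C_space C_space
  by (rule tensor_pairI) (rule vspace_C)+

lemma functionals: "vector_space_pair scale ((*) :: 'k \<Rightarrow> 'k \<Rightarrow> 'k)"
  unfolding vector_space_pair_def using vector_space_axioms vector_space_field by simp

lemma lin_iff_hom: "lin f \<longleftrightarrow> f \<in> homs C_space K_space"
  by (simp add: full_space_hom_iff_linear vector_space_axioms vector_space_field)

lemma lin_hom: "lin f \<Longrightarrow> f \<in> homs C_space K_space"
  by (simp add: lin_iff_hom)

lemma linI: "(\<And>x y. f (x + y) = f x + f y) \<Longrightarrow> (\<And>k x. f (scale k x) = k * f x) \<Longrightarrow> lin f"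
  by (simp add: Vector_Spaces.linear_iff vector_space_axioms vector_space_field)

lemma linD:
  assumes "lin f"
  shows "f (x + y) = f x + f y" "f (x - y) = f x - f y" "f (scale k x) = k * f x" "f 0 = 0"
proof -
  have add: "f (u + v) = f u + f v" for u v
    using assms by (simp add: Vector_Spaces.linear_iff)
  show "f (x + y) = f x + f y" by (rule add)
  show "f (x - y) = f x - f y" using add[of "x - y" y] by simp
  show "f (scale k x) = k * f x" using assms by (simp add: Vector_Spaces.linear_iff)
  have "f (scale 0 0) = 0 * f 0" using assms unfolding Vector_Spaces.linear_iff by blast
  thus "f 0 = 0" by simp
qed

lemma lin_add:
  assumes "lin f" "lin g" shows "lin (\<lambda>c. f c + g c)"
  by (rule linI) (simp_all add: linD[OF assms(1)] linD[OF assms(2)] algebra_simps)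

lemma lin_diff:
  assumes "lin f" "lin g" shows "lin (\<lambda>c. f c - g c)"
  by (rule linI) (simp_all add: linD[OF assms(1)] linD[OF assms(2)] algebra_simps)

lemma lin_scale:
  assumes "lin f" shows "lin (\<lambda>c. k * f c)"
  by (rule linI) (simp_all add: linD[OF assms] algebra_simps)

lemma lin_zero: "lin (\<lambda>c. 0)"
  by (rule linI) simp_all

lemma lin_counit: "lin counit" by (rule counit_linear)

lemma functional_separates_subspace:
  assumes "subspace U" "x \<notin> U"
  obtains f where "lin f" "f x = 1" "\<And>u. u \<in> U \<Longrightarrow> f u = 0"
proof -
  obtain B where B: "B \<subseteq> U" "independent B" "U \<subseteq> span B"
    by (rule basis_exists[of U])
  have sB: "span B = U"
    by (rule equalityI[OF span_minimal[OF B(1) assms(1)] B(3)])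
  have "independent (insert x B)"
    by (rule independent_insertI) (simp_all add: B(2) sB assms(2))
  from vector_space_pair.linear_independent_extend[OF functionals this, of "\<lambda>y. if y = x then 1 else 0"]
  obtain f where f: "lin f" "\<forall>y\<in>insert x B. f y = (if y = x then 1 else 0)"
    by (elim exE conjE)
  have "f b = 0" if "b \<in> B" for b
    using that f(2) B(1) assms(2) by auto
  hence "f u = 0" if "u \<in> span B" for u
    using vector_space_pair.linear_eq_0_on_span[OF functionals f(1) _ that] by simp
  thus ?thesis using that[of f] f sB by simp
qed

text \<open>This turns identities between elements of the coalgebra into identities between functionals.\<close>

lemma eq_if_functionals_eq:
  assumes "\<And>f. lin f \<Longrightarrow> f x = f y"
  shows "x = y"
proof (rule ccontr)
  assume "x \<noteq> y"
  hence "x - y \<notin> {0}" by simp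
  from functional_separates_subspace[OF subspace_single_0 this]
  obtain f where "lin f" "f (x - y) = 1" by metis
  thus False using assms[of f] linD(2)[of f x y] by simp
qed

text \<open>The product of the dual algebra and its two actions on the coalgebra: \<open>lact f c\<close> is \<open>f \<cdot> c\<close> and \<open>ract f c\<close>
is \<open>c \<cdot> f\<close>.\<close>

definition conv :: "('c \<Rightarrow> 'k) \<Rightarrow> ('c \<Rightarrow> 'k) \<Rightarrow> 'c \<Rightarrow> 'k" where
  "conv f g c = tensor_lift K_space (\<lambda>a b. f a * g b) (comult c)"

definition lact :: "('c \<Rightarrow> 'k) \<Rightarrow> 'c \<Rightarrow> 'c" where
  "lact f c = tensor_lift C_space (\<lambda>a b. scale (f b) a) (comult c)"

definition ract :: "('c \<Rightarrow> 'k) \<Rightarrow> 'c \<Rightarrow> 'c" where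
  "ract f c = tensor_lift C_space (\<lambda>a b. scale (f a) b) (comult c)"

lemma comult_closed: "comult c \<in> carrier CC.TS"
  using module_homsD(1)[OF comult_linear, of c] by simp

lemma bilinear_pairing: "lin f \<Longrightarrow> lin g \<Longrightarrow> bilinear_map C_space C_space K_space (\<lambda>a b. f a * g b)"
  by (intro bilinear_map_mult lin_hom)

lemma pairing_hom:
  "lin f \<Longrightarrow> lin g \<Longrightarrow> tensor_lift K_space (\<lambda>a b. f a * g b) \<in> homs CC.TS K_space"
  by (intro CC.tensor_lift_hom vspace_K bilinear_pairing)

lemma bilinear_lact: "lin f \<Longrightarrow> bilinear_map C_space C_space C_space (\<lambda>a b. scale (f b) a)"
  using CC.bilinear_slice[OF lin_hom, of f] by simp

lemma bilinear_ract:
  assumes "lin f" shows "bilinear_map C_space C_space C_space (\<lambda>a b. scale (f a) b)"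
  by (intro bilinear_mapI vspace_homI)
    (simp_all add: linD[OF assms] scale_left_distrib scale_right_distrib mult.commute)

text \<open>The two actions are adjoint to the two multiplications.  Since functionals separate points, facts pass
between product and actions in both directions: the product is associative because the left action is,
and the identities for the right action come from those for the product.\<close>

lemma functional_lact:
  assumes h: "lin h" and f: "lin f"
  shows "h (lact f c) = conv h f c"
  unfolding lact_def conv_def
proof (rule CC.hom_eqI[OF vspace_K _ pairing_hom[OF h f] _ comult_closed])
  show "(\<lambda>t. h (tensor_lift C_space (\<lambda>a b. scale (f b) a) t)) \<in> homs CC.TS K_space"
    by (rule vspace_hom_comp[OF CC.tensor_lift_hom[OF vspace_C bilinear_lact[OF f]] lin_hom[OF h]])
next
  fix v w :: 'c
  show "h (tensor_lift C_space (\<lambda>a b. scale (f b) a) (CC.pure v w)) =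
      tensor_lift K_space (\<lambda>a b. h a * f b) (CC.pure v w)"
    using CC.tensor_lift_pure[OF vspace_C bilinear_lact[OF f]]
      CC.tensor_lift_pure[OF vspace_K bilinear_pairing[OF h f]]
    by (simp add: linD[OF h] mult.commute)
qed

lemma functional_ract:
  assumes h: "lin h" and f: "lin f"
  shows "h (ract f c) = conv f h c"
  unfolding ract_def conv_def
proof (rule CC.hom_eqI[OF vspace_K _ pairing_hom[OF f h] _ comult_closed])
  show "(\<lambda>t. h (tensor_lift C_space (\<lambda>a b. scale (f a) b) t)) \<in> homs CC.TS K_space"
    by (rule vspace_hom_comp[OF CC.tensor_lift_hom[OF vspace_C bilinear_ract[OF f]] lin_hom[OF h]])
next
  fix v w :: 'c
  show "h (tensor_lift C_space (\<lambda>a b. scale (f a) b) (CC.pure v w)) =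
      tensor_lift K_space (\<lambda>a b. f a * h b) (CC.pure v w)"
    using CC.tensor_lift_pure[OF vspace_C bilinear_ract[OF f]]
      CC.tensor_lift_pure[OF vspace_K bilinear_pairing[OF f h]]
    by (simp add: linD[OF h] mult.commute)
qed

lemma lin_conv: "lin f \<Longrightarrow> lin g \<Longrightarrow> lin (conv f g)"
  unfolding lin_iff_hom[of "conv f g"] conv_def
  by (rule vspace_hom_comp[OF comult_linear pairing_hom])

text \<open>Let \<open>A f\<close> be the slice at \<open>f\<close>, so that \<open>m \<mapsto> A f (\<rho> m)\<close> is the operator by which \<open>f\<close> acts through \<open>\<rho>\<close>.
Applying \<open>v \<otimes> a \<otimes> b \<mapsto> g(a) h(b) v\<close> to the two sides of the coassociativity law yields the action of \<open>h\<close>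
followed by that of \<open>g\<close>, and the action of the product \<open>g h\<close>.  Coassociativity of \<open>\<rho>\<close> thus amounts to
associativity of the action; this is used in one direction for \<open>C\<close> and in the other for rational modules.\<close>

lemma coassoc_slices:
  fixes V :: "('k, 'v) module"
  assumes V: "vspace V" and \<rho>: "\<rho> \<in> homs V (tensor_space V C_space)"
    and g: "lin g" and h: "lin h" and m: "m \<in> carrier V"
  defines "A \<equiv> \<lambda>f. tensor_lift V (\<lambda>v c. f c \<odot>\<^bsub>V\<^esub> v)"
  defines "E \<equiv> tensor_lift V (\<lambda>v t. tensor_lift K_space (\<lambda>a b. g a * h b) t \<odot>\<^bsub>V\<^esub> v)"
  shows "E (tensor_assoc V C_space C_space (tensor_map (tensor_space V C_space) C_space \<rho> id (\<rho> m)))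
      = A g (\<rho> (A h (\<rho> m)))"
    and "E (tensor_map V (tensor_space C_space C_space) id comult (\<rho> m)) = A (conv g h) (\<rho> m)"
proof -
  interpret V: vspace V by fact
  interpret VC: tensor_pair V C_space by (rule tensor_pairI[OF V vspace_C])
  interpret VCC: tensor_pair V CC.TS by (rule tensor_pairI[OF V CC.vspace_TS])
  note \<rho>m = module_homsD(1)[OF \<rho> m]
  have E_hom: "E \<in> homs VCC.TS V"
    unfolding E_def by (rule VCC.slice_hom[OF pairing_hom[OF g h]])
  have E_pure: "E (VCC.pure v t) = tensor_lift K_space (\<lambda>a b. g a * h b) t \<odot>\<^bsub>V\<^esub> v"
    if "v \<in> carrier V" "t \<in> carrier CC.TS" for v t
    unfolding E_def by (rule VCC.slice_pure[OF pairing_hom[OF g h] that])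
  have A_hom: "A f \<in> homs VC.TS V" if "lin f" for f
    unfolding A_def by (rule VC.slice_hom[OF lin_hom[OF that]])
  have A_pure: "A f (VC.pure v c) = f c \<odot>\<^bsub>V\<^esub> v" if "lin f" "v \<in> carrier V" for f v c
    unfolding A_def using VC.slice_pure[OF lin_hom[OF that(1)] that(2)] by simp
  have id_hom: "id \<in> homs W W" for W :: "('k, 'x) module"
    by (rule vspace_homI) auto
  note map1_hom = tensor_map_hom[OF V vspace_C VC.vspace_TS vspace_C \<rho> id_hom]
  note map1_pure = tensor_map_pure[OF V vspace_C VC.vspace_TS vspace_C \<rho> id_hom]
  note map2_hom = tensor_map_hom[OF V vspace_C V CC.vspace_TS id_hom comult_linear]
  note map2_pure = tensor_map_pure[OF V vspace_C V CC.vspace_TS id_hom comult_linear]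
  note as_hom = tensor_assoc_hom[OF V vspace_C vspace_C]
  note as_left = tensor_assoc_pure_left[OF V vspace_C vspace_C]
  note slot_hom = tensor_assoc_slot_hom[OF V vspace_C vspace_C]
  note slot_pure = tensor_assoc_slot_pure[OF V vspace_C vspace_C]
  have E_assoc: "E (tensor_assoc V C_space C_space (pure_tensor VC.TS C_space t c)) = h c \<odot>\<^bsub>V\<^esub> A g t"
    if t: "t \<in> carrier VC.TS" for t c
  proof -
    have c: "c \<in> carrier C_space" by simp
    show ?thesis
      unfolding as_left[OF t c]
    proof (rule VC.hom_eqI[OF V vspace_hom_comp[OF slot_hom[OF c] E_hom]
          hom_scl[OF V A_hom[OF g]] _ t])
      fix v w assume v: "v \<in> carrier V" and w: "w \<in> carrier C_space"
      have "tensor_lift K_space (\<lambda>a b. g a * h b) (CC.pure w c) = g w * h c"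
        using CC.tensor_lift_pure[OF vspace_K bilinear_pairing[OF g h] w c] .
      thus "E (tensor_lift VCC.TS (\<lambda>u v. VCC.pure u (CC.pure v c)) (VC.pure v w)) =
          h c \<odot>\<^bsub>V\<^esub> A g (VC.pure v w)"
        using v w by (simp add: slot_pure[OF v w c] E_pure A_pure[OF g] V.scl_scl mult.commute)
    qed
  qed
  show "E (tensor_assoc V C_space C_space (tensor_map VC.TS C_space \<rho> id (\<rho> m))) = A g (\<rho> (A h (\<rho> m)))"
  proof (rule VC.hom_eqI[OF V vspace_hom_comp[OF vspace_hom_comp[OF map1_hom as_hom] E_hom]
        vspace_hom_comp[OF vspace_hom_comp[OF A_hom[OF h] \<rho>] A_hom[OF g]] _ \<rho>m])
    fix v w assume v: "v \<in> carrier V" and w: "w \<in> carrier C_space"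
    have "tensor_map VC.TS C_space \<rho> id (VC.pure v w) = pure_tensor VC.TS C_space (\<rho> v) w"
      using map1_pure[OF v w] by simp
    moreover have "A g (\<rho> (h w \<odot>\<^bsub>V\<^esub> v)) = h w \<odot>\<^bsub>V\<^esub> A g (\<rho> v)"
      using v module_homsD(1)[OF \<rho> v]
      by (simp add: vspace_hom_scl[OF \<rho>] vspace_hom_scl[OF A_hom[OF g]])
    ultimately show "E (tensor_assoc V C_space C_space (tensor_map VC.TS C_space \<rho> id (VC.pure v w)))
        = A g (\<rho> (A h (VC.pure v w)))"
      using v by (simp add: A_pure[OF h] E_assoc module_homsD(1)[OF \<rho>])
  qed
  show "E (tensor_map V CC.TS id comult (\<rho> m)) = A (conv g h) (\<rho> m)"
  proof (rule VC.hom_eqI[OF V vspace_hom_comp[OF map2_hom E_hom] A_hom[OF lin_conv[OF g h]] _ \<rho>m])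
    fix v w assume v: "v \<in> carrier V" and w: "w \<in> carrier C_space"
    show "E (tensor_map V CC.TS id comult (VC.pure v w)) = A (conv g h) (VC.pure v w)"
      using map2_pure[OF v w] v
      by (simp add: E_pure comult_closed A_pure[OF lin_conv[OF g h]] conv_def)
  qed
qed

lemma lact_lact:
  assumes "lin f" "lin g"
  shows "lact f (lact g c) = lact (conv f g) c"
proof -
  note s = coassoc_slices[OF vspace_C comult_linear assms, of c]
  show ?thesis
    using s by (simp add: coassociative lact_def)
qed

lemma lact_counit: "lact counit c = c"
  unfolding lact_def by (rule counit_right)

lemma ract_counit: "ract counit c = c"
  unfolding ract_def by (rule counit_left)

lemma conv_assoc:
  assumes "lin f" "lin g" "lin h"
  shows "conv (conv f g) h = conv f (conv g h)"
proof
  fix c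
  show "conv (conv f g) h c = conv f (conv g h) c"
    using assms by (simp add: functional_lact[symmetric] lact_lact lin_conv)
qed

lemma conv_counit_right: "lin f \<Longrightarrow> conv f counit = f"
  using lin_counit by (auto simp: functional_lact[symmetric] lact_counit)

lemma conv_counit_left: "lin f \<Longrightarrow> conv counit f = f"
  using lin_counit by (auto simp: functional_ract[symmetric] ract_counit)

lemma conv_add_left:
  assumes "lin f" "lin g" "lin h"
  shows "conv (\<lambda>c. f c + g c) h = (\<lambda>c. conv f h c + conv g h c)"
  using functional_lact[OF lin_add[OF assms(1,2)] assms(3)]
  by (auto simp: functional_lact assms fun_eq_iff)

lemma conv_add_right:
  assumes "lin f" "lin g" "lin h"
  shows "conv h (\<lambda>c. f c + g c) = (\<lambda>c. conv h f c + conv h g c)"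
  using functional_ract[OF lin_add[OF assms(1,2)] assms(3)]
  by (auto simp: functional_ract assms fun_eq_iff)

lemma conv_scale:
  assumes "lin f" "lin h"
  shows "conv (\<lambda>c. k * f c) h = (\<lambda>c. k * conv f h c)"
    and "conv h (\<lambda>c. k * f c) = (\<lambda>c. k * conv h f c)"
  using functional_lact[OF lin_scale[OF assms(1)] assms(2)]
    functional_ract[OF lin_scale[OF assms(1)] assms(2)]
  by (auto simp: functional_lact functional_ract assms fun_eq_iff)

lemma lact_linear: 
  assumes "lin f" shows "Vector_Spaces.linear scale scale (lact f)"
proof -
  have "lact f \<in> homs C_space C_space"
    unfolding lact_def
    by (rule vspace_hom_comp[OF comult_linear CC.tensor_lift_hom[OF vspace_C bilinear_lact[OF assms]]])
  thus ?thesis by (simp add: full_space_hom_iff_linear vector_space_axioms)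
qed

lemma ract_linear: 
  assumes "lin f" shows "Vector_Spaces.linear scale scale (ract f)"
proof -
  have "ract f \<in> homs C_space C_space"
    unfolding ract_def
    by (rule vspace_hom_comp[OF comult_linear CC.tensor_lift_hom[OF vspace_C bilinear_ract[OF assms]]])
  thus ?thesis by (simp add: full_space_hom_iff_linear vector_space_axioms)
qed

lemma lact_simps:
  assumes "lin f"
  shows "lact f 0 = 0" "lact f (x + y) = lact f x + lact f y"
    "lact f (x - y) = lact f x - lact f y" "lact f (scale k x) = scale k (lact f x)"
proof -
  interpret l: Vector_Spaces.linear scale scale "lact f" by (rule lact_linear[OF assms])
  show "lact f 0 = 0" "lact f (x + y) = lact f x + lact f y"
    "lact f (x - y) = lact f x - lact f y" "lact f (scale k x) = scale k (lact f x)"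
    by (rule l.zero, rule l.add, rule l.diff, rule l.scale)
qed

lemma ract_simps:
  assumes "lin f"
  shows "ract f 0 = 0" "ract f (x + y) = ract f x + ract f y"
proof -
  interpret r: Vector_Spaces.linear scale scale "ract f" by (rule ract_linear[OF assms])
  show "ract f 0 = 0" "ract f (x + y) = ract f x + ract f y" by (rule r.zero, rule r.add)
qed

lemma lact_ract_commute:
  assumes "lin f" "lin g" shows "lact f (ract g c) = ract g (lact f c)"
  by (rule eq_if_functionals_eq)
    (use assms in \<open>simp add: functional_lact functional_ract lin_conv conv_assoc[symmetric]
      functional_ract[symmetric, of "conv _ _"]\<close>)

lemma ract_ract:
  assumes "lin f" "lin g" shows "ract f (ract g c) = ract (conv g f) c"
  by (rule eq_if_functionals_eq)
    (use assms in \<open>simp add: functional_ract lin_conv conv_assoc\<close>)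

lemma lact_add:
  assumes "lin f" "lin g" shows "lact (\<lambda>c. f c + g c) c = lact f c + lact g c"
proof (rule eq_if_functionals_eq)
  fix h :: "'c \<Rightarrow> 'k" assume h: "lin h"
  show "h (lact (\<lambda>c. f c + g c) c) = h (lact f c + lact g c)"
    using assms h by (simp add: functional_lact linD[OF h] lin_add conv_add_right)
qed

lemma ract_add:
  assumes "lin f" "lin g" shows "ract (\<lambda>c. f c + g c) c = ract f c + ract g c"
proof (rule eq_if_functionals_eq)
  fix h :: "'c \<Rightarrow> 'k" assume h: "lin h"
  show "h (ract (\<lambda>c. f c + g c) c) = h (ract f c + ract g c)"
    using assms h by (simp add: functional_ract linD[OF h] lin_add conv_add_left)
qed

lemma ract_scale:
  assumes "lin f" shows "ract (\<lambda>c. k * f c) c = scale k (ract f c)"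
proof (rule eq_if_functionals_eq)
  fix h :: "'c \<Rightarrow> 'k" assume h: "lin h"
  show "h (ract (\<lambda>c. k * f c) c) = h (scale k (ract f c))"
    using assms h by (simp add: functional_ract linD[OF h] lin_scale conv_scale(1))
qed

text \<open>Any representative of \<open>\<Delta> c\<close> computes the action, so control over its keys becomes control over \<open>c \<cdot> f\<close>.\<close>

lemma ract_by_representative:
  assumes "comult c = CC.cls t" "lin f" "keys t \<subseteq> UNIV \<times> X"
  shows "ract f c \<in> span X"
proof -
  have "t \<in> CC.FT" by (simp add: formal_tensors_def)
  hence "ract f c = formal_eval C_space (\<lambda>(a, b). scale (f a) b) t"
    unfolding ract_def assms(1)
    by (rule CC.tensor_lift_cls[OF vspace_C bilinear_ract[OF assms(2)]])
  also have "\<dots> = (\<Sum>p\<in>keys t. scale (lookup t p) (scale (f (fst p)) (snd p)))"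
    unfolding formal_eval_def finsum_full_space[OF vector_space_axioms]
    by (simp add: case_prod_beta')
  also have "\<dots> \<in> span X"
    using assms(3) by (intro span_sum span_scale span_base) auto
  finally show ?thesis .
qed

lemma lact_by_representative:
  assumes "comult c = CC.cls t" "lin f" "\<And>p. p \<in> keys t \<Longrightarrow> f (snd p) = 0"
  shows "lact f c = 0"
proof -
  have "t \<in> CC.FT" by (simp add: formal_tensors_def)
  hence "lact f c = formal_eval C_space (\<lambda>(a, b). scale (f b) a) t"
    unfolding lact_def assms(1)
    by (rule CC.tensor_lift_cls[OF vspace_C bilinear_lact[OF assms(2)]])
  also have "\<dots> = (\<Sum>p\<in>keys t. scale (lookup t p) (scale (f (snd p)) (fst p)))"
    unfolding formal_eval_def finsum_full_space[OF vector_space_axioms]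
    by (simp add: case_prod_beta')
  also have "\<dots> = 0" using assms(3) by (intro sum.neutral) auto
  finally show ?thesis .
qed

lemma comult_representative: obtains t where "comult c = CC.cls t"
  using comult_closed[of c] by (auto simp: CC.TS_carrier)

lemma lact_finite:
  obtains S where "finite S" "\<And>f. lin f \<Longrightarrow> \<forall>s\<in>S. f s = 0 \<Longrightarrow> lact f c = 0"
proof -
  obtain t where t: "comult c = CC.cls t" by (rule comult_representative)
  show ?thesis
    by (rule that[of "snd ` keys t"]) (auto intro: lact_by_representative[OF t])
qed

text \<open>The local finiteness of comodules: the submodule generated by one element is finite-dimensional.\<close>

lemma ract_finite:
  obtains S where "finite S" "\<And>f. lin f \<Longrightarrow> ract f c \<in> span S"
proof -
  obtain t where t: "comult c = CC.cls t" by (rule comult_representative)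
  have "keys t \<subseteq> UNIV \<times> snd ` keys t" by force
  thus ?thesis
    by (intro that[of "snd ` keys t"]) (auto intro: ract_by_representative[OF t])
qed

end

section \<open>Modules over a noncommutative ring\<close>

context left_module
begin

lemma smult_zero_left: "x \<in> carrier M \<Longrightarrow> \<zero>\<^bsub>R\<^esub> \<odot>\<^bsub>M\<^esub> x = \<zero>\<^bsub>M\<^esub>"
proof -
  assume x: "x \<in> carrier M"
  have "\<zero>\<^bsub>R\<^esub> \<odot>\<^bsub>M\<^esub> x = \<zero>\<^bsub>R\<^esub> \<odot>\<^bsub>M\<^esub> x \<oplus>\<^bsub>M\<^esub> \<zero>\<^bsub>R\<^esub> \<odot>\<^bsub>M\<^esub> x"
    using smult_l_distr[OF R.zero_closed R.zero_closed x] by simp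
  thus ?thesis using smult_closed[OF R.zero_closed x] by (metis M.add.r_cancel_one')
qed

lemma smult_zero_right: "a \<in> carrier R \<Longrightarrow> a \<odot>\<^bsub>M\<^esub> \<zero>\<^bsub>M\<^esub> = \<zero>\<^bsub>M\<^esub>"
proof -
  assume a: "a \<in> carrier R"
  have "a \<odot>\<^bsub>M\<^esub> \<zero>\<^bsub>M\<^esub> = a \<odot>\<^bsub>M\<^esub> \<zero>\<^bsub>M\<^esub> \<oplus>\<^bsub>M\<^esub> a \<odot>\<^bsub>M\<^esub> \<zero>\<^bsub>M\<^esub>"
    using smult_r_distr[OF a M.zero_closed M.zero_closed] by simp
  thus ?thesis using smult_closed[OF a M.zero_closed] by (metis M.add.r_cancel_one')
qed

lemma smult_minus_one: "x \<in> carrier M \<Longrightarrow> (\<ominus>\<^bsub>R\<^esub> \<one>\<^bsub>R\<^esub>) \<odot>\<^bsub>M\<^esub> x = \<ominus>\<^bsub>M\<^esub> x"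
proof -
  assume x: "x \<in> carrier M"
  have m: "\<ominus>\<^bsub>R\<^esub> \<one>\<^bsub>R\<^esub> \<in> carrier R" by simp
  have "(\<ominus>\<^bsub>R\<^esub> \<one>\<^bsub>R\<^esub>) \<odot>\<^bsub>M\<^esub> x \<oplus>\<^bsub>M\<^esub> x = (\<ominus>\<^bsub>R\<^esub> \<one>\<^bsub>R\<^esub> \<oplus>\<^bsub>R\<^esub> \<one>\<^bsub>R\<^esub>) \<odot>\<^bsub>M\<^esub> x"
    using smult_l_distr[OF m R.one_closed x] smult_one[OF x] by simp
  also have "\<dots> = \<zero>\<^bsub>M\<^esub>" using smult_zero_left[OF x] by (simp add: R.l_neg)
  finally show ?thesis
    using M.minus_equality[OF _ x smult_closed[OF m x]] by simp
qed

lemma submoduleI: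
  assumes "H \<subseteq> carrier M" "\<zero>\<^bsub>M\<^esub> \<in> H"
    and "\<And>x y. x \<in> H \<Longrightarrow> y \<in> H \<Longrightarrow> x \<oplus>\<^bsub>M\<^esub> y \<in> H"
    and "\<And>a x. a \<in> carrier R \<Longrightarrow> x \<in> H \<Longrightarrow> a \<odot>\<^bsub>M\<^esub> x \<in> H"
  shows "submodule H R M"
proof -
  have "\<ominus>\<^bsub>M\<^esub> x \<in> H" if "x \<in> H" for x
    using assms(4)[of "\<ominus>\<^bsub>R\<^esub> \<one>\<^bsub>R\<^esub>" x] smult_minus_one[of x] that assms(1) by auto
  thus ?thesis
    using assms by (intro submodule.intro subgroup.intro)
      (auto simp: submodule_axioms_def a_inv_def)
qed

lemma submoduleD:
  assumes "submodule H R M"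
  shows "H \<subseteq> carrier M" "\<zero>\<^bsub>M\<^esub> \<in> H"
    and "\<And>x y. x \<in> H \<Longrightarrow> y \<in> H \<Longrightarrow> x \<oplus>\<^bsub>M\<^esub> y \<in> H"
    and "\<And>a x. a \<in> carrier R \<Longrightarrow> x \<in> H \<Longrightarrow> a \<odot>\<^bsub>M\<^esub> x \<in> H"
proof -
  interpret submodule H R M by fact
  show "H \<subseteq> carrier M" "\<zero>\<^bsub>M\<^esub> \<in> H" using subset one_closed by simp_all
  show "x \<oplus>\<^bsub>M\<^esub> y \<in> H" if "x \<in> H" "y \<in> H" for x y using m_closed[OF that] by simp
  show "a \<odot>\<^bsub>M\<^esub> x \<in> H" if "a \<in> carrier R" "x \<in> H" for a x using smult_closed[OF that] .
qed

lemma left_module_submodule: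
  assumes "submodule H R M"
  shows "left_module R (M\<lparr>carrier := H\<rparr>)"
proof -
  note H = submoduleD[OF assms]
  have c: "x \<in> carrier M" if "x \<in> H" for x using that H(1) by auto
  show ?thesis
  proof (intro left_module.intro left_module_axioms.intro)
    show "ring R" by (rule R.ring_axioms)
    show "abelian_group (M\<lparr>carrier := H\<rparr>)"
    proof (rule abelian_groupI)
      fix x assume "x \<in> carrier (M\<lparr>carrier := H\<rparr>)"
      hence x: "x \<in> H" by simp
      have "(\<ominus>\<^bsub>R\<^esub> \<one>\<^bsub>R\<^esub>) \<odot>\<^bsub>M\<^esub> x \<in> H" using H(4)[OF _ x] by simp
      hence "\<ominus>\<^bsub>M\<^esub> x \<in> H" using smult_minus_one[OF c[OF x]] by simp
      thus "\<exists>y\<in>carrier (M\<lparr>carrier := H\<rparr>). y \<oplus>\<^bsub>M\<lparr>carrier := H\<rparr>\<^esub> x = \<zero>\<^bsub>M\<lparr>carrier := H\<rparr>\<^esub>"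
        using c[OF x] by (auto intro!: bexI[of _ "\<ominus>\<^bsub>M\<^esub> x"] simp: M.l_neg)
    qed (use H(2,3) c in \<open>auto simp: M.a_ac\<close>)
  qed (use H(4) c smult_l_distr smult_r_distr smult_assoc smult_one in auto)
qed

end

section \<open>Rational modules\<close>

context coalgebra
begin

lemma dual_algebra_simps [simp]:
  "carrier dual_algebra = {f. lin f}"
  "f \<otimes>\<^bsub>dual_algebra\<^esub> g = conv f g"
  "\<one>\<^bsub>dual_algebra\<^esub> = counit"
  "\<zero>\<^bsub>dual_algebra\<^esub> = (\<lambda>c. 0)"
  "f \<oplus>\<^bsub>dual_algebra\<^esub> g = (\<lambda>c. f c + g c)"
  by (auto simp: dual_algebra_def conv_def fun_eq_iff)

lemma ring_dual_algebra: "ring dual_algebra"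
proof (rule ringI)
  show "abelian_group dual_algebra"
  proof (rule abelian_groupI)
    fix f assume "f \<in> carrier dual_algebra"
    hence f: "lin f" by simp
    show "\<exists>y\<in>carrier dual_algebra. y \<oplus>\<^bsub>dual_algebra\<^esub> f = \<zero>\<^bsub>dual_algebra\<^esub>"
      by (rule bexI[of _ "\<lambda>c. (- 1) * f c"]) (simp_all only: dual_algebra_simps mem_Collect_eq lin_scale[OF f], simp)
  qed (auto simp: lin_add lin_zero fun_eq_iff add.assoc add.commute)
  show "monoid dual_algebra"
    by (rule monoidI) (simp_all add: lin_conv lin_counit conv_assoc conv_counit_left conv_counit_right)
qed (simp_all add: conv_add_left conv_add_right)

text \<open>In topological terms the annihilator of \<open>m\<close> is open for the finite topology on the dual algebra.  If
\<open>f \<cdot> m = f(c\<^sub>1) m\<^sub>1 + \<dots> + f(c\<^sub>n) m\<^sub>n\<close> for all \<open>f\<close>, then \<open>S\<close> can be taken as the set of the \<open>c\<^sub>i\<close>; conversely a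
finite dual basis for \<open>S\<close> produces such a formula.  The present form is visibly stable under sums and
under the action.\<close>

definition rational_element :: "('c \<Rightarrow> 'k, 'm) module \<Rightarrow> 'm \<Rightarrow> bool" where
  "rational_element M m \<longleftrightarrow> m \<in> carrier M \<and>
    (\<exists>S. finite S \<and> (\<forall>f. lin f \<longrightarrow> (\<forall>s\<in>S. f s = 0) \<longrightarrow> f \<odot>\<^bsub>M\<^esub> m = \<zero>\<^bsub>M\<^esub>))"

lemma underlying_space_simps [simp]:
  "carrier (underlying_space M) = carrier M"
  "\<zero>\<^bsub>underlying_space M\<^esub> = \<zero>\<^bsub>M\<^esub>"
  "x \<oplus>\<^bsub>underlying_space M\<^esub> y = x \<oplus>\<^bsub>M\<^esub> y"
  "k \<odot>\<^bsub>underlying_space M\<^esub> x = (\<lambda>c. k * counit c) \<odot>\<^bsub>M\<^esub> x"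
  by (simp_all add: underlying_space_def)

lemma conv_scaled_counit:
  assumes "lin f"
  shows "conv (\<lambda>c. k * counit c) f = (\<lambda>c. k * f c)" "conv f (\<lambda>c. k * counit c) = (\<lambda>c. k * f c)"
  using assms by (simp_all add: conv_scale lin_counit conv_counit_left conv_counit_right)

lemma vspace_underlying_space:
  fixes M :: "('c \<Rightarrow> 'k, 'm) module" (structure)
  assumes "left_module dual_algebra M"
  shows "vspace (underlying_space M)"
proof -
  let ?V = "underlying_space M"
  interpret M: left_module dual_algebra M by fact
  note le = lin_scale[OF lin_counit]
  show ?thesis
  proof (rule vspaceI)
    show "abelian_group (?V)"
    proof (rule abelian_groupI)
      fix x assume "x \<in> carrier (?V)"
      thus "\<exists>y\<in>carrier (?V). y \<oplus>\<^bsub>?V\<^esub> x = \<zero>\<^bsub>?V\<^esub>"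
        by (auto intro!: bexI[of _ "\<ominus> x"] simp: M.M.l_neg)
    qed (auto simp: M.M.a_ac)
  next
    fix k l x assume "x \<in> carrier (?V)"
    hence x: "x \<in> carrier M" by simp
    show "k \<odot>\<^bsub>?V\<^esub> x \<in> carrier (?V)"
      using M.smult_closed[of "\<lambda>c. k * counit c" x] x le by simp
    show "(k + l) \<odot>\<^bsub>?V\<^esub> x
        = k \<odot>\<^bsub>?V\<^esub> x \<oplus>\<^bsub>?V\<^esub> l \<odot>\<^bsub>?V\<^esub> x"
      using M.smult_l_distr[of "\<lambda>c. k * counit c" "\<lambda>c. l * counit c" x] x le
      by (simp add: distrib_right)
    show "(k * l) \<odot>\<^bsub>?V\<^esub> x = k \<odot>\<^bsub>?V\<^esub> (l \<odot>\<^bsub>?V\<^esub> x)"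
      using M.smult_assoc[of "\<lambda>c. k * counit c" "\<lambda>c. l * counit c" x] x le
      by (simp add: conv_scaled_counit mult.assoc)
    show "1 \<odot>\<^bsub>?V\<^esub> x = x"
      using M.smult_one[OF x] by simp
  next
    fix k x y assume "x \<in> carrier (?V)" "y \<in> carrier (?V)"
    thus "k \<odot>\<^bsub>?V\<^esub> (x \<oplus>\<^bsub>?V\<^esub> y)
        = k \<odot>\<^bsub>?V\<^esub> x \<oplus>\<^bsub>?V\<^esub> k \<odot>\<^bsub>?V\<^esub> y"
      using M.smult_r_distr[of "\<lambda>c. k * counit c" x y] le by simp
  qed
qed

lemma rational_imp_rational_element:
  fixes M :: "('c \<Rightarrow> 'k, 'm) module" (structure)
  assumes "rational M" "m \<in> carrier M"
  shows "rational_element M m"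
proof -
  let ?V = "underlying_space M"
  interpret M: left_module dual_algebra M using assms(1) by (simp add: rational_def)
  interpret V: vspace ?V by (rule vspace_underlying_space) (rule M.left_module_axioms)
  interpret VC: tensor_pair ?V C_space by (rule tensor_pairI[OF V.vspace_axioms vspace_C])
  obtain \<rho> where \<rho>: "right_comodule ?V \<rho>" and act: "\<forall>f\<in>carrier dual_algebra. \<forall>m\<in>carrier M.
        f \<odot> m = VC.slice f (\<rho> m)"
    using assms(1) unfolding rational_def by blast
  have "\<rho> \<in> homs ?V VC.TS" using \<rho> unfolding right_comodule_def by blast
  hence "\<rho> m \<in> carrier VC.TS" using module_homsD(1)[of \<rho> field_ring ?V VC.TS m] assms(2) by simp
  then obtain x where x: "x \<in> VC.FT" "\<rho> m = VC.cls x" unfolding VC.TS_carrier by (elim imageE)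
  have "f \<odot> m = \<zero>" if f: "lin f" and S: "\<forall>s\<in>snd ` keys x. f s = 0" for f
  proof -
    have "f \<odot> m = formal_eval ?V (\<lambda>(v, c). f c \<odot>\<^bsub>?V\<^esub> v) x"
      using act f assms(2) x VC.tensor_lift_cls[OF V.vspace_axioms VC.bilinear_slice[OF lin_hom[OF f]] x(1)]
      by simp
    also have "\<dots> = finsum ?V (\<lambda>p. \<zero>\<^bsub>?V\<^esub>) (keys x)"
      unfolding formal_eval_def
    proof (rule V.M.finsum_cong')
      fix p assume p: "p \<in> keys x"
      have "f (snd p) = 0" using S p by simp
      thus "lookup x p \<odot>\<^bsub>?V\<^esub> (case p of (v, c) \<Rightarrow> f c \<odot>\<^bsub>?V\<^esub> v) = \<zero>\<^bsub>?V\<^esub>"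
        using VC.keys_FT[OF x(1) p] V.scl_zero_left[of "fst p"] V.scl_zero_right
        by (simp add: case_prod_beta')
    qed auto
    also have "\<dots> = \<zero>\<^bsub>?V\<^esub>" by (rule V.M.add.finprod_one_eqI) simp
    finally show ?thesis by simp
  qed
  thus ?thesis using assms(2) unfolding rational_element_def
    by (intro conjI exI[of _ "snd ` keys x"]) auto
qed

lemma finite_dual_basis:
  assumes "finite S"
  obtains B d where "finite B" "\<And>b. b \<in> B \<Longrightarrow> lin (d b)"
    "\<And>f s. lin f \<Longrightarrow> s \<in> S \<Longrightarrow> f s = (\<Sum>b\<in>B. f b * d b s)"
proof -
  obtain B where B: "B \<subseteq> S" "independent B" "S \<subseteq> span B" by (rule basis_exists[of S])
  have fB: "finite B" using B(1) assms by (rule finite_subset)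
  have "\<exists>g. lin g \<and> (\<forall>x\<in>B. g x = (if x = b then 1 else 0))" for b
    by (rule vector_space_pair.linear_independent_extend[OF functionals B(2)])
  then obtain d where d: "\<And>b. lin (d b)" "\<And>b x. x \<in> B \<Longrightarrow> d b x = (if x = b then 1 else 0)"
    by metis
  have "f s = (\<Sum>b\<in>B. f b * d b s)" if f: "lin f" and s: "s \<in> S" for f s
  proof -
    have sum_lin: "lin (\<lambda>s. \<Sum>b\<in>A. f b * d b s)" if "finite A" for A
      using that
      by (induction A) (simp_all add: lin_zero lin_add lin_scale d(1))
    have "f s - (\<Sum>b\<in>B. f b * d b s) = 0"
    proof (rule vector_space_pair.linear_eq_0_on_span[OF functionals lin_diff[OF f sum_lin[OF fB]]])
      fix x assume x: "x \<in> B"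
      have "(\<Sum>b\<in>B. f b * d b x) = (\<Sum>b\<in>B. if x = b then f b else 0)"
        by (rule sum.cong) (simp_all add: d(2)[OF x])
      also have "\<dots> = f x" using fB x by simp
      finally show "f x - (\<Sum>b\<in>B. f b * d b x) = 0" by simp
    next
      show "s \<in> span B" using s B(3) by auto
    qed
    thus ?thesis by simp
  qed
  thus ?thesis using that[of B d] fB d(1) by simp
qed

text \<open>For \<open>m\<close> with finite set \<open>S\<close> and dual basis \<open>d\<close> of \<open>S\<close>, the coaction is \<open>\<rho> m = \<Sum> (d b \<cdot> m) \<otimes> b\<close>.  Its slice at
\<open>f\<close> is \<open>f \<cdot> m\<close>, and slices determine tensors; hence linearity, coassociativity and counit law of \<open>\<rho>\<close> all
follow from the module axioms.\<close>

lemma rational_if_rational_elements: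
  fixes M :: "('c \<Rightarrow> 'k, 'm) module" (structure)
  assumes M: "left_module dual_algebra M" and el: "\<And>m. m \<in> carrier M \<Longrightarrow> rational_element M m"
  shows "rational M"
proof -
  let ?V = "underlying_space M"
  interpret M: left_module dual_algebra M by (rule M)
  interpret V: vspace ?V by (rule vspace_underlying_space) (rule M)
  interpret VC: tensor_pair ?V C_space by (rule tensor_pairI[OF V.vspace_axioms vspace_C])
  interpret CC: tensor_pair C_space C_space by (rule tensor_pairI) (rule vspace_C)+
  interpret VCC: tensor_pair ?V CC.TS by (rule tensor_pairI[OF V.vspace_axioms CC.vspace_TS])
  have sm: "f \<odot> m \<in> carrier M" if "lin f" "m \<in> carrier M" for f m
    using M.smult_closed that by simp
  have scl_smult: "k \<odot>\<^bsub>?V\<^esub> (f \<odot> m) = (\<lambda>c. k * f c) \<odot> m"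
    if "lin f" "m \<in> carrier M" for k f m
    using M.smult_assoc[of "\<lambda>c. k * counit c" f m] that lin_scale[OF lin_counit]
    by (simp add: conv_scaled_counit)
  have "\<exists>X. X \<in> carrier VC.TS \<and> (\<forall>f. lin f \<longrightarrow> VC.slice f X = f \<odot> m)" if m: "m \<in> carrier M" for m
  proof -
    obtain S where S: "finite S" "\<And>f. lin f \<Longrightarrow> \<forall>s\<in>S. f s = 0 \<Longrightarrow> f \<odot> m = \<zero>"
      using el[OF m] unfolding rational_element_def by blast
    obtain B :: "'c set" and d where B: "finite B" and d: "\<And>b. b \<in> B \<Longrightarrow> lin (d b)"
      and exp: "\<And>f s. lin f \<Longrightarrow> s \<in> S \<Longrightarrow> f s = (\<Sum>b\<in>B. f b * d b s)"
      using finite_dual_basis[OF S(1)] by metis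
    let ?X = "finsum VC.TS (\<lambda>b. VC.pure (d b \<odot> m) b) B"
    have pc: "(\<lambda>b. VC.pure (d b \<odot> m) b) \<in> B \<rightarrow> carrier VC.TS"
      using sm[OF d m] by simp
    have "VC.slice f ?X = f \<odot> m" if f: "lin f" for f
    proof -
      have sum_act: "lin (\<lambda>c. \<Sum>b\<in>A. f b * d b c) \<and> (\<lambda>c. \<Sum>b\<in>A. f b * d b c) \<odot> m
          = finsum ?V (\<lambda>b. f b \<odot>\<^bsub>?V\<^esub> (d b \<odot> m)) A" if "finite A" "A \<subseteq> B" for A
        using that
      proof (induction A)
        case empty
        show ?case using M.smult_zero_left[OF m] lin_zero by simp
      next
        case (insert a A)
        have da: "lin (d a)" using d insert.prems by simp
        have l: "lin (\<lambda>c. f a * d a c)" by (rule lin_scale[OF da])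
        have IH: "lin (\<lambda>c. \<Sum>b\<in>A. f b * d b c)" "(\<lambda>c. \<Sum>b\<in>A. f b * d b c) \<odot> m
            = finsum ?V (\<lambda>b. f b \<odot>\<^bsub>?V\<^esub> (d b \<odot> m)) A"
          using insert by auto
        have "(\<lambda>c. f a * d a c + (\<Sum>b\<in>A. f b * d b c)) \<odot> m
            = (\<lambda>c. f a * d a c) \<odot> m \<oplus> (\<lambda>c. \<Sum>b\<in>A. f b * d b c) \<odot> m"
          using M.smult_l_distr[of "\<lambda>c. f a * d a c" "\<lambda>c. \<Sum>b\<in>A. f b * d b c" m] l IH(1) m by simp
        also have "\<dots> = f a \<odot>\<^bsub>?V\<^esub> (d a \<odot> m) \<oplus>\<^bsub>?V\<^esub> finsum ?V (\<lambda>b. f b \<odot>\<^bsub>?V\<^esub> (d b \<odot> m)) A"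
          unfolding IH(2) scl_smult[OF da m] by simp
        also have "\<dots> = finsum ?V (\<lambda>b. f b \<odot>\<^bsub>?V\<^esub> (d b \<odot> m)) (insert a A)"
        proof (rule V.M.finsum_insert[symmetric])
          show "(\<lambda>b. f b \<odot>\<^bsub>?V\<^esub> (d b \<odot> m)) \<in> A \<rightarrow> carrier ?V"
            using insert.prems d m sm by (intro funcsetI V.scl_closed) auto
          show "f a \<odot>\<^bsub>?V\<^esub> (d a \<odot> m) \<in> carrier ?V"
            using sm[OF da m] by (intro V.scl_closed) simp
        qed (use insert.hyps in auto)
        finally show ?case using insert.hyps lin_add[OF l IH(1)] by simp
      qed
      have s: "lin (\<lambda>c. \<Sum>b\<in>B. f b * d b c)" "(\<lambda>c. \<Sum>b\<in>B. f b * d b c) \<odot> m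
          = finsum ?V (\<lambda>b. f b \<odot>\<^bsub>?V\<^esub> (d b \<odot> m)) B"
        using sum_act[OF B subset_refl] by auto
      note ld = lin_diff[OF f s(1)]
      have z: "(\<lambda>c. f c - (\<Sum>b\<in>B. f b * d b c)) \<odot> m = \<zero>"
        by (rule S(2)[OF ld]) (use exp[OF f] in simp)
      have "VC.slice f ?X = finsum ?V (\<lambda>b. VC.slice f (VC.pure (d b \<odot> m) b)) B"
        by (rule vspace_hom_finsum[OF VC.vspace_TS V.vspace_axioms VC.slice_hom[OF lin_hom[OF f]] B pc])
      also have "\<dots> = finsum ?V (\<lambda>b. f b \<odot>\<^bsub>?V\<^esub> (d b \<odot> m)) B"
      proof (rule V.M.finsum_cong')
        show "(\<lambda>b. f b \<odot>\<^bsub>?V\<^esub> (d b \<odot> m)) \<in> B \<rightarrow> carrier ?V"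
          using d m sm by (intro funcsetI V.scl_closed) auto
        fix b assume b: "b \<in> B"
        show "VC.slice f (VC.pure (d b \<odot> m) b) = f b \<odot>\<^bsub>?V\<^esub> (d b \<odot> m)"
          by (rule VC.slice_pure[OF lin_hom[OF f]]) (use sm[OF d[OF b] m] in simp_all)
      qed simp
      also have "\<dots> = (\<lambda>c. \<Sum>b\<in>B. f b * d b c) \<odot> m" by (rule s(2)[symmetric])
      also have "\<dots> = (\<lambda>c. f c - (\<Sum>b\<in>B. f b * d b c)) \<odot> m \<oplus> (\<lambda>c. \<Sum>b\<in>B. f b * d b c) \<odot> m"
        using sm[OF s(1) m] by (simp only: z M.M.l_zero)
      also have "\<dots> = f \<odot> m"
        using M.smult_l_distr[of "\<lambda>c. f c - (\<Sum>b\<in>B. f b * d b c)" "\<lambda>c. \<Sum>b\<in>B. f b * d b c" m] ld s(1) m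
        by simp
      finally show ?thesis .
    qed
    thus ?thesis using VC.T.M.finsum_closed[OF pc] by blast
  qed
  then obtain \<rho> where \<rho>c: "\<And>m. m \<in> carrier M \<Longrightarrow> \<rho> m \<in> carrier VC.TS"
    and \<rho>: "\<And>m f. m \<in> carrier M \<Longrightarrow> lin f \<Longrightarrow> VC.slice f (\<rho> m) = f \<odot> m"
    by metis
  have lin_homs: "{f. lin f} \<subseteq> homs C_space K_space"
    using lin_hom by auto
  have C_sep: "w = \<zero>\<^bsub>C_space\<^esub>" if "\<forall>\<phi>\<in>{f. lin f}. \<phi> w = 0" for w
    by (rule eq_if_functionals_eq) (use that in \<open>simp add: linD(4)\<close>)
  have sl_hom: "VC.slice f \<in> homs VC.TS ?V" if "lin f" for f
    by (rule VC.slice_hom[OF lin_hom[OF that]])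
  have \<rho>_hom: "\<rho> \<in> homs ?V VC.TS"
  proof (rule vspace_homI)
    fix x assume "x \<in> carrier ?V"
    hence x: "x \<in> carrier M" by simp
    show "\<rho> x \<in> carrier VC.TS" by (rule \<rho>c[OF x])
    fix k
    have kx: "k \<odot>\<^bsub>?V\<^esub> x \<in> carrier M" using V.scl_closed[of x k] x by simp
    show "\<rho> (k \<odot>\<^bsub>?V\<^esub> x) = k \<odot>\<^bsub>VC.TS\<^esub> \<rho> x"
    proof (rule VC.tensor_eq_if_slices_eq[OF lin_homs C_sep])
      fix f assume "f \<in> {f. lin f}"
      hence f: "lin f" by simp
      have "VC.slice f (k \<odot>\<^bsub>VC.TS\<^esub> \<rho> x) = k \<odot>\<^bsub>?V\<^esub> VC.slice f (\<rho> x)"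
        by (rule vspace_hom_scl[OF sl_hom[OF f] \<rho>c[OF x]])
      also have "\<dots> = (\<lambda>c. k * f c) \<odot> x" unfolding \<rho>[OF x f] by (rule scl_smult[OF f x])
      also have "\<dots> = f \<odot> (k \<odot>\<^bsub>?V\<^esub> x)"
        using M.smult_assoc[of f "\<lambda>c. k * counit c" x] f x lin_scale[OF lin_counit]
        by (simp add: conv_scaled_counit)
      finally show "VC.slice f (\<rho> (k \<odot>\<^bsub>?V\<^esub> x)) = VC.slice f (k \<odot>\<^bsub>VC.TS\<^esub> \<rho> x)"
        by (simp only: \<rho>[OF kx f])
    qed (use \<rho>c[OF x] \<rho>c[OF kx] VC.T.scl_closed in auto)
  next
    fix x y assume "x \<in> carrier ?V" "y \<in> carrier ?V"
    hence x: "x \<in> carrier M" and y: "y \<in> carrier M" by simp_all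
    have xy: "x \<oplus> y \<in> carrier M" using x y by simp
    have "\<rho> (x \<oplus> y) = \<rho> x \<oplus>\<^bsub>VC.TS\<^esub> \<rho> y"
    proof (rule VC.tensor_eq_if_slices_eq[OF lin_homs C_sep])
      fix f assume "f \<in> {f. lin f}"
      hence f: "lin f" by simp
      show "VC.slice f (\<rho> (x \<oplus> y)) = VC.slice f (\<rho> x \<oplus>\<^bsub>VC.TS\<^esub> \<rho> y)"
        unfolding module_homsD(2)[OF sl_hom[OF f] \<rho>c[OF x] \<rho>c[OF y]] \<rho>[OF xy f] \<rho>[OF x f] \<rho>[OF y f]
        using M.smult_r_distr[of f x y] f x y by simp
    qed (use \<rho>c[OF x] \<rho>c[OF y] \<rho>c[OF xy] VC.T.M.a_closed in auto)
    thus "\<rho> (x \<oplus>\<^bsub>?V\<^esub> y) = \<rho> x \<oplus>\<^bsub>VC.TS\<^esub> \<rho> y" by simp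
  qed
  let ?pair = "\<lambda>g h. tensor_lift K_space (\<lambda>a b. g a * h b)"
  let ?\<Phi> = "{?pair g h | g h. lin g \<and> lin h}"
  have pairs: "?\<Phi> \<subseteq> homs CC.TS K_space" using pairing_hom by auto
  have CC_sep: "t = \<zero>\<^bsub>CC.TS\<^esub>" if t: "t \<in> carrier CC.TS" and z: "\<forall>\<phi>\<in>?\<Phi>. \<phi> t = 0" for t
  proof (rule CC.tensor_zero_if_slices_zero[OF lin_homs C_sep t])
    fix h assume "h \<in> {f. lin f}"
    hence h: "lin h" by simp
    have sh: "CC.slice h \<in> homs CC.TS C_space" by (rule CC.slice_hom[OF lin_hom[OF h]])
    show "CC.slice h t = \<zero>\<^bsub>C_space\<^esub>"
    proof (rule C_sep, rule ballI)
      fix g assume "g \<in> {f. lin f}"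
      hence g: "lin g" by simp
      have "g (CC.slice h t) = ?pair g h t"
      proof (rule CC.hom_eqI[OF vspace_K vspace_hom_comp[OF sh lin_hom[OF g]] pairing_hom[OF g h] _ t])
        fix v w assume vw: "v \<in> carrier C_space" "w \<in> carrier C_space"
        show "g (CC.slice h (CC.pure v w)) = ?pair g h (CC.pure v w)"
          unfolding CC.slice_pure[OF lin_hom[OF h] vw]
            CC.tensor_lift_pure[OF vspace_K bilinear_pairing[OF g h] vw]
          by (simp add: linD[OF g] mult.commute)
      qed
      thus "g (CC.slice h t) = 0" using z g h by auto
    qed
  qed auto
  have id_hom: "id \<in> homs W W" for W :: "('k, 'x) module"
    by (rule vspace_homI) auto
  have "right_comodule ?V \<rho>"
    unfolding right_comodule_def
  proof (intro conjI ballI)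
    show "Module.module field_ring ?V" using V.vspace_axioms by (simp add: vspace_def)
    show "\<rho> \<in> homs ?V VC.TS" by (rule \<rho>_hom)
  next
    fix m assume mV: "m \<in> carrier ?V"
    hence m: "m \<in> carrier M" by simp
    let ?L = "tensor_assoc ?V C_space C_space (tensor_map VC.TS C_space \<rho> id (\<rho> m))"
    let ?R = "tensor_map ?V CC.TS id comult (\<rho> m)"
    show "?L = ?R"
    proof (rule VCC.tensor_eq_if_slices_eq[OF pairs CC_sep])
      note map1 = tensor_map_hom[OF V.vspace_axioms vspace_C VC.vspace_TS vspace_C \<rho>_hom id_hom]
      note map2 = tensor_map_hom[OF V.vspace_axioms vspace_C V.vspace_axioms CC.vspace_TS id_hom comult_linear]
      show "?L \<in> carrier VCC.TS"
        by (rule module_homsD(1)[OF tensor_assoc_hom[OF V.vspace_axioms vspace_C vspace_C]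
              module_homsD(1)[OF map1 \<rho>c[OF m]]])
      show "?R \<in> carrier VCC.TS" by (rule module_homsD(1)[OF map2 \<rho>c[OF m]])
    next
      fix \<phi> assume "\<phi> \<in> ?\<Phi>"
      then obtain g h where g: "lin g" and h: "lin h" and \<phi>: "\<phi> = ?pair g h" by auto
      note s = coassoc_slices[OF V.vspace_axioms \<rho>_hom g h mV]
      have hm: "h \<odot> m \<in> carrier M" by (rule sm[OF h m])
      have "VCC.slice \<phi> ?L = g \<odot> (h \<odot> m)"
        unfolding \<phi> s(1) \<rho>[OF m h] \<rho>[OF hm g] ..
      also have "\<dots> = conv g h \<odot> m" using M.smult_assoc[of g h m] g h m by simp
      also have "\<dots> = VCC.slice \<phi> ?R" unfolding \<phi> s(2) \<rho>[OF m lin_conv[OF g h]] ..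
      finally show "VCC.slice \<phi> ?L = VCC.slice \<phi> ?R" .
    qed
    show "VC.slice counit (\<rho> m) = m"
      unfolding \<rho>[OF m lin_counit] using M.smult_one[OF m] by simp
  qed
  moreover have "\<forall>f\<in>carrier dual_algebra. \<forall>m\<in>carrier M. f \<odot> m = VC.slice f (\<rho> m)"
    using \<rho> by simp
  ultimately show ?thesis unfolding rational_def using M by blast
qed

lemma Rat_eq:
  fixes M :: "('c \<Rightarrow> 'k, 'm) module" (structure)
  assumes "left_module dual_algebra M"
  shows "Rat M = {m. rational_element M m}"
proof -
  interpret M: left_module dual_algebra M by fact
  let ?R = "{m. rational_element M m}"
  have sub: "submodule ?R dual_algebra M"
  proof (rule M.submoduleI)
    show "\<zero> \<in> ?R"
      using M.smult_zero_right by (auto simp: rational_element_def intro!: exI[of _ "{}"])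
  next
    fix x y assume "x \<in> ?R" "y \<in> ?R"
    then obtain S T where S: "finite S" "\<And>f. lin f \<Longrightarrow> \<forall>s\<in>S. f s = 0 \<Longrightarrow> f \<odot> x = \<zero>"
      and T: "finite T" "\<And>f. lin f \<Longrightarrow> \<forall>s\<in>T. f s = 0 \<Longrightarrow> f \<odot> y = \<zero>"
      and xy: "x \<in> carrier M" "y \<in> carrier M"
      by (auto simp: rational_element_def)
    have "f \<odot> (x \<oplus> y) = \<zero>" if "lin f" "\<forall>s\<in>S \<union> T. f s = 0" for f
      using M.smult_r_distr[of f x y] S(2)[of f] T(2)[of f] that xy by simp
    thus "x \<oplus> y \<in> ?R" using xy S(1) T(1)
      by (auto simp: rational_element_def intro!: exI[of _ "S \<union> T"])
  next
    fix g x assume "g \<in> carrier dual_algebra" "x \<in> ?R"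
    then obtain S where S: "finite S" "\<And>f. lin f \<Longrightarrow> \<forall>s\<in>S. f s = 0 \<Longrightarrow> f \<odot> x = \<zero>"
      and x: "x \<in> carrier M" and g: "lin g"
      by (auto simp: rational_element_def)
    have "f \<odot> (g \<odot> x) = \<zero>" if f: "lin f" "\<forall>s\<in>lact g ` S. f s = 0" for f
    proof -
      have "f \<odot> (g \<odot> x) = conv f g \<odot> x"
        using M.smult_assoc[of f g x] f g x by simp
      also have "\<dots> = \<zero>"
        by (rule S(2)[OF lin_conv[OF f(1) g]]) (use f(2) in \<open>simp add: functional_lact[OF f(1) g]\<close>)
      finally show ?thesis .
    qed
    thus "g \<odot> x \<in> ?R" using S(1) x g M.smult_closed[of g x]
      by (auto simp: rational_element_def intro!: exI[of _ "lact g ` S"])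
  qed (auto simp: rational_element_def)
  have restrict: "rational_element (M\<lparr>carrier := N\<rparr>) x \<Longrightarrow> N \<subseteq> carrier M \<Longrightarrow> rational_element M x" for N x
    by (auto simp: rational_element_def)
  have "rational (M\<lparr>carrier := ?R\<rparr>)"
    by (rule rational_if_rational_elements[OF M.left_module_submodule[OF sub]])
      (auto simp: rational_element_def)
  hence "?R \<subseteq> \<Union>{N. submodule N dual_algebra M \<and> rational (M\<lparr>carrier := N\<rparr>)}"
    using sub by (intro Union_upper) simp
  moreover have "\<Union>{N. submodule N dual_algebra M \<and> rational (M\<lparr>carrier := N\<rparr>)} \<subseteq> ?R"
  proof (rule Union_least)
    fix N assume N: "N \<in> {N. submodule N dual_algebra M \<and> rational (M\<lparr>carrier := N\<rparr>)}"
    show "N \<subseteq> ?R"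
    proof
      fix x assume "x \<in> N"
      hence "rational_element (M\<lparr>carrier := N\<rparr>) x"
        using N by (intro rational_imp_rational_element) auto
      moreover have "N \<subseteq> carrier M" using N M.submoduleD(1) by auto
      ultimately show "x \<in> ?R" using restrict by simp
    qed
  qed
  ultimately have U: "\<Union>{N. submodule N dual_algebra M \<and> rational (M\<lparr>carrier := N\<rparr>)} = ?R"
    by (rule antisym[rotated])
  show ?thesis
    unfolding Rat_def generated_submodule_def U using sub by (intro equalityI Inter_lower Inter_greatest) auto
qed

section \<open>Splitting of cyclic modules\<close>

definition left_ideal :: "('c \<Rightarrow> 'k) set \<Rightarrow> bool" where
  "left_ideal L \<longleftrightarrow> L \<subseteq> {f. lin f} \<and> (\<lambda>c. 0) \<in> L \<and>
    (\<forall>f\<in>L. \<forall>g\<in>L. (\<lambda>c. f c + g c) \<in> L) \<and> (\<forall>f g. lin f \<longrightarrow> g \<in> L \<longrightarrow> conv f g \<in> L)"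

text \<open>The preimage of the rational part of \<open>C\<^sup>* / L\<close> in \<open>C\<^sup>*\<close>.\<close>

definition rational_closure :: "('c \<Rightarrow> 'k) set \<Rightarrow> ('c \<Rightarrow> 'k) set" where
  "rational_closure L = {f. lin f \<and>
    (\<exists>S. finite S \<and> (\<forall>g. lin g \<longrightarrow> (\<forall>s\<in>S. g s = 0) \<longrightarrow> conv g f \<in> L))}"

lemma left_idealD:
  assumes "left_ideal L"
  shows "f \<in> L \<Longrightarrow> lin f" and "(\<lambda>c. 0) \<in> L"
    and "f \<in> L \<Longrightarrow> g \<in> L \<Longrightarrow> (\<lambda>c. f c + g c) \<in> L"
    and "lin f \<Longrightarrow> g \<in> L \<Longrightarrow> conv f g \<in> L"
  using assms by (auto simp: left_ideal_def)

lemma left_ideal_scale: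
  assumes "left_ideal L" "f \<in> L" shows "(\<lambda>c. k * f c) \<in> L"
  using left_idealD(4)[OF assms(1) lin_scale[OF lin_counit] assms(2), of k]
  by (simp add: conv_scaled_counit left_idealD(1)[OF assms])

lemma left_ideal_diff:
  assumes "left_ideal L" "f \<in> L" "g \<in> L" shows "(\<lambda>c. f c - g c) \<in> L"
  using left_idealD(3)[OF assms(1,2) left_ideal_scale[OF assms(1,3), of "- 1"]] by simp

text \<open>Cosets are encoded as sets of sequences of functionals, the carrier type over which the splitting
hypothesis quantifies.  Only the entry with index \<open>0\<close> is constrained.\<close>

definition coset :: "('c \<Rightarrow> 'k) set \<Rightarrow> ('c \<Rightarrow> 'k) \<Rightarrow> (nat \<Rightarrow> 'c \<Rightarrow> 'k) set" where
  "coset L f = {\<phi>. (\<lambda>c. \<phi> 0 c - f c) \<in> L}"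

definition coset_rep :: "(nat \<Rightarrow> 'c \<Rightarrow> 'k) set \<Rightarrow> 'c \<Rightarrow> 'k" where
  "coset_rep X = (SOME \<phi>. \<phi> \<in> X) 0"

definition quotient_module ::
    "('c \<Rightarrow> 'k) set \<Rightarrow> ('c \<Rightarrow> 'k, (nat \<Rightarrow> 'c \<Rightarrow> 'k) set) module" where
  "quotient_module L = \<lparr>carrier = coset L ` {f. lin f}, monoid.mult = undefined, one = undefined,
    zero = coset L (\<lambda>c. 0), add = (\<lambda>X Y. coset L (\<lambda>c. coset_rep X c + coset_rep Y c)),
    smult = (\<lambda>f X. coset L (conv f (coset_rep X)))\<rparr>"

lemma coset_eq_iff:
  assumes "left_ideal L"
  shows "coset L f = coset L g \<longleftrightarrow> (\<lambda>c. f c - g c) \<in> L"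
proof
  assume "coset L f = coset L g"
  moreover have "(\<lambda>_. f) \<in> coset L f" using left_idealD(2)[OF assms] by (simp add: coset_def)
  ultimately have "(\<lambda>_. f) \<in> coset L g" by simp
  thus "(\<lambda>c. f c - g c) \<in> L" by (simp add: coset_def)
next
  assume d: "(\<lambda>c. f c - g c) \<in> L"
  have "(\<lambda>c. \<phi> c - f c) \<in> L \<longleftrightarrow> (\<lambda>c. \<phi> c - g c) \<in> L" for \<phi>
    using left_idealD(3)[OF assms _ d, of "\<lambda>c. \<phi> c - f c"]
      left_ideal_diff[OF assms _ d, of "\<lambda>c. \<phi> c - g c"] by auto
  thus "coset L f = coset L g" by (simp add: coset_def)
qed

lemma coset_rep:
  assumes "left_ideal L" "lin f"
  shows "(\<lambda>c. coset_rep (coset L f) c - f c) \<in> L" "lin (coset_rep (coset L f))"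
proof -
  have "(\<lambda>_. f) \<in> coset L f" using left_idealD(2)[OF assms(1)] by (simp add: coset_def)
  hence "coset L f \<noteq> {}" by blast
  hence "(SOME \<phi>. \<phi> \<in> coset L f) \<in> coset L f" by (rule some_in_eq[THEN iffD2])
  thus d: "(\<lambda>c. coset_rep (coset L f) c - f c) \<in> L" by (simp add: coset_def coset_rep_def)
  show "lin (coset_rep (coset L f))"
    using lin_add[OF left_idealD(1)[OF assms(1) d] assms(2)] by simp
qed

lemma conv_diff_right:
  assumes "lin f" "lin g" "lin h"
  shows "conv h (\<lambda>c. f c - g c) = (\<lambda>c. conv h f c - conv h g c)"
  using functional_ract[OF lin_diff[OF assms(1,2)] assms(3)]
  by (auto simp: functional_ract assms fun_eq_iff)

lemma quotient_module_simps:
  assumes L: "left_ideal L"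
  shows "carrier (quotient_module L) = coset L ` {f. lin f}"
    and "\<zero>\<^bsub>quotient_module L\<^esub> = coset L (\<lambda>c. 0)"
    and "lin f \<Longrightarrow> lin g \<Longrightarrow>
      coset L f \<oplus>\<^bsub>quotient_module L\<^esub> coset L g = coset L (\<lambda>c. f c + g c)"
    and "lin f \<Longrightarrow> lin g \<Longrightarrow> g \<odot>\<^bsub>quotient_module L\<^esub> coset L f = coset L (conv g f)"
proof -
  show "carrier (quotient_module L) = coset L ` {f. lin f}"
    and "\<zero>\<^bsub>quotient_module L\<^esub> = coset L (\<lambda>c. 0)"
    by (simp_all add: quotient_module_def)
  assume f: "lin f" and g: "lin g"
  note rf = coset_rep[OF L f] and rg = coset_rep[OF L g]
  have "(\<lambda>c. coset_rep (coset L f) c + coset_rep (coset L g) c - (f c + g c)) \<in> L"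
    using left_idealD(3)[OF L rf(1) rg(1)] by (simp add: algebra_simps)
  thus "coset L f \<oplus>\<^bsub>quotient_module L\<^esub> coset L g = coset L (\<lambda>c. f c + g c)"
    by (simp add: quotient_module_def coset_eq_iff[OF L])
  show "g \<odot>\<^bsub>quotient_module L\<^esub> coset L f = coset L (conv g f)"
    using left_idealD(4)[OF L g rf(1)]
    by (simp add: quotient_module_def coset_eq_iff[OF L] conv_diff_right[OF rf(2) f g])
qed

lemma left_module_quotient:
  assumes L: "left_ideal L"
  shows "left_module dual_algebra (quotient_module L)"
proof -
  let ?Q = "quotient_module L"
  note q = quotient_module_simps[OF L] lin_add lin_conv lin_zero lin_counit
  have rep: "\<exists>f. lin f \<and> X = coset L f" if "X \<in> carrier ?Q" for X
    using that q(1) by auto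
  have closed: "coset L f \<in> carrier ?Q" if "lin f" for f
    using that q(1) by auto
  show ?thesis
  proof (intro left_module.intro left_module_axioms.intro)
    show "ring dual_algebra" by (rule ring_dual_algebra)
    show "abelian_group ?Q"
    proof (rule abelian_groupI)
      fix X assume "X \<in> carrier ?Q"
      then obtain f where f: "lin f" "X = coset L f" using rep by blast
      show "\<exists>y\<in>carrier ?Q. y \<oplus>\<^bsub>?Q\<^esub> X = \<zero>\<^bsub>?Q\<^esub>"
        by (rule bexI[OF _ closed[OF lin_scale[OF f(1), of "- 1"]]])
          (simp only: f(2) q(3)[OF lin_scale[OF f(1)] f(1)] q(2), simp)
      show "\<zero>\<^bsub>?Q\<^esub> \<oplus>\<^bsub>?Q\<^esub> X = X" using f by (simp add: q)
    next
      fix X Y assume "X \<in> carrier ?Q" "Y \<in> carrier ?Q"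
      then obtain f g where f: "lin f" "X = coset L f" "lin g" "Y = coset L g" using rep by metis
      thus "X \<oplus>\<^bsub>?Q\<^esub> Y \<in> carrier ?Q" by (simp add: q(3) closed lin_add)
      show "X \<oplus>\<^bsub>?Q\<^esub> Y = Y \<oplus>\<^bsub>?Q\<^esub> X" using f by (simp add: q add.commute)
      fix Z assume "Z \<in> carrier ?Q"
      then obtain h where "lin h" "Z = coset L h" using rep by metis
      thus "X \<oplus>\<^bsub>?Q\<^esub> Y \<oplus>\<^bsub>?Q\<^esub> Z = X \<oplus>\<^bsub>?Q\<^esub> (Y \<oplus>\<^bsub>?Q\<^esub> Z)"
        using f by (simp add: q add.assoc)
    next
      show "\<zero>\<^bsub>?Q\<^esub> \<in> carrier ?Q" unfolding q(2) by (rule closed[OF lin_zero])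
    qed
  next
    fix a X assume "a \<in> carrier dual_algebra" "X \<in> carrier ?Q"
    then obtain f where "lin a" "lin f" "X = coset L f" using rep by auto
    thus "a \<odot>\<^bsub>?Q\<^esub> X \<in> carrier ?Q" by (simp add: q(4) closed lin_conv)
  next
    fix a b X assume "a \<in> carrier dual_algebra" "b \<in> carrier dual_algebra" "X \<in> carrier ?Q"
    then obtain f where f: "lin a" "lin b" "lin f" "X = coset L f" using rep by auto
    thus "(a \<oplus>\<^bsub>dual_algebra\<^esub> b) \<odot>\<^bsub>?Q\<^esub> X = a \<odot>\<^bsub>?Q\<^esub> X \<oplus>\<^bsub>?Q\<^esub> b \<odot>\<^bsub>?Q\<^esub> X"
      by (simp add: q conv_add_left)
    show "(a \<otimes>\<^bsub>dual_algebra\<^esub> b) \<odot>\<^bsub>?Q\<^esub> X = a \<odot>\<^bsub>?Q\<^esub> (b \<odot>\<^bsub>?Q\<^esub> X)"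
      using f by (simp add: q conv_assoc)
  next
    fix a X Y assume a: "a \<in> carrier dual_algebra" and "X \<in> carrier ?Q" "Y \<in> carrier ?Q"
    then obtain f g where "lin f" "X = coset L f" "lin g" "Y = coset L g" using rep by metis
    thus "a \<odot>\<^bsub>?Q\<^esub> (X \<oplus>\<^bsub>?Q\<^esub> Y) = a \<odot>\<^bsub>?Q\<^esub> X \<oplus>\<^bsub>?Q\<^esub> a \<odot>\<^bsub>?Q\<^esub> Y"
      using a by (simp add: q conv_add_right)
  next
    fix X assume "X \<in> carrier ?Q"
    then obtain f where "lin f" "X = coset L f" using rep by auto
    thus "\<one>\<^bsub>dual_algebra\<^esub> \<odot>\<^bsub>?Q\<^esub> X = X" by (simp add: q conv_counit_left)
  qed
qed

lemma finitely_generated_quotient: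
  assumes L: "left_ideal L"
  shows "finitely_generated dual_algebra (quotient_module L)"
proof -
  note q = quotient_module_simps[OF L]
  let ?Q = "quotient_module L"
  interpret Q: left_module dual_algebra ?Q by (rule left_module_quotient[OF L])
  have "generated_submodule dual_algebra ?Q {coset L counit} = carrier ?Q"
    unfolding generated_submodule_def
  proof (intro equalityI Inter_lower Inter_greatest)
    have "submodule (carrier ?Q) dual_algebra ?Q"
      by (rule Q.submoduleI) (auto intro: Q.smult_closed simp del: dual_algebra_simps)
    thus "carrier ?Q \<in> {N. submodule N dual_algebra ?Q \<and> {coset L counit} \<subseteq> N}"
      using lin_counit q(1) by auto
  next
    fix N assume "N \<in> {N. submodule N dual_algebra ?Q \<and> {coset L counit} \<subseteq> N}"
    hence N: "submodule N dual_algebra ?Q" "coset L counit \<in> N" by auto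
    show "carrier ?Q \<subseteq> N"
    proof
      fix X assume "X \<in> carrier ?Q"
      then obtain f where f: "lin f" "X = coset L f" using q(1) by auto
      have "f \<odot>\<^bsub>?Q\<^esub> coset L counit \<in> N" by (rule Q.submoduleD(4)[OF N(1) _ N(2)]) (simp add: f(1))
      thus "X \<in> N" by (simp add: f q(4) lin_counit conv_counit_right)
    qed
  qed
  thus ?thesis unfolding finitely_generated_def
    using lin_counit q(1) by (intro exI[of _ "{coset L counit}"]) auto
qed

lemma rational_element_coset_iff:
  assumes L: "left_ideal L" and f: "lin f"
  shows "rational_element (quotient_module L) (coset L f) \<longleftrightarrow> f \<in> rational_closure L"
proof -
  note q = quotient_module_simps[OF L]
  have "g \<odot>\<^bsub>quotient_module L\<^esub> coset L f = \<zero>\<^bsub>quotient_module L\<^esub> \<longleftrightarrow> conv g f \<in> L" if "lin g" for g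
    by (simp add: q(4)[OF f that] q(2) coset_eq_iff[OF L])
  moreover have "coset L f \<in> carrier (quotient_module L)" using f q(1) by blast
  ultimately show ?thesis
    unfolding rational_element_def rational_closure_def by (simp add: f cong: conj_cong)
qed

text \<open>Decompose \<open>\<epsilon> = e + e'\<close> modulo \<open>L\<close> along the direct sum of the rational part and a complement.  For \<open>f\<close>
rational modulo \<open>L\<close>, \<open>f e' = f - f e\<close> is both rational and in the complement, and so vanishes modulo \<open>L\<close>.\<close>

lemma splitting_idempotent:
  assumes split: "left_finite_Rat_splitting" and L: "left_ideal L"
  obtains e where "e \<in> rational_closure L"
    and "\<And>f. f \<in> rational_closure L \<Longrightarrow> (\<lambda>c. f c - conv f e c) \<in> L"
proof -
  note q = quotient_module_simps[OF L]
  let ?Q = "quotient_module L"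
  note Q_mod = left_module_quotient[OF L]
  interpret Q: left_module dual_algebra ?Q by (rule Q_mod)
  have "direct_summand dual_algebra ?Q (Rat ?Q)"
    using split Q_mod finitely_generated_quotient[OF L]
    unfolding left_finite_Rat_splitting_def by blast
  then obtain N where R: "submodule (Rat ?Q) dual_algebra ?Q" and N: "submodule N dual_algebra ?Q"
    and sum: "Rat ?Q <+>\<^bsub>?Q\<^esub> N = carrier ?Q" and int: "Rat ?Q \<inter> N = {\<zero>\<^bsub>?Q\<^esub>}"
    unfolding direct_summand_def by blast
  have "coset L counit \<in> carrier ?Q" using lin_counit q(1) by blast
  hence "coset L counit \<in> Rat ?Q <+>\<^bsub>?Q\<^esub> N" using sum by simp
  then obtain X Y where X: "X \<in> Rat ?Q" and Y: "Y \<in> N" and XY: "coset L counit = X \<oplus>\<^bsub>?Q\<^esub> Y"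
    unfolding set_add_def set_mult_def by auto
  have XYc: "X \<in> carrier ?Q" "Y \<in> carrier ?Q"
    using X Y Q.submoduleD(1)[OF R] Q.submoduleD(1)[OF N] by auto
  obtain e where e: "lin e" "X = coset L e" using XYc(1) q(1) by auto
  have e_rat: "e \<in> rational_closure L"
    using X unfolding e(2) Rat_eq[OF Q_mod] by (simp add: rational_element_coset_iff[OF L e(1)])
  show ?thesis
  proof (rule that[OF e_rat])
    fix f assume f: "f \<in> rational_closure L"
    hence lf: "lin f" by (simp add: rational_closure_def)
    have fc: "f \<in> carrier dual_algebra" using lf by simp
    let ?x = "f \<odot>\<^bsub>?Q\<^esub> X" and ?y = "f \<odot>\<^bsub>?Q\<^esub> Y"
    have x: "?x \<in> Rat ?Q" by (rule Q.submoduleD(4)[OF R fc X])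
    have y: "?y \<in> N" by (rule Q.submoduleD(4)[OF N fc Y])
    have xyc: "?x \<in> carrier ?Q" "?y \<in> carrier ?Q"
      using x y Q.submoduleD(1)[OF R] Q.submoduleD(1)[OF N] by auto
    have "coset L f = f \<odot>\<^bsub>?Q\<^esub> coset L counit"
      by (simp add: q(4)[OF lin_counit lf] conv_counit_right[OF lf])
    also have "\<dots> = ?x \<oplus>\<^bsub>?Q\<^esub> ?y" unfolding XY by (rule Q.smult_r_distr[OF fc XYc])
    finally have s: "coset L f = ?x \<oplus>\<^bsub>?Q\<^esub> ?y" .
    have fR: "coset L f \<in> Rat ?Q"
      using f by (simp add: Rat_eq[OF Q_mod] rational_element_coset_iff[OF L lf])
    have nx: "\<ominus>\<^bsub>?Q\<^esub> ?x \<in> Rat ?Q"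
    proof -
      have "(\<ominus>\<^bsub>dual_algebra\<^esub> \<one>\<^bsub>dual_algebra\<^esub>) \<odot>\<^bsub>?Q\<^esub> ?x \<in> Rat ?Q"
        by (rule Q.submoduleD(4)[OF R _ x]) (rule Q.R.a_inv_closed[OF Q.R.one_closed])
      thus ?thesis unfolding Q.smult_minus_one[OF xyc(1)] .
    qed
    have "\<ominus>\<^bsub>?Q\<^esub> ?x \<oplus>\<^bsub>?Q\<^esub> coset L f = ?y"
      unfolding s by (rule Q.M.r_neg1[OF xyc])
    hence "?y \<in> Rat ?Q" using Q.submoduleD(3)[OF R nx fR] by simp
    hence "?y = \<zero>\<^bsub>?Q\<^esub>" using y int by blast
    hence "coset L f = ?x" using s xyc by simp
    also have "\<dots> = coset L (conv f e)" unfolding e(2) by (rule q(4)[OF e(1) lf])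
    finally show "(\<lambda>c. f c - conv f e c) \<in> L" by (simp add: coset_eq_iff[OF L])
  qed
qed

section \<open>Essential extensions of left subcomodules\<close>

text \<open>Left subcomodules of \<open>C\<close>, seen as right submodules over the dual algebra.\<close>

definition left_coideal :: "'c set \<Rightarrow> bool" where
  "left_coideal X \<longleftrightarrow> subspace X \<and> (\<forall>f x. lin f \<longrightarrow> x \<in> X \<longrightarrow> ract f x \<in> X)"

lemma left_coidealD: "left_coideal X \<Longrightarrow> subspace X" "left_coideal X \<Longrightarrow> lin f \<Longrightarrow> x \<in> X \<Longrightarrow> ract f x \<in> X"
  by (auto simp: left_coideal_def)

lemma left_coideal_span:
  assumes "\<And>f a. lin f \<Longrightarrow> a \<in> A \<Longrightarrow> ract f a \<in> span A"
  shows "left_coideal (span A)"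
  unfolding left_coideal_def
proof (intro conjI allI impI)
  fix f x assume f: "lin f" and x: "x \<in> span A"
  interpret r: Vector_Spaces.linear scale scale "ract f" by (rule ract_linear[OF f])
  have "span A \<subseteq> {x. ract f x \<in> span A}"
    by (rule span_minimal) (use assms[OF f] r.subspace_linear_preimage in auto)
  thus "ract f x \<in> span A" using x by auto
qed simp

lemma left_coideal_span_Un:
  assumes "left_coideal X" "left_coideal Y" shows "left_coideal (span (X \<union> Y))"
  by (rule left_coideal_span) (use left_coidealD(2)[OF assms(1)] left_coidealD(2)[OF assms(2)] in \<open>auto intro: span_base\<close>)

lemma left_coideal_Union_chain:
  assumes "\<And>n. left_coideal (A n)" "\<And>n. A n \<subseteq> A (Suc n)"
  shows "left_coideal (\<Union>n::nat. A n)"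
proof -
  have mono: "A m \<subseteq> A n" if "m \<le> n" for m n
    using lift_Suc_mono_le[of A m n] assms(2) that by simp
  have sub: "subspace (\<Union>n. A n)"
  proof (rule subspaceI)
    show "0 \<in> (\<Union>n. A n)" using subspace_0[OF left_coidealD(1)[OF assms(1)]] by blast
  next
    fix x y assume "x \<in> (\<Union>n. A n)" "y \<in> (\<Union>n. A n)"
    then obtain m n where "x \<in> A m" "y \<in> A n" by blast
    hence "x + y \<in> A (max m n)"
      using mono[of m "max m n"] mono[of n "max m n"]
      by (intro subspace_add[OF left_coidealD(1)[OF assms(1)]]) auto
    thus "x + y \<in> (\<Union>n. A n)" by blast
  next
    fix k x assume "x \<in> (\<Union>n. A n)"
    then obtain n where "x \<in> A n" by blast
    hence "scale k x \<in> A n" by (rule subspace_scale[OF left_coidealD(1)[OF assms(1)]])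
    thus "scale k x \<in> (\<Union>n. A n)" by blast
  qed
  have "ract f x \<in> (\<Union>n. A n)" if f: "lin f" and x: "x \<in> (\<Union>n. A n)" for f x
  proof -
    obtain n where "x \<in> A n" using x by blast
    hence "ract f x \<in> A n" by (rule left_coidealD(2)[OF assms(1) f])
    thus ?thesis by blast
  qed
  thus ?thesis unfolding left_coideal_def using sub by simp
qed

text \<open>The subcomodule \<open>c \<cdot> C\<^sup>*\<close> contains \<open>c = c \<cdot> \<epsilon>\<close> and is finite-dimensional by local finiteness.\<close>

lemma left_coideal_generated:
  obtains F where "finite F" "left_coideal (span F)" "c \<in> span F"
    "\<And>Y. left_coideal Y \<Longrightarrow> c \<in> Y \<Longrightarrow> span F \<subseteq> Y"
proof -
  let ?D = "{ract f c | f. lin f}"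
  obtain S where S: "finite S" "\<And>f. lin f \<Longrightarrow> ract f c \<in> span S" using ract_finite[of c] by metis
  have sub: "subspace ?D"
  proof (rule subspaceI)
    have "ract (\<lambda>c. 0) c = 0" using ract_scale[OF lin_counit, of 0 c] by simp
    thus "0 \<in> ?D" using lin_zero by (metis (mono_tags, lifting) mem_Collect_eq)
  next
    fix x y assume "x \<in> ?D" "y \<in> ?D"
    then obtain f g where "lin f" "lin g" "x = ract f c" "y = ract g c" by auto
    hence "x + y = ract (\<lambda>c. f c + g c) c" "lin (\<lambda>c. f c + g c)" by (simp_all add: ract_add lin_add)
    thus "x + y \<in> ?D" by blast
  next
    fix k x assume "x \<in> ?D"
    then obtain f where "lin f" "x = ract f c" by auto
    hence "scale k x = ract (\<lambda>c. k * f c) c" "lin (\<lambda>c. k * f c)" by (simp_all add: ract_scale lin_scale)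
    thus "scale k x \<in> ?D" by blast
  qed
  obtain B where B: "B \<subseteq> ?D" "independent B" "?D \<subseteq> span B" by (rule basis_exists[of ?D])
  have sB: "span B = ?D" by (rule equalityI[OF span_minimal[OF B(1) sub] B(3)])
  have "B \<subseteq> span S" using B(1) S(2) by auto
  hence "finite B" using independent_span_bound[OF S(1) B(2)] by simp
  moreover have "left_coideal (span B)"
    unfolding sB using sub by (auto simp: left_coideal_def ract_ract intro: lin_conv)
  moreover have "c \<in> span B" unfolding sB using ract_counit[of c] lin_counit by force
  moreover have "span B \<subseteq> Y" if "left_coideal Y" "c \<in> Y" for Y
    unfolding sB using left_coidealD(2)[OF that(1) _ that(2)] by auto
  ultimately show ?thesis by (rule that)
qed

lemma finite_span_no_infinite_independent_sequence:
  assumes "finite S" "\<And>n::nat. v n \<in> span S"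
  obtains n where "v n \<in> span (v ` {..<n})"
proof (rule ccontr)
  assume "\<not> thesis"
  hence no: "v n \<notin> span (v ` {..<n})" for n using that by blast
  have "independent (v ` {..<n}) \<and> card (v ` {..<n}) = n" for n
  proof (induction n)
    case (Suc n)
    have "v n \<notin> v ` {..<n}" using no[of n] span_base[of "v n" "v ` {..<n}"] by auto
    thus ?case using Suc no[of n] by (simp add: lessThan_Suc independent_insertI)
  qed (simp add: independent_empty)
  from this[of "Suc (card S)"] independent_span_bound[OF assms(1), of "v ` {..<Suc (card S)}"]
  show False using assms(2) by auto
qed

lemma annihilator_left_ideal:
  assumes "left_coideal W"
  shows "left_ideal {f. lin f \<and> (\<forall>w\<in>W. f w = 0)}"
  using left_coidealD(2)[OF assms]
  by (auto simp: left_ideal_def lin_zero lin_add lin_conv functional_ract[symmetric])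

text \<open>On \<open>W\<close> a functional \<open>f\<close> that is rational modulo \<open>L\<close> agrees with \<open>f e\<close>, that is, with \<open>w \<mapsto> f (e \<cdot> w)\<close>.
Since \<open>e\<close> itself is rational modulo \<open>L\<close>, the space \<open>e \<cdot> W\<close> is finite-dimensional.  Hence the
restrictions to \<open>W\<close> of all these \<open>f\<close> form a finite-dimensional space.\<close>

lemma rational_closure_annihilator_vanishes_on_kernel:
  assumes split: "left_finite_Rat_splitting" and W: "left_coideal W"
  defines "L \<equiv> {f. lin f \<and> (\<forall>w\<in>W. f w = 0)}"
  shows "\<exists>e S. lin e \<and> finite S \<and> (\<forall>w\<in>W. lact e w \<in> span S) \<and>
    (\<forall>f\<in>rational_closure L. \<forall>w\<in>W. lact e w = 0 \<longrightarrow> f w = 0)"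
proof -
  have L: "left_ideal L" unfolding L_def by (rule annihilator_left_ideal[OF W])
  obtain e where e: "e \<in> rational_closure L"
    "\<And>f. f \<in> rational_closure L \<Longrightarrow> (\<lambda>c. f c - conv f e c) \<in> L"
    using splitting_idempotent[OF split L] by metis
  obtain S where le: "lin e" and S: "finite S"
    "\<And>g. lin g \<Longrightarrow> \<forall>s\<in>S. g s = 0 \<Longrightarrow> conv g e \<in> L"
    using e(1) by (auto simp: rational_closure_def)
  have "lact e w \<in> span S" if w: "w \<in> W" for w
  proof (rule ccontr)
    assume "lact e w \<notin> span S"
    from functional_separates_subspace[OF subspace_span this]
    obtain g where g: "lin g" "g (lact e w) = 1" "\<And>u. u \<in> span S \<Longrightarrow> g u = 0" by metis
    have "conv g e \<in> L" by (rule S(2)[OF g(1)]) (simp add: g(3) span_base)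
    hence "g (lact e w) = 0" using w by (simp add: L_def functional_lact[OF g(1) le])
    thus False using g(2) by simp
  qed
  moreover have "f w = 0" if f: "f \<in> rational_closure L" and w: "w \<in> W" "lact e w = 0" for f w
  proof -
    have lf: "lin f" using f by (simp add: rational_closure_def)
    have "f w = conv f e w" using e(2)[OF f] w(1) by (simp add: L_def)
    also have "\<dots> = 0" using functional_lact[OF lf le, of w] w(2) linD(4)[OF lf] by simp
    finally show ?thesis .
  qed
  ultimately show ?thesis using le S(1) by (intro exI[of _ e] exI[of _ S]) simp
qed

definition finite_over :: "'c set \<Rightarrow> 'c set \<Rightarrow> bool" where
  "finite_over X P \<longleftrightarrow> left_coideal P \<and> (\<exists>F. finite F \<and> P = span (X \<union> F))"

lemma finite_overD:
  assumes "finite_over X P"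
  shows "left_coideal P" "X \<subseteq> P" "subspace P"
proof -
  obtain F where F: "left_coideal P" "P = span (X \<union> F)" using assms by (auto simp: finite_over_def)
  show "left_coideal P" "subspace P" using F(1) left_coidealD(1) by auto
  show "X \<subseteq> P" unfolding F(2) using span_superset[of "X \<union> F"] by simp
qed

lemma finite_over_self: "left_coideal X \<Longrightarrow> finite_over X X"
  unfolding finite_over_def
  by (intro conjI exI[of _ "{}"]) (simp_all add: left_coidealD(1) span_eq_iff[THEN iffD2, symmetric])

lemma finite_over_sum:
  assumes "finite_over X P" "finite_over X Q"
  shows "finite_over X (span (P \<union> Q))"
proof -
  obtain F G where F: "finite F" "P = span (X \<union> F)" and G: "finite G" "Q = span (X \<union> G)"
    using assms by (auto simp: finite_over_def)
  have "span (P \<union> Q) = span (X \<union> (F \<union> G))"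
  proof (rule equalityI)
    show "span (P \<union> Q) \<subseteq> span (X \<union> (F \<union> G))"
      unfolding F(2) G(2) by (intro span_minimal Un_least subspace_span span_mono) auto
    show "span (X \<union> (F \<union> G)) \<subseteq> span (P \<union> Q)"
    proof (rule span_mono)
      have "X \<union> F \<subseteq> P" "X \<union> G \<subseteq> Q" unfolding F(2) G(2) by (rule span_superset)+
      thus "X \<union> (F \<union> G) \<subseteq> P \<union> Q" by auto
    qed
  qed
  thus ?thesis
    using left_coideal_span_Un[OF finite_overD(1)[OF assms(1)] finite_overD(1)[OF assms(2)]] F(1) G(1)
    unfolding finite_over_def by blast
qed

lemma finite_over_generated:
  assumes "left_coideal X"
  obtains S where "finite_over X S" "c \<in> S" "\<And>Y. left_coideal Y \<Longrightarrow> X \<subseteq> Y \<Longrightarrow> c \<in> Y \<Longrightarrow> S \<subseteq> Y"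
proof -
  obtain F where F: "finite F" "left_coideal (span F)" "c \<in> span F"
    "\<And>Y. left_coideal Y \<Longrightarrow> c \<in> Y \<Longrightarrow> span F \<subseteq> Y" using left_coideal_generated[of c] by metis
  have sp: "span (X \<union> span F) = span (X \<union> F)"
  proof (rule equalityI)
    have "X \<subseteq> span (X \<union> F)" "span F \<subseteq> span (X \<union> F)"
      using span_superset[of "X \<union> F"] span_mono[of F "X \<union> F"] by auto
    thus "span (X \<union> span F) \<subseteq> span (X \<union> F)" by (intro span_minimal) auto
    show "span (X \<union> F) \<subseteq> span (X \<union> span F)"
      using span_superset[of F] by (intro span_mono) auto
  qed
  show ?thesis
  proof (rule that[of "span (X \<union> span F)"])
    show "finite_over X (span (X \<union> span F))"
      using left_coideal_span_Un[OF assms F(2)] F(1) unfolding finite_over_def sp by blast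
    show "c \<in> span (X \<union> span F)" using F(3) by (intro span_base) simp
    fix Y assume Y: "left_coideal Y" "X \<subseteq> Y" "c \<in> Y"
    show "span (X \<union> span F) \<subseteq> Y"
      using F(4)[OF Y(1,3)] Y(2) left_coidealD(1)[OF Y(1)] by (intro span_minimal) auto
  qed
qed

lemma span_Un_subspacesE:
  assumes "subspace A" "subspace B" "x \<in> span (A \<union> B)"
  obtains a b where "a \<in> A" "b \<in> B" "x = a + b"
proof -
  have sp: "span A = A" "span B = B" by (rule span_eq_iff[THEN iffD2], fact)+
  have "x \<in> {x + y |x y. x \<in> A \<and> y \<in> B}" using assms(3) unfolding span_Un sp .
  thus ?thesis using that by blast
qed

text \<open>Suppose there is no such \<open>P\<close>.  Then one builds an increasing sequence \<open>P n\<close> of subcomodules of finite dimension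
over \<open>X\<close>, where \<open>P (n + 1)\<close> is the sum of \<open>P n\<close> and a subcomodule \<open>S n\<close> strictly above \<open>X\<close> that meets
\<open>P n\<close> only in \<open>X\<close>.  Let \<open>W\<close> be the union of the \<open>P n\<close> and \<open>U n\<close> the sum of the \<open>S i\<close> with \<open>i \<ge> n\<close>, so that
\<open>W = P n + U n\<close> and \<open>P n \<inter> U n = X\<close>.  A functional \<open>f\<close> that vanishes on \<open>U n\<close> is rational modulo the
annihilator of \<open>W\<close>, since \<open>f \<cdot> W\<close> is spanned by the images of finitely many elements of \<open>P n\<close>.  Such
functionals separate the points of \<open>W\<close> from \<open>X\<close>, so the operator \<open>w \<mapsto> e \<cdot> w\<close>, which has finite rank on \<open>W\<close>,
has its kernel on \<open>W\<close> inside \<open>X\<close>.  Applied to elements \<open>s n\<close> of \<open>S n\<close> outside \<open>X\<close>, it gives infinitely many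
independent vectors in a finite-dimensional space.\<close>

lemma finite_essential_extension:
  assumes split: "left_finite_Rat_splitting" and X: "left_coideal X"
  obtains P where "finite_over X P"
    "\<And>S. left_coideal S \<Longrightarrow> X \<subseteq> S \<Longrightarrow> S \<inter> P \<subseteq> X \<Longrightarrow> S = X"
proof (rule ccontr)
  assume contr: "\<not> thesis"
  note found = that
  have "\<exists>S. finite_over X S \<and> S \<noteq> X \<and> S \<inter> P \<subseteq> X" if P: "finite_over X P" for P
  proof -
    obtain Y where Y: "left_coideal Y" "X \<subseteq> Y" "Y \<inter> P \<subseteq> X" "Y \<noteq> X"
      using found[OF P] contr by blast
    then obtain c where c: "c \<in> Y" "c \<notin> X" by blast
    obtain S where S: "finite_over X S" "c \<in> S" "S \<subseteq> Y"
      using finite_over_generated[OF X, of c] Y(1,2) c(1) by metis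
    thus ?thesis using c(2) Y(3) by blast
  qed
  then obtain \<sigma> where \<sigma>: "\<And>P. finite_over X P \<Longrightarrow> finite_over X (\<sigma> P)"
    "\<And>P. finite_over X P \<Longrightarrow> \<sigma> P \<noteq> X" "\<And>P. finite_over X P \<Longrightarrow> \<sigma> P \<inter> P \<subseteq> X"
    by metis
  define P where "P = rec_nat X (\<lambda>_ P. span (P \<union> \<sigma> P))"
  have P0: "P 0 = X" and PSuc: "P (Suc n) = span (P n \<union> \<sigma> (P n))" for n
    by (simp_all add: P_def)
  define S where "S n = \<sigma> (P n)" for n
  have fin: "finite_over X (P n)" for n
  proof (induction n)
    case (Suc n)
    show ?case unfolding PSuc by (rule finite_over_sum[OF Suc \<sigma>(1)[OF Suc]])
  qed (simp add: P0 finite_over_self X)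
  have S: "finite_over X (S n)" "S n \<noteq> X" "S n \<inter> P n \<subseteq> X" for n
    using \<sigma>[OF fin] by (simp_all add: S_def)
  have PS: "P (Suc n) = span (P n \<union> S n)" for n by (simp add: PSuc S_def)
  have P_S: "P n \<subseteq> P (Suc n)" "S n \<subseteq> P (Suc n)" for n
    unfolding PS using span_superset[of "P n \<union> S n"] by auto
  have P_mono: "P m \<subseteq> P n" if "m \<le> n" for m n
    using lift_Suc_mono_le[of P m n] P_S(1) that by simp
  \<comment> \<open>\<open>T n k\<close> is the sum of \<open>X\<close> and the \<open>k\<close> subcomodules \<open>S n\<close>, ..., \<open>S (n + k - 1)\<close>.  The union of the
    \<open>T n k\<close> over all \<open>k\<close> complements \<open>P n\<close> modulo \<open>X\<close>.\<close>
  define T where "T n = rec_nat X (\<lambda>k A. span (A \<union> S (n + k)))" for n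
  have T0: "T n 0 = X" and TS: "T n (Suc k) = span (T n k \<union> S (n + k))" for n k
    by (simp_all add: T_def)
  have T: "left_coideal (T n k)" for n k
    by (induction k) (simp_all add: T0 TS X left_coideal_span_Un finite_overD(1)[OF S(1)])
  have T_Suc: "T n k \<subseteq> T n (Suc k)" for n k
    unfolding TS using span_superset[of "T n k \<union> S (n + k)"] by auto
  have T_P: "T n k \<subseteq> P (n + k)" for n k
  proof (induction k)
    case (Suc k)
    have "T n k \<union> S (n + k) \<subseteq> P (Suc (n + k))" using Suc P_S[of "n + k"] by auto
    from span_minimal[OF this finite_overD(3)[OF fin]] show ?case by (simp add: TS)
  qed (simp add: T0 finite_overD(2)[OF fin])
  have T_indep: "P n \<inter> T n k \<subseteq> X" for n k
  proof (induction k)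
    case (Suc k)
    show ?case
    proof
      fix x assume "x \<in> P n \<inter> T n (Suc k)"
      hence x: "x \<in> P n" "x \<in> span (T n k \<union> S (n + k))" by (auto simp: TS)
      obtain t s where ts: "t \<in> T n k" "s \<in> S (n + k)" "x = t + s"
        by (rule span_Un_subspacesE[OF left_coidealD(1)[OF T] finite_overD(3)[OF S(1)] x(2)])
      have "x \<in> P (n + k)" "t \<in> P (n + k)" using x(1) P_mono[of n "n + k"] ts(1) T_P by auto
      hence "x - t \<in> P (n + k)" by (rule subspace_diff[OF finite_overD(3)[OF fin]])
      hence "s \<in> X" using ts S(3) by auto
      moreover have "X \<subseteq> T n k" using lift_Suc_mono_le[of "T n" 0 k] T_Suc[of n] by (simp add: T0)
      ultimately have "x \<in> T n k" using ts subspace_add[OF left_coidealD(1)[OF T]] by auto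
      thus "x \<in> X" using x(1) Suc by auto
    qed
  qed (simp add: T0)
  define W where "W = (\<Union>n. P n)"
  define U where "U n = (\<Union>k. T n k)" for n
  have W: "left_coideal W" unfolding W_def by (rule left_coideal_Union_chain) (rule finite_overD(1)[OF fin], rule P_S(1))
  have U: "left_coideal (U n)" for n unfolding U_def by (rule left_coideal_Union_chain) (rule T, rule T_Suc)
  have XU: "X \<subseteq> U n" for n unfolding U_def using T0 by blast
  have W_sum: "W \<subseteq> span (P n \<union> U n)" for n
  proof -
    have "P (n + k) \<subseteq> span (P n \<union> U n)" for k
    proof (induction k)
      case 0
      show ?case using span_superset[of "P n \<union> U n"] by auto
    next
      case (Suc k)
      have "S (n + k) \<subseteq> T n (Suc k)" unfolding TS using span_superset[of "T n k \<union> S (n + k)"] by auto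
      hence "S (n + k) \<subseteq> U n" unfolding U_def by blast
      hence "P (n + k) \<union> S (n + k) \<subseteq> span (P n \<union> U n)"
        using Suc span_superset[of "P n \<union> U n"] by auto
      thus ?case using PS[of "n + k"] by (simp add: span_minimal)
    qed
    moreover have "P m \<subseteq> P (n + m)" for m by (rule P_mono) simp
    ultimately have "P m \<subseteq> span (P n \<union> U n)" for m by (metis subset_trans)
    thus ?thesis unfolding W_def by (rule UN_least)
  qed
  define L where "L = {f. lin f \<and> (\<forall>w\<in>W. f w = 0)}"
  obtain e E where e: "lin e" and E: "finite E" "\<forall>w\<in>W. lact e w \<in> span E"
    and ker: "\<forall>f\<in>rational_closure L. \<forall>w\<in>W. lact e w = 0 \<longrightarrow> f w = 0"
    using rational_closure_annihilator_vanishes_on_kernel[OF split W]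
    unfolding L_def[symmetric] by (elim exE conjE)
  have rat: "f \<in> rational_closure L" if f: "lin f" "\<And>u. u \<in> U n \<Longrightarrow> f u = 0" for f n
  proof -
    obtain F where F: "finite F" "P n = span (X \<union> F)" using fin[of n] by (auto simp: finite_over_def)
    have "conv g f \<in> L" if g: "lin g" "\<forall>s\<in>lact f ` F. g s = 0" for g
    proof -
      note l = lin_conv[OF g(1) f(1)]
      have z: "conv g f b = 0" if "b \<in> F \<union> U n" for b
        using that
      proof
        assume "b \<in> F" thus ?thesis using g(2) by (simp add: functional_lact[OF g(1) f(1), symmetric])
      next
        assume "b \<in> U n"
        hence "ract g b \<in> U n" by (rule left_coidealD(2)[OF U g(1)])
        thus ?thesis using f(2) by (simp add: functional_ract[OF f(1) g(1), symmetric])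
      qed
      have "W \<subseteq> span (F \<union> U n)"
      proof -
        have "P n \<subseteq> span (F \<union> U n)" unfolding F(2) using XU[of n] by (intro span_mono) auto
        hence "span (P n \<union> U n) \<subseteq> span (F \<union> U n)"
          using span_superset[of "F \<union> U n"] by (intro span_minimal) auto
        thus ?thesis using W_sum[of n] by simp
      qed
      hence "conv g f w = 0" if "w \<in> W" for w
        using vector_space_pair.linear_eq_0_on_span[OF functionals l z, of "F \<union> U n" w] that by auto
      thus ?thesis using l by (simp add: L_def)
    qed
    thus ?thesis using f(1) F(1) by (auto simp: rational_closure_def intro!: exI[of _ "lact f ` F"])
  qed
  have ker_X: "w \<in> X" if w: "w \<in> P n" "lact e w = 0" for w n
  proof (rule ccontr)
    assume "w \<notin> X"
    hence "w \<notin> U n" using w(1) T_indep[of n] by (auto simp: U_def)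
    from functional_separates_subspace[OF left_coidealD(1)[OF U] this]
    obtain f where f: "lin f" "f w = 1" "\<And>u. u \<in> U n \<Longrightarrow> f u = 0" by metis
    have "f \<in> rational_closure L" by (rule rat[OF f(1,3)])
    moreover have "w \<in> W" using w(1) by (auto simp: W_def)
    ultimately have "f w = 0" using ker w(2) by simp
    thus False using f(2) by simp
  qed
  have "\<exists>s. s \<in> S n \<and> s \<notin> X" for n
    using S(2)[of n] finite_overD(2)[OF S(1)[of n]] by blast
  then obtain s where s: "\<And>n. s n \<in> S n" "\<And>n. s n \<notin> X" by metis
  have sP: "s n \<in> P m" if "n < m" for n m
    using s(1)[of n] P_S(2)[of n] P_mono[of "Suc n" m] that by auto
  interpret e: Vector_Spaces.linear scale scale "lact e" by (rule lact_linear[OF e])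
  have "lact e (s n) \<in> span E" for n
    by (rule bspec[OF E(2)]) (use sP[of n "Suc n"] in \<open>auto simp: W_def\<close>)
  then obtain n where n: "lact e (s n) \<in> span ((\<lambda>n. lact e (s n)) ` {..<n})"
    by (rule finite_span_no_infinite_independent_sequence[OF E(1)])
  have "span ((\<lambda>n. lact e (s n)) ` {..<n}) = lact e ` span (s ` {..<n})"
    using e.span_image[of "s ` {..<n}"] by (simp add: image_image)
  then obtain p where p: "p \<in> span (s ` {..<n})" "lact e (s n) = lact e p" using n by auto
  have "span (s ` {..<n}) \<subseteq> P n"
    using sP finite_overD(3)[OF fin] by (intro span_minimal) auto
  hence pP: "p \<in> P n" using p(1) by auto
  have "s n - p \<in> P (Suc n)"
    using sP[of n "Suc n"] pP P_S(1)[of n] by (intro subspace_diff[OF finite_overD(3)[OF fin]]) auto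
  moreover have "lact e (s n - p) = 0" using p(2) by (simp add: e.diff)
  ultimately have "s n - p \<in> X" by (rule ker_X)
  hence "s n - p + p \<in> P n"
    using finite_overD(2)[OF fin, of n] pP by (intro subspace_add[OF finite_overD(3)[OF fin]]) auto
  thus False using s[of n] S(3)[of n] by auto
qed

end

section \<open>Chain conditions and countable dimension\<close>

lemma descending_chain_condition_mono:
  assumes "descending_chain_condition \<G>" "\<F> \<subseteq> \<G>"
  shows "descending_chain_condition \<F>"
  unfolding descending_chain_condition_def
proof (intro allI impI)
  fix N :: "nat \<Rightarrow> 'a set"
  assume "\<forall>i. N i \<in> \<F>" and dec: "\<forall>i. N (Suc i) \<subseteq> N i"
  hence "\<forall>i. N i \<in> \<G>" using assms(2) by auto
  thus "\<exists>n. \<forall>i\<ge>n. N i = N n" using assms(1) dec unfolding descending_chain_condition_def by simp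
qed

lemma linear_functional_extension:
  fixes s :: "'k::field \<Rightarrow> 'v::ab_group_add \<Rightarrow> 'v"
  assumes V: "vector_space s" and U: "module.subspace s U"
    and add: "\<And>x y. x \<in> U \<Longrightarrow> y \<in> U \<Longrightarrow> \<phi> (x + y) = \<phi> x + \<phi> y"
    and scl: "\<And>k x. x \<in> U \<Longrightarrow> \<phi> (s k x) = k * (\<phi> x :: 'k)"
  shows "\<exists>g. Vector_Spaces.linear s (*) g \<and> (\<forall>u\<in>U. g u = \<phi> u)"
proof -
  interpret V: vector_space s by (rule V)
  have pair: "vector_space_pair s ((*) :: 'k \<Rightarrow> 'k \<Rightarrow> 'k)"
    unfolding vector_space_pair_def using V vector_space_field by simp
  obtain B where B: "B \<subseteq> U" "V.independent B" "U \<subseteq> V.span B" by (rule V.basis_exists[of U])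
  from vector_space_pair.linear_independent_extend[OF pair B(2), of \<phi>]
  obtain g where g: "Vector_Spaces.linear s (*) g" "\<forall>x\<in>B. g x = \<phi> x" by (elim exE conjE)
  have g_add: "g (x + y) = g x + g y" and g_scl: "g (s k x) = k * g x" for x y k
    using g(1) by (simp_all add: Vector_Spaces.linear_iff)
  have zero: "\<phi> 0 = 0" using scl[OF V.subspace_0[OF U], of 0] by simp
  have g0: "g 0 = 0" using g_scl[of 0 0] by simp
  have "V.subspace {u \<in> U. g u = \<phi> u}"
    by (rule V.subspaceI)
      (auto simp: zero g0 g_add g_scl add scl V.subspace_0[OF U] V.subspace_add[OF U] V.subspace_scale[OF U])
  hence "V.span B \<subseteq> {u \<in> U. g u = \<phi> u}" using B(1) g(2) by (intro V.span_minimal) auto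
  thus ?thesis using g(1) B(3) by auto
qed

context coalgebra
begin

text \<open>Induction on \<open>F\<close>: if adding one vector \<open>a\<close> destroyed the property, all \<open>N j\<close> would contain a vector \<open>a + p\<close>
with \<open>p\<close> in the smaller span, and by the induction hypothesis these vectors agree up to \<open>X\<close> from some
level on.  One of them would then lie in all \<open>N j\<close>.\<close>

lemma descending_subspaces_meet_finite_extension:
  assumes N: "\<And>i::nat. subspace (N i)" "\<And>i. N (Suc i) \<subseteq> N i" and "finite F"
  shows "\<exists>i. N i \<inter> span ((\<Inter>i. N i) \<union> F) \<subseteq> (\<Inter>i. N i)"
  using \<open>finite F\<close>
proof (induction F)
  case empty
  have "subspace (\<Inter>i. N i)" by (rule subspace_Int) (rule N(1))
  thus ?case by (simp add: span_eq_iff[THEN iffD2])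
next
  case (insert a F)
  let ?X = "\<Inter>i. N i"
  have mono: "N j \<subseteq> N i" if "i \<le> j" for i j
    using lift_Suc_antimono_le[of N i j] N(2) that by simp
  obtain i where i: "N i \<inter> span (?X \<union> F) \<subseteq> ?X" using insert.IH by auto
  show ?case
  proof (rule ccontr)
    assume no: "\<nexists>i. N i \<inter> span (?X \<union> insert a F) \<subseteq> ?X"
    \<comment> \<open>Below level \<open>i\<close>, a vector of the form \<open>a + p\<close> is unique up to \<open>X\<close>.\<close>
    have ex: "\<exists>p\<in>span (?X \<union> F). a + p \<in> N j" if ij: "i \<le> j" for j
    proof -
      have "\<not> N j \<inter> span (insert a (?X \<union> F)) \<subseteq> ?X" using no by simp
      then obtain y where y: "y \<in> N j" "y \<in> span (insert a (?X \<union> F))" "y \<notin> ?X" by blast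
      then obtain k where k: "y - scale k a \<in> span (?X \<union> F)" by (auto simp: span_insert)
      have "k \<noteq> 0"
      proof
        assume "k = 0"
        hence "y \<in> N i \<inter> span (?X \<union> F)" using k y(1) mono[OF ij] by auto
        thus False using i y(3) by auto
      qed
      hence "scale (inverse k) y = a + scale (inverse k) (y - scale k a)"
        by (simp add: scale_right_diff_distrib)
      moreover have "scale (inverse k) y \<in> N j" by (rule subspace_scale[OF N(1) y(1)])
      ultimately show ?thesis using span_scale[OF k, of "inverse k"] by metis
    qed
    obtain p where p: "p \<in> span (?X \<union> F)" "a + p \<in> N i" using ex[of i] by auto
    have deep: "a + p \<in> N j" if ij: "i \<le> j" for j
    proof -
      obtain q where q: "q \<in> span (?X \<union> F)" "a + q \<in> N j" using ex[OF ij] by auto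
      have "(a + p) - (a + q) \<in> N i"
        using p(2) q(2) mono[OF ij] by (intro subspace_diff[OF N(1)]) auto
      hence "p - q \<in> ?X" using i span_diff[OF p(1) q(1)] by auto
      hence "(a + q) + (p - q) \<in> N j" by (intro subspace_add[OF N(1) q(2)]) auto
      thus ?thesis by simp
    qed
    have "a + p \<in> N j" for j
      using deep[of "max i j"] mono[of j "max i j"] by auto
    hence apX: "a + p \<in> ?X" by blast
    have "a \<in> span (?X \<union> F)"
      using span_diff[OF span_base[of "a + p" "?X \<union> F"] p(1)] apX by auto
    hence "span (?X \<union> insert a F) = span (?X \<union> F)" using span_redundant[of a "?X \<union> F"] by simp
    thus False using no i by auto
  qed
qed

lemma left_coideal_descending_chain_condition:
  assumes split: "left_finite_Rat_splitting"
  shows "descending_chain_condition {X. left_coideal X}"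
  unfolding descending_chain_condition_def
proof (intro allI impI)
  fix N :: "nat \<Rightarrow> 'c set"
  assume "\<forall>i. N i \<in> {X. left_coideal X}" and d: "\<forall>i. N (Suc i) \<subseteq> N i"
  hence N: "left_coideal (N i)" and dec: "N (Suc i) \<subseteq> N i" for i by auto
  let ?X = "\<Inter>i. N i"
  have "subspace ?X" by (rule subspace_Int) (rule left_coidealD(1)[OF N])
  hence X: "left_coideal ?X" unfolding left_coideal_def using left_coidealD(2)[OF N] by auto
  obtain P where P: "finite_over ?X P"
    "\<And>S. left_coideal S \<Longrightarrow> ?X \<subseteq> S \<Longrightarrow> S \<inter> P \<subseteq> ?X \<Longrightarrow> S = ?X"
    using finite_essential_extension[OF split X] by metis
  obtain F where F: "finite F" "P = span (?X \<union> F)" using P(1) by (auto simp: finite_over_def)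
  obtain i where i: "N i \<inter> P \<subseteq> ?X"
    using descending_subspaces_meet_finite_extension[of N, OF left_coidealD(1)[OF N] dec F(1)] F(2) by metis
  have "N i = ?X" by (rule P(2)[OF N _ i]) blast
  moreover have "?X \<subseteq> N j" "j \<ge> i \<Longrightarrow> N j \<subseteq> N i" for j
    using lift_Suc_antimono_le[of N i j] dec by auto
  ultimately show "\<exists>n. \<forall>i\<ge>n. N i = N n" by (intro exI[of _ i] allI impI equalityI) auto
qed

text \<open>Iterating the essential extension from \<open>0\<close> gives finite-dimensional subcomodules \<open>Q n\<close>.  If \<open>c\<close> were in none
of them, the finite-dimensional subcomodule \<open>D\<close> generated by \<open>c\<close> would have \<open>D + Q n\<close> strictly above \<open>Q n\<close>
for all \<open>n\<close>; it would therefore contain, for each \<open>n\<close>, a vector of \<open>Q (n + 1)\<close> outside \<open>Q n\<close>.\<close>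

lemma countable_dimension_if_splitting:
  assumes split: "left_finite_Rat_splitting"
  shows "countable_dimension"
proof -
  have "\<exists>P. finite_over X P \<and> (\<forall>S. left_coideal S \<longrightarrow> X \<subseteq> S \<longrightarrow> S \<inter> P \<subseteq> X \<longrightarrow> S = X)" if "left_coideal X" for X
    using finite_essential_extension[OF split that] by metis
  then obtain \<pi> where \<pi>: "\<And>X. left_coideal X \<Longrightarrow> finite_over X (\<pi> X)"
    "\<And>X S. left_coideal X \<Longrightarrow> left_coideal S \<Longrightarrow> X \<subseteq> S \<Longrightarrow> S \<inter> \<pi> X \<subseteq> X \<Longrightarrow> S = X" by metis
  define Q where "Q = rec_nat {0} (\<lambda>_ X. \<pi> X)"
  have Q0: "Q 0 = {0}" and QS: "Q (Suc n) = \<pi> (Q n)" for n by (simp_all add: Q_def)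
  have r0: "left_coideal {0}" by (simp add: left_coideal_def ract_simps(1))
  have Q: "left_coideal (Q n)" for n
    by (induction n) (simp_all add: Q0 QS r0 finite_overD(1)[OF \<pi>(1)])
  have fin: "\<exists>G. finite G \<and> Q n = span G" for n
  proof (induction n)
    case 0
    show ?case by (intro exI[of _ "{}"]) (simp add: Q0)
  next
    case (Suc n)
    then obtain G where G: "finite G" "Q n = span G" by auto
    obtain F where F: "finite F" "Q (Suc n) = span (Q n \<union> F)"
      using \<pi>(1)[OF Q[of n]] by (auto simp: finite_over_def QS)
    have "span (Q n \<union> F) = span (G \<union> F)"
    proof (rule equalityI)
      have "Q n \<subseteq> span (G \<union> F)" unfolding G(2) by (rule span_mono) simp
      moreover have "F \<subseteq> span (G \<union> F)" using span_superset[of "G \<union> F"] by simp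
      ultimately show "span (Q n \<union> F) \<subseteq> span (G \<union> F)" by (intro span_minimal) auto
      have "G \<subseteq> Q n" unfolding G(2) by (rule span_superset)
      thus "span (G \<union> F) \<subseteq> span (Q n \<union> F)" by (intro span_mono) auto
    qed
    thus ?case using F G(1) by (intro exI[of _ "G \<union> F"]) simp
  qed
  then obtain G where G: "\<And>n. finite (G n)" "\<And>n. Q n = span (G n)" by metis
  have Q_mono: "Q m \<subseteq> Q n" if "m \<le> n" for m n
  proof -
    have "Q k \<subseteq> Q (Suc k)" for k unfolding QS by (rule finite_overD(2)[OF \<pi>(1)[OF Q]])
    thus ?thesis using lift_Suc_mono_le[of Q m n] that by simp
  qed
  have all: "c \<in> (\<Union>n. Q n)" for c
  proof (rule ccontr)
    assume c: "c \<notin> (\<Union>n. Q n)"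
    obtain F where F: "finite F" "left_coideal (span F)" "c \<in> span F" using left_coideal_generated[of c] by metis
    have "\<exists>v. v \<in> span F \<and> v \<in> Q (Suc n) \<and> v \<notin> Q n" for n
    proof (rule ccontr)
      assume no: "\<nexists>v. v \<in> span F \<and> v \<in> Q (Suc n) \<and> v \<notin> Q n"
      let ?S = "span (span F \<union> Q n)"
      have "?S \<inter> \<pi> (Q n) \<subseteq> Q n"
      proof
        fix x assume "x \<in> ?S \<inter> \<pi> (Q n)"
        hence x: "x \<in> ?S" "x \<in> Q (Suc n)" by (auto simp: QS)
        obtain u q where u: "u \<in> span F" "q \<in> Q n" "x = u + q"
          by (rule span_Un_subspacesE[OF subspace_span left_coidealD(1)[OF Q] x(1)])
        have "x - q \<in> Q (Suc n)"
          using x(2) u(2) Q_mono[of n "Suc n"] by (intro subspace_diff[OF left_coidealD(1)[OF Q]]) auto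
        hence "u \<in> Q n" using u no by auto
        thus "x \<in> Q n" unfolding u(3) using u(2) by (rule subspace_add[OF left_coidealD(1)[OF Q]])
      qed
      hence "?S = Q n"
        using span_superset[of "span F \<union> Q n"] by (intro \<pi>(2)[OF Q left_coideal_span_Un[OF F(2) Q]]) auto
      moreover have "c \<in> ?S" using F(3) by (intro span_base) simp
      ultimately show False using c by auto
    qed
    then obtain v where v: "\<And>n. v n \<in> span F" "\<And>n. v n \<in> Q (Suc n)" "\<And>n. v n \<notin> Q n" by metis
    obtain n where n: "v n \<in> span (v ` {..<n})"
      by (rule finite_span_no_infinite_independent_sequence[OF F(1) v(1)])
    have "v ` {..<n} \<subseteq> Q n"
    proof
      fix x assume "x \<in> v ` {..<n}"
      then obtain m where "m < n" "x = v m" by auto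
      thus "x \<in> Q n" using v(2)[of m] Q_mono[of "Suc m" n] by auto
    qed
    hence "span (v ` {..<n}) \<subseteq> Q n" by (rule span_minimal[OF _ left_coidealD(1)[OF Q]])
    thus False using n v(3)[of n] by auto
  qed
  let ?G = "\<Union>n. G n"
  obtain B where B: "B \<subseteq> ?G" "independent B" "?G \<subseteq> span B"
    by (rule maximal_independent_subset[of ?G])
  have "countable ?G" using G(1) by (intro countable_UN) (auto intro: countable_finite)
  hence "countable B" using B(1) countable_subset by metis
  moreover have "span B = UNIV"
  proof -
    have "Q n \<subseteq> span B" for n
      unfolding G(2) using B(3) by (intro span_minimal subspace_span) auto
    hence "(\<Union>n. Q n) \<subseteq> span B" by (rule UN_least)
    thus ?thesis using all by blast
  qed
  ultimately show ?thesis unfolding countable_dimension_def using B(2) by blast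
qed

lemma left_coideal_common_kernel:
  assumes "\<And>t. t \<in> T \<Longrightarrow> lin t"
  shows "left_coideal {c. \<forall>t\<in>T. lact t c = 0}"
proof -
  have "subspace {c. \<forall>t\<in>T. lact t c = 0}"
    by (rule subspaceI) (simp_all add: lact_simps[OF assms])
  moreover have "lact t (ract f c) = 0" if "lin f" "\<forall>t\<in>T. lact t c = 0" "t \<in> T" for f c t
    using that ract_simps(1)[OF that(1)]
    by (simp add: lact_ract_commute[OF assms[OF that(3)] that(1)])
  ultimately show ?thesis by (simp add: left_coideal_def)
qed

text \<open>Finitely generated left ideals are annihilators: \<open>C\<^sup>* t\<close> consists of the functionals that factor
through \<open>c \<mapsto> t \<cdot> c\<close>, that is, of those vanishing on its kernel.  For several generators one generator
is split off at a time; \<open>f - g t\<close> vanishes on the common kernel of the others when \<open>g\<close> is chosen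
such that \<open>f = g t\<close> there.\<close>

lemma left_ideal_contains_annihilator_of_common_kernel:
  assumes I: "left_ideal I" and T: "finite T" "T \<subseteq> I"
    and f: "lin f" "\<And>c. \<forall>t\<in>T. lact t c = 0 \<Longrightarrow> f c = 0"
  shows "f \<in> I"
  using T f
proof (induction T arbitrary: f)
  case empty
  hence "f = (\<lambda>c. 0)" by auto
  thus ?case using left_idealD(2)[OF I] by simp
next
  case (insert t T)
  have t: "lin t" "t \<in> I" and TI: "\<And>s. s \<in> T \<Longrightarrow> lin s"
    using insert.prems(1) left_idealD(1)[OF I] by auto
  interpret t: Vector_Spaces.linear scale scale "lact t" by (rule lact_linear[OF t(1)])
  let ?U = "{c. \<forall>s\<in>T. lact s c = 0}"
  have U: "subspace ?U" by (rule left_coidealD(1)[OF left_coideal_common_kernel[OF TI]])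
  \<comment> \<open>On \<open>?U\<close>, \<open>f\<close> depends only on \<open>t \<cdot> u\<close>, because \<open>f\<close> vanishes on the kernel of \<open>t\<close> there.\<close>
  define \<phi> where "\<phi> y = f (SOME u. u \<in> ?U \<and> lact t u = y)" for y
  have \<phi>: "\<phi> (lact t u) = f u" if u: "u \<in> ?U" for u
  proof -
    let ?v = "SOME v. v \<in> ?U \<and> lact t v = lact t u"
    have v: "?v \<in> ?U \<and> lact t ?v = lact t u" by (rule someI[of _ u]) (use u in simp)
    have "?v - u \<in> ?U" using v u by (intro subspace_diff[OF U]) auto
    moreover have "lact t (?v - u) = 0" using v by (simp add: t.diff)
    ultimately have "f (?v - u) = 0" using insert.prems(3)[of "?v - u"] by simp
    thus ?thesis unfolding \<phi>_def using linD(2)[OF insert.prems(2)] by simp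
  qed
  have "\<exists>g. lin g \<and> (\<forall>y\<in>lact t ` ?U. g y = \<phi> y)"
  proof (rule linear_functional_extension[OF vector_space_axioms t.subspace_image[OF U]])
    fix x y assume "x \<in> lact t ` ?U" "y \<in> lact t ` ?U"
    then obtain u v where uv: "u \<in> ?U" "x = lact t u" "v \<in> ?U" "y = lact t v" by blast
    show "\<phi> (x + y) = \<phi> x + \<phi> y"
      using \<phi>[OF subspace_add[OF U uv(1,3)]] \<phi>[OF uv(1)] \<phi>[OF uv(3)]
      by (simp only: uv t.add linD(1)[OF insert.prems(2)])
  next
    fix k x assume "x \<in> lact t ` ?U"
    then obtain u where u: "u \<in> ?U" "x = lact t u" by blast
    show "\<phi> (scale k x) = k * \<phi> x"
      using \<phi>[OF subspace_scale[OF U u(1)], of k] \<phi>[OF u(1)]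
      by (simp only: u t.scale linD(3)[OF insert.prems(2)])
  qed
  then obtain g where g: "lin g" "\<forall>y\<in>lact t ` ?U. g y = \<phi> y" by (elim exE conjE)
  have gt: "conv g t \<in> I" by (rule left_idealD(4)[OF I g(1) t(2)])
  have "(\<lambda>c. f c - conv g t c) \<in> I"
  proof (rule insert.IH)
    show "T \<subseteq> I" using insert.prems(1) by simp
    show "lin (\<lambda>c. f c - conv g t c)" by (rule lin_diff[OF insert.prems(2) lin_conv[OF g(1) t(1)]])
    fix c assume c: "\<forall>s\<in>T. lact s c = 0"
    have "conv g t c = g (lact t c)" by (rule functional_lact[OF g(1) t(1), symmetric])
    also have "\<dots> = f c" using g(2) c \<phi>[of c] by simp
    finally show "f c - conv g t c = 0" by simp
  qed
  from left_idealD(3)[OF I this gt] show ?case by simp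
qed

text \<open>The chain condition provides a finite \<open>T\<close> with minimal common kernel.  Every \<open>f\<close> in \<open>I\<close> acts as zero on this kernel, and
\<open>f(c) = \<epsilon>(f \<cdot> c)\<close>.\<close>

lemma left_ideal_finite_kernel:
  assumes dcc: "descending_chain_condition {X. left_coideal X}" and I: "left_ideal I"
  shows "\<exists>T. finite T \<and> T \<subseteq> I \<and> (\<forall>f\<in>I. \<forall>c. (\<forall>t\<in>T. lact t c = 0) \<longrightarrow> f c = 0)"
proof (rule ccontr)
  assume no: "\<not> ?thesis"
  have "\<exists>f. f \<in> I \<and> (\<exists>c. (\<forall>t\<in>T. lact t c = 0) \<and> f c \<noteq> 0)" if "finite T" "T \<subseteq> I" for T
    using no that by blast
  then obtain \<phi> where \<phi>: "\<And>T. finite T \<Longrightarrow> T \<subseteq> I \<Longrightarrow>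
    \<phi> T \<in> I \<and> (\<exists>c. (\<forall>t\<in>T. lact t c = 0) \<and> \<phi> T c \<noteq> 0)" by metis
  define T where "T = rec_nat {} (\<lambda>_ A. insert (\<phi> A) A)"
  have T0: "T 0 = {}" and TS: "T (Suc n) = insert (\<phi> (T n)) (T n)" for n by (simp_all add: T_def)
  have T: "finite (T n) \<and> T n \<subseteq> I" for n
    by (induction n) (simp_all add: T0 TS \<phi>)
  let ?K = "\<lambda>n. {c. \<forall>t\<in>T n. lact t c = 0}"
  have "left_coideal (?K n)" for n
    using T[of n] left_idealD(1)[OF I] by (intro left_coideal_common_kernel) auto
  moreover have "?K (Suc n) \<subseteq> ?K n" for n by (auto simp: TS)
  ultimately obtain n where n: "\<forall>i\<ge>n. ?K i = ?K n"
    using dcc unfolding descending_chain_condition_def by (elim allE[of _ ?K]) auto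
  obtain c where c: "c \<in> ?K n" "\<phi> (T n) c \<noteq> 0" using \<phi>[of "T n"] T[of n] by auto
  have l: "lin (\<phi> (T n))" using \<phi>[of "T n"] T[of n] left_idealD(1)[OF I] by auto
  have "?K (Suc n) = ?K n" by (rule n[rule_format]) simp
  hence "c \<in> ?K (Suc n)" using c(1) by blast
  hence "lact (\<phi> (T n)) c = 0" by (simp add: TS)
  hence "conv counit (\<phi> (T n)) c = 0"
    using functional_lact[OF lin_counit l, of c] linD(4)[OF lin_counit] by simp
  thus False using c(2) by (simp add: conv_counit_left[OF l])
qed

lemma left_ideal_ascending_chain_condition:
  assumes dcc: "descending_chain_condition {X. left_coideal X}"
  shows "ascending_chain_condition {I. left_ideal I}"
  unfolding ascending_chain_condition_def
proof (intro allI impI)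
  fix I :: "nat \<Rightarrow> ('c \<Rightarrow> 'k) set"
  assume "\<forall>i. I i \<in> {I. left_ideal I}" and "\<forall>i. I i \<subseteq> I (Suc i)"
  hence I: "left_ideal (I i)" and asc: "I i \<subseteq> I (Suc i)" for i by auto
  have mono: "I m \<subseteq> I n" if "m \<le> n" for m n
    using lift_Suc_mono_le[of I m n] asc that by simp
  let ?J = "\<Union>i. I i"
  have J: "left_ideal ?J"
    unfolding left_ideal_def
  proof (intro conjI ballI allI impI)
    show "?J \<subseteq> {f. lin f}" using left_idealD(1)[OF I] by auto
    show "(\<lambda>c. 0) \<in> ?J" using left_idealD(2)[OF I] by auto
    show "conv f g \<in> ?J" if "lin f" "g \<in> ?J" for f g
      using left_idealD(4)[OF I that(1)] that(2) by auto
    fix f g assume "f \<in> ?J" "g \<in> ?J"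
    then obtain m n where "f \<in> I m" "g \<in> I n" by auto
    hence "f \<in> I (max m n)" "g \<in> I (max m n)"
      using mono[of m "max m n"] mono[of n "max m n"] by auto
    from left_idealD(3)[OF I this] show "(\<lambda>c. f c + g c) \<in> ?J" by auto
  qed
  obtain T where T: "finite T" "T \<subseteq> ?J"
    and ker: "\<forall>f\<in>?J. \<forall>c. (\<forall>t\<in>T. lact t c = 0) \<longrightarrow> f c = 0"
    using left_ideal_finite_kernel[OF dcc J] by (elim exE conjE)
  have "\<exists>n. T \<subseteq> I n"
    using T
  proof (induction T)
    case (insert t T)
    then obtain m n where "T \<subseteq> I m" "t \<in> I n" by auto
    hence "insert t T \<subseteq> I (max m n)" using mono[of m "max m n"] mono[of n "max m n"] by auto
    thus ?case by blast
  qed simp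
  then obtain n where n: "T \<subseteq> I n" ..
  have "?J \<subseteq> I n"
  proof
    fix f assume f: "f \<in> ?J"
    show "f \<in> I n"
      by (rule left_ideal_contains_annihilator_of_common_kernel[OF I T(1) n left_idealD(1)[OF J f]])
        (use ker f in blast)
  qed
  thus "\<exists>n. \<forall>i\<ge>n. I i = I n" using mono by (intro exI[of _ n] allI impI equalityI) auto
qed

end

section \<open>Injectivity\<close>

lemma vector_space_functions:
  "vector_space (\<lambda>(k :: 'k::field) (f :: 'a \<Rightarrow> 'k) c. k * f c)"
  by unfold_locales (simp_all add: fun_eq_iff algebra_simps)

context coalgebra
begin

text \<open>Finite-dimensional duality: \<open>\<mu>\<close> factors through the restriction of functionals to \<open>S\<close>.\<close>

lemma functional_on_dual_is_evaluation:
  assumes S: "finite S" and vanish: "\<And>f. lin f \<Longrightarrow> \<forall>s\<in>S. f s = 0 \<Longrightarrow> \<mu> f = 0"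
    and add: "\<And>f g. lin f \<Longrightarrow> lin g \<Longrightarrow> \<mu> (\<lambda>c. f c + g c) = \<mu> f + \<mu> g"
    and scl: "\<And>k f. lin f \<Longrightarrow> \<mu> (\<lambda>c. k * f c) = k * \<mu> f"
  shows "\<exists>c. \<forall>f. lin f \<longrightarrow> \<mu> f = f c"
proof -
  obtain B :: "'c set" and d where B: "finite B" and d: "\<And>b. b \<in> B \<Longrightarrow> lin (d b)"
    and exp: "\<And>f s. lin f \<Longrightarrow> s \<in> S \<Longrightarrow> f s = (\<Sum>b\<in>B. f b * d b s)"
    using finite_dual_basis[OF S] by metis
  define x where "x = (\<Sum>b\<in>B. scale (\<mu> (d b)) b)"
  have "\<mu> f = f x" if f: "lin f" for f
  proof -
    have zero: "\<mu> (\<lambda>c. 0) = 0" by (rule vanish[OF lin_zero]) simp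
    have sums: "lin (\<lambda>c. \<Sum>b\<in>A. f b * d b c) \<and>
        \<mu> (\<lambda>c. \<Sum>b\<in>A. f b * d b c) = f (\<Sum>b\<in>A. scale (\<mu> (d b)) b)"
      if "finite A" "A \<subseteq> B" for A
      using that
    proof (induction A)
      case empty
      show ?case by (simp add: zero lin_zero linD(4)[OF f])
    next
      case (insert a A)
      have l: "lin (d a)" "lin (\<lambda>c. \<Sum>b\<in>A. f b * d b c)" using insert d by auto
      show ?case
        using insert add[OF lin_scale[OF l(1)] l(2), of "f a"] scl[OF l(1), of "f a"]
        by (simp add: lin_add lin_scale l linD[OF f] mult.commute)
    qed
    note s = sums[OF B subset_refl]
    let ?s = "\<lambda>c. \<Sum>b\<in>B. f b * d b c"
    have ld: "lin (\<lambda>c. f c - ?s c)" by (rule lin_diff[OF f conjunct1[OF s]])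
    have "\<mu> (\<lambda>c. f c - ?s c) = 0" by (rule vanish[OF ld]) (use exp[OF f] in simp)
    hence "\<mu> f = \<mu> ?s" using add[OF ld conjunct1[OF s]] by simp
    thus ?thesis using s by (simp add: x_def)
  qed
  thus ?thesis by blast
qed

text \<open>The extension problem of Baer's criterion for \<open>C\<close>, solved with the projection onto the rational part of
\<open>C\<^sup>* / ker \<phi>\<close>.  A homomorphism to \<open>C\<close> is determined by its composite with \<open>\<epsilon>\<close>, so it is enough to extend
that functional linearly and then to correct it by \<open>e\<close>, which makes it an evaluation.\<close>

lemma homomorphism_from_left_ideal_extends:
  assumes split: "left_finite_Rat_splitting" and I: "left_ideal I"
    and add: "\<And>f g. f \<in> I \<Longrightarrow> g \<in> I \<Longrightarrow> \<phi> (\<lambda>c. f c + g c) = \<phi> f + \<phi> g"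
    and act: "\<And>f g. lin f \<Longrightarrow> g \<in> I \<Longrightarrow> \<phi> (conv f g) = lact f (\<phi> g)"
  shows "\<exists>x. \<forall>f\<in>I. \<phi> f = lact f x"
proof -
  note lI = left_idealD(1)[OF I]
  define L where "L = {f \<in> I. \<phi> f = 0}"
  have \<phi>0: "\<phi> (\<lambda>c. 0) = 0"
    using add[OF left_idealD(2)[OF I] left_idealD(2)[OF I]] by simp
  have L: "left_ideal L"
    unfolding left_ideal_def L_def
    using left_idealD[OF I] by (auto simp: \<phi>0 add act lact_simps(1))
  have I_rat: "f \<in> rational_closure L" if f: "f \<in> I" for f
  proof -
    obtain S where S: "finite S" "\<And>g. lin g \<Longrightarrow> \<forall>s\<in>S. g s = 0 \<Longrightarrow> lact g (\<phi> f) = 0"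
      using lact_finite[of "\<phi> f"] by metis
    have "conv g f \<in> L" if "lin g" "\<forall>s\<in>S. g s = 0" for g
      using S(2)[OF that] left_idealD(4)[OF I that(1) f] act[OF that(1) f] by (simp add: L_def)
    thus ?thesis using S(1) lI[OF f] unfolding rational_closure_def by blast
  qed
  obtain e where e: "e \<in> rational_closure L"
    "\<And>f. f \<in> rational_closure L \<Longrightarrow> (\<lambda>c. f c - conv f e c) \<in> L"
    using splitting_idempotent[OF split L] by metis
  obtain S where le: "lin e" and S: "finite S"
    "\<And>g. lin g \<Longrightarrow> \<forall>s\<in>S. g s = 0 \<Longrightarrow> conv g e \<in> L"
    using e(1) by (auto simp: rational_closure_def)
  let ?sc = "\<lambda>k f c. k * f c :: 'k"
  interpret F: vector_space "?sc :: 'k \<Rightarrow> ('c \<Rightarrow> 'k) \<Rightarrow> 'c \<Rightarrow> 'k" by (rule vector_space_functions)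
  have I_sub: "F.subspace I"
    using left_idealD(2,3)[OF I] left_ideal_scale[OF I]
    by (intro F.subspaceI) (simp_all add: zero_fun_def plus_fun_def)
  have \<phi>_scale: "\<phi> (\<lambda>c. k * f c) = scale k (\<phi> f)" if f: "f \<in> I" for k f
  proof (rule eq_if_functionals_eq)
    fix h :: "'c \<Rightarrow> 'k" assume h: "lin h"
    note lk = lin_scale[OF lin_counit, of k]
    have "\<phi> (\<lambda>c. k * f c) = lact (\<lambda>c. k * counit c) (\<phi> f)"
      using act[OF lk f] by (simp add: conv_scaled_counit lI[OF f])
    thus "h (\<phi> (\<lambda>c. k * f c)) = h (scale k (\<phi> f))"
      by (simp add: functional_lact[OF h lk] conv_scaled_counit[OF h] linD[OF h])
  qed
  have "\<exists>\<Lambda>. Vector_Spaces.linear ?sc (*) \<Lambda> \<and> (\<forall>f\<in>I. \<Lambda> f = counit (\<phi> f))"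
    by (rule linear_functional_extension[OF vector_space_functions I_sub])
      (simp_all add: plus_fun_def add \<phi>_scale linD[OF lin_counit])
  then obtain \<Lambda> where \<Lambda>: "Vector_Spaces.linear ?sc (*) \<Lambda>" "\<forall>f\<in>I. \<Lambda> f = counit (\<phi> f)"
    by (elim exE conjE)
  have \<Lambda>_add: "\<Lambda> (\<lambda>c. f c + g c) = \<Lambda> f + \<Lambda> g" and \<Lambda>_scl: "\<Lambda> (\<lambda>c. k * f c) = k * \<Lambda> f" for f g k
    using \<Lambda>(1) by (simp_all add: Vector_Spaces.linear_iff plus_fun_def)
  have \<Lambda>_L: "\<Lambda> f = 0" if "f \<in> L" for f
    using that \<Lambda>(2) linD(4)[OF lin_counit] by (simp add: L_def)
  have "\<exists>x. \<forall>f. lin f \<longrightarrow> \<Lambda> (conv f e) = f x"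
    by (rule functional_on_dual_is_evaluation[OF S(1)])
      (simp_all add: \<Lambda>_L S(2) conv_add_left[OF _ _ le] conv_scale(1)[OF _ le] \<Lambda>_add \<Lambda>_scl)
  then obtain x where x: "\<And>f. lin f \<Longrightarrow> \<Lambda> (conv f e) = f x" by blast
  have "\<phi> r = lact r x" if r: "r \<in> I" for r
  proof (rule eq_if_functionals_eq)
    fix f :: "'c \<Rightarrow> 'k" assume f: "lin f"
    note lr = lI[OF r]
    have fr: "conv f r \<in> I" by (rule left_idealD(4)[OF I f r])
    have "(\<lambda>c. conv f r c - conv (conv f r) e c) \<in> L" by (rule e(2)[OF I_rat[OF fr]])
    hence "\<Lambda> (\<lambda>c. conv f r c - conv (conv f r) e c) = 0" by (rule \<Lambda>_L)
    hence "\<Lambda> (conv f r) = \<Lambda> (conv (conv f r) e)"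
      using \<Lambda>_add[of "\<lambda>c. conv f r c - conv (conv f r) e c" "conv (conv f r) e"] by simp
    also have "\<dots> = f (lact r x)" using x[OF lin_conv[OF f lr]] functional_lact[OF f lr] by simp
    finally have "f (lact r x) = counit (\<phi> (conv f r))" using \<Lambda>(2) fr by simp
    also have "\<dots> = f (\<phi> r)"
      by (simp add: act[OF f r] functional_lact[OF lin_counit f] conv_counit_left[OF f])
    finally show "f (\<phi> r) = f (lact r x)" by simp
  qed
  thus ?thesis by blast
qed

lemma C_as_left_module_simps [simp]:
  "carrier C_as_left_module = UNIV" "\<zero>\<^bsub>C_as_left_module\<^esub> = 0"
  "x \<oplus>\<^bsub>C_as_left_module\<^esub> y = x + y" "f \<odot>\<^bsub>C_as_left_module\<^esub> x = lact f x"
  by (simp_all add: C_as_left_module_def lact_def)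

lemma left_module_C: "left_module dual_algebra C_as_left_module"
proof (intro left_module.intro left_module_axioms.intro)
  show "ring dual_algebra" by (rule ring_dual_algebra)
  show "abelian_group C_as_left_module"
  proof (rule abelian_groupI)
    fix x
    show "\<exists>y\<in>carrier C_as_left_module. y \<oplus>\<^bsub>C_as_left_module\<^esub> x = \<zero>\<^bsub>C_as_left_module\<^esub>"
      by (auto intro: exI[of _ "- x"])
  qed (simp_all add: algebra_simps)
next
  fix a x y assume "a \<in> carrier dual_algebra"
  thus "a \<odot>\<^bsub>C_as_left_module\<^esub> (x \<oplus>\<^bsub>C_as_left_module\<^esub> y)
      = a \<odot>\<^bsub>C_as_left_module\<^esub> x \<oplus>\<^bsub>C_as_left_module\<^esub> a \<odot>\<^bsub>C_as_left_module\<^esub> y"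
    by (simp add: lact_simps(2))
qed (simp_all add: lact_add lact_lact lact_counit)

text \<open>Baer's argument: in a maximal partial extension, an element \<open>b\<close> outside the domain gives a left
ideal \<open>I\<close> of scalars that carry \<open>b\<close> into the domain.  The induced homomorphism on \<open>I\<close> is given by an
element \<open>x\<close>, and sending \<open>b\<close> to \<open>x\<close> enlarges the domain.  Partial homomorphisms are represented by
their graphs, for which unions of chains are immediate.\<close>

lemma injective_if_splitting:
  assumes split: "left_finite_Rat_splitting"
  shows "injective_module TYPE('a) TYPE('b) dual_algebra C_as_left_module"
  unfolding injective_module_def
proof (intro conjI allI impI)
  show "left_module dual_algebra C_as_left_module" by (rule left_module_C)
  fix A :: "('c \<Rightarrow> 'k, 'a) module" and B :: "('c \<Rightarrow> 'k, 'b) module" (structure) and i g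
  assume A: "left_module dual_algebra A" and B: "left_module dual_algebra B"
    and i: "i \<in> module_homs dual_algebra A B" and inj: "inj_on i (carrier A)"
    and g: "g \<in> module_homs dual_algebra A C_as_left_module"
  interpret A: left_module dual_algebra A by (rule A)
  interpret B: left_module dual_algebra B by (rule B)
  have smB: "f \<odot> y \<in> carrier B" if "lin f" "y \<in> carrier B" for f y
    using B.smult_closed that by simp
  \<comment> \<open>Graphs of homomorphisms from a submodule of \<open>B\<close> to \<open>C\<close> that extend \<open>g\<close>.\<close>
  define \<G> where "\<G> = {G. G \<subseteq> carrier B \<times> UNIV \<and> (\<lambda>x. (i x, g x)) ` carrier A \<subseteq> G \<and>
    (\<forall>y c y' c'. (y, c) \<in> G \<longrightarrow> (y', c') \<in> G \<longrightarrow> (y \<oplus> y', c + c') \<in> G) \<and>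
    (\<forall>f y c. lin f \<longrightarrow> (y, c) \<in> G \<longrightarrow> (f \<odot> y, lact f c) \<in> G) \<and>
    (\<forall>c. (\<zero>, c) \<in> G \<longrightarrow> c = 0)}"
  have GD: "G \<subseteq> carrier B \<times> UNIV" "x \<in> carrier A \<Longrightarrow> (i x, g x) \<in> G"
    "(y, c) \<in> G \<Longrightarrow> (y', c') \<in> G \<Longrightarrow> (y \<oplus> y', c + c') \<in> G"
    "lin f \<Longrightarrow> (y, c) \<in> G \<Longrightarrow> (f \<odot> y, lact f c) \<in> G"
    "(\<zero>, c) \<in> G \<Longrightarrow> c = 0"
    if "G \<in> \<G>" for G x y c y' c' f
    using that unfolding \<G>_def by (blast, blast, blast, blast, blast)
  let ?G0 = "(\<lambda>x. (i x, g x)) ` carrier A"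
  have i0: "i \<zero>\<^bsub>A\<^esub> = \<zero>"
  proof -
    have "i (\<zero>\<^bsub>dual_algebra\<^esub> \<odot>\<^bsub>A\<^esub> \<zero>\<^bsub>A\<^esub>) = \<zero>\<^bsub>dual_algebra\<^esub> \<odot> i \<zero>\<^bsub>A\<^esub>"
      by (rule module_homsD(3)[OF i A.R.zero_closed A.M.zero_closed])
    thus ?thesis
      using A.smult_zero_left[OF A.M.zero_closed] B.smult_zero_left[OF module_homsD(1)[OF i A.M.zero_closed]]
      by simp
  qed
  have g0: "g \<zero>\<^bsub>A\<^esub> = 0"
    using module_homsD(2)[OF g A.M.zero_closed A.M.zero_closed] by simp
  have "?G0 \<in> \<G>"
    unfolding \<G>_def
  proof (intro CollectI conjI allI impI)
    show "?G0 \<subseteq> carrier B \<times> UNIV" using module_homsD(1)[OF i] by auto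
  next
    fix y c y' c' assume "(y, c) \<in> ?G0" "(y', c') \<in> ?G0"
    then obtain x x' where x: "x \<in> carrier A" "y = i x" "c = g x"
      and x': "x' \<in> carrier A" "y' = i x'" "c' = g x'" by auto
    have "(y \<oplus> y', c + c') = (i (x \<oplus>\<^bsub>A\<^esub> x'), g (x \<oplus>\<^bsub>A\<^esub> x'))"
      using module_homsD(2)[OF i x(1) x'(1)] module_homsD(2)[OF g x(1) x'(1)] x x' by simp
    thus "(y \<oplus> y', c + c') \<in> ?G0" using x(1) x'(1) by simp
  next
    fix f y c assume f: "lin f" and "(y, c) \<in> ?G0"
    then obtain x where x: "x \<in> carrier A" "y = i x" "c = g x" by auto
    have fc: "f \<in> carrier dual_algebra" using f by simp
    have "(f \<odot> y, lact f c) = (i (f \<odot>\<^bsub>A\<^esub> x), g (f \<odot>\<^bsub>A\<^esub> x))"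
      using module_homsD(3)[OF i fc x(1)] module_homsD(3)[OF g fc x(1)] x by simp
    moreover have "f \<odot>\<^bsub>A\<^esub> x \<in> carrier A" by (rule A.smult_closed[OF fc x(1)])
    ultimately show "(f \<odot> y, lact f c) \<in> ?G0" by simp
  next
    fix c assume "(\<zero>, c) \<in> ?G0"
    then obtain x where x: "x \<in> carrier A" "i x = \<zero>" "c = g x" by auto
    have "x = \<zero>\<^bsub>A\<^esub>" by (rule inj_onD[OF inj]) (use x i0 in auto)
    thus "c = 0" using x(3) g0 by simp
  qed simp
  moreover have "\<Union>\<C> \<in> \<G>" if ne: "\<C> \<noteq> {}" and ch: "subset.chain \<G> \<C>" for \<C>
  proof -
    have sub: "\<And>G. G \<in> \<C> \<Longrightarrow> G \<in> \<G>" and tot: "\<And>G H. G \<in> \<C> \<Longrightarrow> H \<in> \<C> \<Longrightarrow> G \<subseteq> H \<or> H \<subseteq> G"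
      using ch unfolding subset_chain_def by auto
    show ?thesis
      unfolding \<G>_def
    proof (intro CollectI conjI allI impI)
      show "\<Union>\<C> \<subseteq> carrier B \<times> UNIV" by (rule Union_least) (rule GD(1)[OF sub])
      obtain G where "G \<in> \<C>" using ne by blast
      thus "?G0 \<subseteq> \<Union>\<C>" using GD(2)[OF sub] by blast
    next
      fix y c y' c' assume "(y, c) \<in> \<Union>\<C>" "(y', c') \<in> \<Union>\<C>"
      then obtain G H where GH: "G \<in> \<C>" "H \<in> \<C>" "(y, c) \<in> G" "(y', c') \<in> H" by blast
      then obtain J where J: "J \<in> \<C>" "(y, c) \<in> J" "(y', c') \<in> J" using tot[OF GH(1,2)] by blast
      from GD(3)[OF sub[OF J(1)] J(2,3)] J(1) show "(y \<oplus> y', c + c') \<in> \<Union>\<C>" by blast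
    next
      fix f y c assume f: "lin f" and "(y, c) \<in> \<Union>\<C>"
      then obtain J where J: "J \<in> \<C>" "(y, c) \<in> J" by blast
      from GD(4)[OF sub[OF J(1)] f J(2)] J(1) show "(f \<odot> y, lact f c) \<in> \<Union>\<C>" by blast
    next
      fix c assume "(\<zero>, c) \<in> \<Union>\<C>"
      then obtain J where J: "J \<in> \<C>" "(\<zero>, c) \<in> J" by blast
      show "c = 0" by (rule GD(5)[OF sub[OF J(1)] J(2)])
    qed
  qed
  ultimately have "\<exists>G\<in>\<G>. \<forall>H\<in>\<G>. G \<subseteq> H \<longrightarrow> H = G"
    by (intro subset_Zorn_nonempty) auto
  then obtain G where G: "G \<in> \<G>" and max: "\<And>H. H \<in> \<G> \<Longrightarrow> G \<subseteq> H \<Longrightarrow> H = G" by blast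
  note G_sub = GD(1)[OF G] and G_ext = GD(2)[OF G] and G_add = GD(3)[OF G]
    and G_act = GD(4)[OF G] and G_zero = GD(5)[OF G]
  have GB: "y \<in> carrier B" if "(y, c) \<in> G" for y c using G_sub that by auto
  have G00: "(\<zero>, 0) \<in> G" using G_ext[OF A.M.zero_closed] i0 g0 by simp
  have lm: "lin (\<lambda>c. - 1 * counit c)" by (rule lin_scale[OF lin_counit])
  have minus_one: "(\<lambda>c. - 1 * counit c) \<odot> y \<oplus> y = \<zero>" if y: "y \<in> carrier B" for y
  proof -
    have "(\<lambda>c. - 1 * counit c) \<odot> y \<oplus> counit \<odot> y = (\<lambda>c. - 1 * counit c + counit c) \<odot> y"
      using B.smult_l_distr[of "\<lambda>c. - 1 * counit c" counit y] lm lin_counit y by simp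
    also have "\<dots> = \<zero>" using B.smult_zero_left[OF y] by simp
    finally show ?thesis using B.smult_one[OF y] by simp
  qed
  have lact_minus: "lact (\<lambda>c. - 1 * counit c) x = - x" for x
  proof (rule eq_if_functionals_eq)
    fix h :: "'c \<Rightarrow> 'k" assume h: "lin h"
    have "h (lact (\<lambda>c. - 1 * counit c) x) = - 1 * h x"
      unfolding functional_lact[OF h lm] conv_scaled_counit(2)[OF h] ..
    thus "h (lact (\<lambda>c. - 1 * counit c) x) = h (- x)" using linD(2)[OF h, of 0 x] linD(4)[OF h] by simp
  qed
  have G_fun: "c = c'" if "(y, c) \<in> G" "(y, c') \<in> G" for y c c'
  proof -
    have "((\<lambda>c. - 1 * counit c) \<odot> y \<oplus> y, - c + c') \<in> G"
      using G_add[OF G_act[OF lm that(1)] that(2)] by (simp only: lact_minus)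
    hence "- c + c' = 0" unfolding minus_one[OF GB[OF that(1)]] by (rule G_zero)
    hence "c + (- c + c') = c" by (simp only: add_0_right)
    thus ?thesis by simp
  qed
  have total: "\<exists>c. (b, c) \<in> G" if b: "b \<in> carrier B" for b
  proof -
    define I where "I = {f. lin f \<and> (\<exists>c. (f \<odot> b, c) \<in> G)}"
    define \<phi> where "\<phi> f = (THE c. (f \<odot> b, c) \<in> G)" for f
    have \<phi>I: "\<phi> f = c" if "(f \<odot> b, c) \<in> G" for f c
      unfolding \<phi>_def by (rule the_equality) (rule that, rule G_fun[OF _ that])
    have \<phi>G: "(f \<odot> b, \<phi> f) \<in> G" if "f \<in> I" for f
      using that \<phi>I by (auto simp: I_def)
    have addG: "((\<lambda>c. f c + h c) \<odot> b, \<phi> f + \<phi> h) \<in> G" if "f \<in> I" "h \<in> I" for f h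
      using G_add[OF \<phi>G[OF that(1)] \<phi>G[OF that(2)]] B.smult_l_distr[of f h b] that b
      by (simp add: I_def)
    have actG: "(conv f h \<odot> b, lact f (\<phi> h)) \<in> G" if "lin f" "h \<in> I" for f h
      using G_act[OF that(1) \<phi>G[OF that(2)]] B.smult_assoc[of f h b] that b by (simp add: I_def)
    have I: "left_ideal I"
      unfolding left_ideal_def
    proof (intro conjI ballI allI impI)
      show "I \<subseteq> {f. lin f}" by (auto simp: I_def)
      show "(\<lambda>c. 0) \<in> I" using G00 B.smult_zero_left[OF b] lin_zero by (auto simp: I_def)
      show "(\<lambda>c. f c + h c) \<in> I" if "f \<in> I" "h \<in> I" for f h
        using addG[OF that] that lin_add by (auto simp: I_def)
      show "conv f h \<in> I" if "lin f" "h \<in> I" for f h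
        using actG[OF that] that lin_conv by (auto simp: I_def)
    qed
    obtain x where x: "\<forall>f\<in>I. \<phi> f = lact f x"
      using homomorphism_from_left_ideal_extends[OF split I, of \<phi>] \<phi>I[OF addG] \<phi>I[OF actG] by blast
    \<comment> \<open>The graph of the extension by \<open>b \<mapsto> x\<close>; it equals \<open>G\<close> by maximality.\<close>
    define H where "H = {(y \<oplus> r \<odot> b, c + lact r x) | y c r. (y, c) \<in> G \<and> lin r}"
    have HI: "(y \<oplus> r \<odot> b, c + lact r x) \<in> H" if "(y, c) \<in> G" "lin r" for y c r
      using that unfolding H_def by blast
    have lact_zero_fun: "lact (\<lambda>c. 0) x = 0" for x
      using lact_add[OF lin_zero lin_zero, of x] by simp
    have "G \<subseteq> H"
    proof
      fix p assume p: "p \<in> G"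
      obtain y c where yc: "p = (y, c)" by (cases p)
      have "(y \<oplus> (\<lambda>c. 0) \<odot> b, c + lact (\<lambda>c. 0) x) \<in> H" by (rule HI) (use p yc lin_zero in auto)
      moreover have "y \<oplus> (\<lambda>c. 0) \<odot> b = y"
        using B.smult_zero_left[OF b] GB p yc by simp
      ultimately show "p \<in> H" using yc by (simp add: lact_zero_fun)
    qed
    moreover have "H \<in> \<G>"
      unfolding \<G>_def
    proof (intro CollectI conjI allI impI)
      show "H \<subseteq> carrier B \<times> UNIV" using GB smB[OF _ b] by (auto simp: H_def)
      show "?G0 \<subseteq> H" using G_ext \<open>G \<subseteq> H\<close> by auto
    next
      fix y c y' c' assume "(y, c) \<in> H" "(y', c') \<in> H"
      then obtain u d r u' d' r' where u: "(u, d) \<in> G" "lin r" "y = u \<oplus> r \<odot> b" "c = d + lact r x"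
        and u': "(u', d') \<in> G" "lin r'" "y' = u' \<oplus> r' \<odot> b" "c' = d' + lact r' x"
        unfolding H_def by blast
      have "y \<oplus> y' = (u \<oplus> u') \<oplus> (\<lambda>c. r c + r' c) \<odot> b"
        using B.smult_l_distr[of r r' b] GB[OF u(1)] GB[OF u'(1)] smB[OF u(2) b] smB[OF u'(2) b] u(2) u'(2) b
        by (simp add: u(3) u'(3) B.M.a_ac)
      moreover have "c + c' = (d + d') + lact (\<lambda>c. r c + r' c) x"
        by (simp add: u(4) u'(4) lact_add u(2) u'(2) algebra_simps)
      ultimately show "(y \<oplus> y', c + c') \<in> H"
        using HI[OF G_add[OF u(1) u'(1)] lin_add[OF u(2) u'(2)]] by simp
    next
      fix f y c assume f: "lin f" and "(y, c) \<in> H"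
      then obtain u d r where u: "(u, d) \<in> G" "lin r" "y = u \<oplus> r \<odot> b" "c = d + lact r x"
        unfolding H_def by blast
      have "f \<odot> y = f \<odot> u \<oplus> conv f r \<odot> b"
        using B.smult_r_distr[of f u "r \<odot> b"] B.smult_assoc[of f r b] GB[OF u(1)] smB[OF u(2) b] u(2) f b
        by (simp add: u(3))
      moreover have "lact f c = lact f d + lact (conv f r) x"
        by (simp add: u(4) lact_simps(2)[OF f] lact_lact[OF f u(2)])
      ultimately show "(f \<odot> y, lact f c) \<in> H"
        using HI[OF G_act[OF f u(1)] lin_conv[OF f u(2)]] by simp
    next
      fix c assume "(\<zero>, c) \<in> H"
      then obtain u d r where u: "(u, d) \<in> G" "lin r" "\<zero> = u \<oplus> r \<odot> b" "c = d + lact r x"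
        unfolding H_def by blast
      note uc = GB[OF u(1)] and rc = smB[OF u(2) b]
      have m: "((\<lambda>c. - 1 * counit c) \<odot> u, - d) \<in> G"
        using G_act[OF lm u(1)] by (simp only: lact_minus)
      have "(\<lambda>c. - 1 * counit c) \<odot> u = r \<odot> b"
        using B.M.minus_equality[OF minus_one[OF uc] uc GB[OF m]]
          B.M.minus_equality[of "r \<odot> b" u] u(3) uc rc by (simp add: B.M.a_comm)
      hence rG: "(r \<odot> b, - d) \<in> G" using m by simp
      hence "r \<in> I" using u(2) by (auto simp: I_def)
      hence "lact r x = - d" using x \<phi>I[OF rG] by simp
      thus "c = 0" using u(4) by simp
    qed
    ultimately have HG: "H = G" by (intro max)
    have "(\<zero> \<oplus> counit \<odot> b, 0 + lact counit x) \<in> H" by (rule HI[OF G00 lin_counit])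
    hence "(b, x) \<in> G" using HG B.smult_one[OF b] b by (simp add: lact_counit)
    thus ?thesis by blast
  qed
  define h where "h b = (THE c. (b, c) \<in> G)" for b
  have hI: "h b = c" if "(b, c) \<in> G" for b c
    unfolding h_def by (rule the_equality) (rule that, rule G_fun[OF _ that])
  have hG: "(b, h b) \<in> G" if "b \<in> carrier B" for b using total[OF that] hI by auto
  show "\<exists>h\<in>module_homs dual_algebra B C_as_left_module. \<forall>x\<in>carrier A. h (i x) = g x"
  proof (intro bexI[of _ h] ballI)
    show "h (i x) = g x" if "x \<in> carrier A" for x by (rule hI[OF G_ext[OF that]])
    show "h \<in> module_homs dual_algebra B C_as_left_module"
      unfolding module_homs_def
      using hI[OF G_add[OF hG hG]] hI[OF G_act[OF _ hG]] by simp
  qed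
qed

section \<open>The coalgebra as a right module\<close>

lemma C_as_right_module_simps [simp]:
  "carrier C_as_right_module = UNIV" "\<zero>\<^bsub>C_as_right_module\<^esub> = 0"
  "x \<oplus>\<^bsub>C_as_right_module\<^esub> y = x + y" "f \<odot>\<^bsub>C_as_right_module\<^esub> x = ract f x"
  by (simp_all add: C_as_right_module_def ract_def)

lemma right_module_C: "right_module dual_algebra C_as_right_module"
proof (intro right_module.intro right_module_axioms.intro)
  show "ring dual_algebra" by (rule ring_dual_algebra)
  show "abelian_group C_as_right_module"
  proof (rule abelian_groupI)
    fix x
    show "\<exists>y\<in>carrier C_as_right_module. y \<oplus>\<^bsub>C_as_right_module\<^esub> x = \<zero>\<^bsub>C_as_right_module\<^esub>"
      by (auto intro: exI[of _ "- x"])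
  qed (simp_all add: algebra_simps)
next
  fix a x y assume "a \<in> carrier dual_algebra"
  thus "a \<odot>\<^bsub>C_as_right_module\<^esub> (x \<oplus>\<^bsub>C_as_right_module\<^esub> y)
      = a \<odot>\<^bsub>C_as_right_module\<^esub> x \<oplus>\<^bsub>C_as_right_module\<^esub> a \<odot>\<^bsub>C_as_right_module\<^esub> y"
    by (simp add: ract_simps(2))
qed (simp_all add: ract_add ract_ract ract_counit)

lemma submodule_imp_left_coideal:
  assumes "submodule X dual_algebra C_as_right_module"
  shows "left_coideal X"
proof -
  interpret X: submodule X dual_algebra C_as_right_module by (rule assms)
  have act: "ract f x \<in> X" if "lin f" "x \<in> X" for f x using X.smult_closed[of f x] that by simp
  have "subspace X"
  proof (rule subspaceI)
    show "0 \<in> X" using X.one_closed by simp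
    show "x + y \<in> X" if "x \<in> X" "y \<in> X" for x y using X.m_closed[OF that] by simp
    fix k x assume x: "x \<in> X"
    have "ract (\<lambda>c. k * counit c) x = scale k x" by (simp add: ract_scale[OF lin_counit] ract_counit)
    thus "scale k x \<in> X" using act[OF lin_scale[OF lin_counit] x] by metis
  qed
  thus ?thesis using act by (simp add: left_coideal_def)
qed

lemma left_subcomodule_imp_left_coideal:
  assumes "left_subcomodule X"
  shows "left_coideal X"
proof -
  have sub: "subspace X" and rep: "\<forall>c\<in>X. \<exists>t. keys t \<subseteq> UNIV \<times> X \<and> comult c = tensor_class C_space C_space t"
    using assms by (auto simp: left_subcomodule_def)
  have "ract f c \<in> X" if f: "lin f" and c: "c \<in> X" for f c
  proof -
    obtain t where t: "keys t \<subseteq> UNIV \<times> X" "comult c = tensor_class C_space C_space t"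
      using rep c by blast
    have "ract f c \<in> span X" by (rule ract_by_representative[OF t(2) f t(1)])
    thus ?thesis using sub by (simp add: span_eq_iff[THEN iffD2])
  qed
  thus ?thesis using sub by (simp add: left_coideal_def)
qed

lemma submodule_imp_left_ideal:
  assumes "submodule I dual_algebra (regular_left_module dual_algebra)"
  shows "left_ideal I"
proof -
  interpret I: submodule I dual_algebra "regular_left_module dual_algebra" by (rule assms)
  show ?thesis
    unfolding left_ideal_def
    using I.subset I.one_closed I.m_closed I.smult_closed
    by (auto simp: regular_left_module_def)
qed

end

theorem proposition1p4:
  fixes scale :: "'k::field \<Rightarrow> 'c::ab_group_add \<Rightarrow> 'c"
    and comult :: "'c \<Rightarrow> ('c \<times> 'c \<Rightarrow>\<^sub>0 'k) set"
    and counit :: "'c \<Rightarrow> 'k"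
  assumes "coalgebra scale comult counit"
    and "coalgebra.left_finite_Rat_splitting scale comult counit"
  shows "(coalgebra.artinian_as_left_comodule scale comult \<and>
      artinian_right_module (coalgebra.dual_algebra scale comult counit)
        (coalgebra.C_as_right_module scale comult)) \<and>
    left_noetherian_ring (coalgebra.dual_algebra scale comult counit) \<and>
    coalgebra.countable_dimension scale \<and>
    injective_module TYPE('a) TYPE('b) (coalgebra.dual_algebra scale comult counit)
      (coalgebra.C_as_left_module scale comult)"
proof -
  interpret coalgebra scale comult counit by fact
  note split = assms(2)
  note dcc = left_coideal_descending_chain_condition[OF split]
  have "artinian_as_left_comodule"
    unfolding artinian_as_left_comodule_def
    by (rule descending_chain_condition_mono[OF dcc]) (auto intro: left_subcomodule_imp_left_coideal)
  moreover have "artinian_right_module dual_algebra C_as_right_module"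
    unfolding artinian_right_module_def
    using right_module_C
    by (intro conjI descending_chain_condition_mono[OF dcc]) (auto intro: submodule_imp_left_coideal)
  moreover have "left_noetherian_ring dual_algebra"
    unfolding left_noetherian_ring_def ascending_chain_condition_def
    using ring_dual_algebra left_ideal_ascending_chain_condition[OF dcc] submodule_imp_left_ideal
    by (auto simp: ascending_chain_condition_def)
  ultimately show ?thesis
    using countable_dimension_if_splitting[OF split] injective_if_splitting[OF split] by simp
qed

end
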